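(* Let $n\ge 2$ and $d\ge 1$ be integers and let $I$ be a non-empty collection of subsets of $[n]=\{0,1,\dots,n-1\}$ such that $\mathrm{card}(\sigma)\ge 2$ for all $\sigma\in I$. Then the stabilization map $s_d:\mathrm{Hol}_d^*(S^2,X_I)\to\mathrm{Hol}_{d+1}^*(S^2,X_I)$ is a homology equivalence through dimension $D(I;d)=(2r_{\min}(I)-3)d-2$.
   Context: For $\sigma\subset[n]$ put $L_\sigma=\{(x_0,\dots,x_{n-1})\in\mathbb{C}^n: x_i=0 \text{ for all } i\in\sigma\}$, $L(I)=\bigcup_{\sigma\in I}L_\sigma$, and $X_I=(\mathbb{C}^n\setminus L(I))/\mathbb{C}^*$ (scalar action). Put $r_{\min}(I)=\min\{\mathrm{card}(\sigma):\sigma\in I\}$. $\mathrm{Hol}_d^*(S^2,X_I)$ is the space of based holomorphic maps $(S^2,\infty)\to(X_I,[1:\cdots:1])$ of degree $d$, where $S^2=\mathbb{C}\cup\{\infty\}$; it is identified with the space of $n$-tuples $(f_0,\dots,f_{n-1})$ of monic polynomials in $\mathbb{C}[z]$ of degree $d$ such that for every $\sigma\in I$ the polynomials $\{f_j\}_{j\in\sigma}$ have no common root. Stabilization map. For a space $X$, $\mathrm{SP}^d(X)=X^d/S_d$ is the $d$-th symmetric product, whose elements are written as formal sums $\sum n_kx_k$ of distinct points with positive multiplicities summing to $d$. Let $E_d^I(X)=\{(\xi_0,\dots,\xi_{n-1})\in\mathrm{SP}^d(X)^n:\bigcap_{j\in\sigma}\xi_j=\emptyset\text{ for any }\sigma\in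 I\}$ (intersection of supports). Sending a monic polynomial $\prod(z-x_k)^{n_k}$ to $\sum n_kx_k$ gives a homeomorphism $\mathrm{Hol}_d^*(S^2,X_I)\cong E_d^I(\mathbb{C})$. Let $U_d=\{x\in\mathbb{C}:\mathrm{Re}(x)<d\}\cong\mathbb{C}$, choose $n$ distinct points $x_{0;d},\dots,x_{n-1;d}$ with $d<\mathrm{Re}(x_{k;d})<d+1$, and define $\hat s_d:E_d^I(U_d)\to E_{d+1}^I(U_{d+1})$ by $\hat s_d(\xi_0,\dots,\xi_{n-1})=(\xi_0+x_{0;d},\dots,\xi_{n-1}+x_{n-1;d})$. The map $s_d$ is the composite $\mathrm{Hol}_d^*(S^2,X_I)\cong E_d^I(\mathbb{C})\cong E_d^I(U_d)\xrightarrow{\hat s_d}E_{d+1}^I(U_{d+1})\cong E_{d+1}^I(\mathbb{C})\cong\mathrm{Hol}_{d+1}^*(S^2,X_I)$; its homotopy class does not depend on the choice of the points $x_{k;d}$. A map $f:X\to Y$ is a homology equivalence through dimension $D$ if $f_*:H_k(X,\mathbb{Z})\to H_k(Y,\mathbb{Z})$ is an isomorphism for every $k\le D$. *)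

theory Defs
  imports "HOL-Homology.Homology" "HOL-Computational_Algebra.Computational_Algebra"
begin

text \<open>
  An \<open>n\<close>-tuple is an extensional function on \<open>{..<n}\<close>; the index set \<open>[n]\<close> is \<open>{..<n}\<close>.
\<close>

section \<open>The space of based holomorphic maps\<close>

definition coord_subspace :: "nat \<Rightarrow> nat set \<Rightarrow> (nat \<Rightarrow> complex) set" where
  "coord_subspace n \<sigma> = {x \<in> {..<n} \<rightarrow>\<^sub>E UNIV. \<forall>i\<in>\<sigma>. x i = 0}"

definition arrangement :: "nat \<Rightarrow> nat set set \<Rightarrow> (nat \<Rightarrow> complex) set" where
  "arrangement n I = (\<Union>\<sigma>\<in>I. coord_subspace n \<sigma>)"

definition r_min :: "nat set set \<Rightarrow> nat" where
  "r_min I = Min (card ` I)"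

definition monic_polys :: "nat \<Rightarrow> complex poly set" where
  "monic_polys d = {p. lead_coeff p = 1 \<and> degree p = d}"

text \<open>
  A monic polynomial of degree \<open>d\<close> is determined by its \<open>d\<close> lower coefficients, so that the
  space of such polynomials carries the topology of \<open>d\<close>-dimensional complex space.
\<close>

definition monic_poly_space :: "nat \<Rightarrow> complex poly topology" where
  "monic_poly_space d =
     pullback_topology (monic_polys d) (\<lambda>p. restrict (poly.coeff p) {..<d})
       (product_topology (\<lambda>_. euclidean) {..<d})"

text \<open>
  A based holomorphic map of degree \<open>d\<close> from the Riemann sphere to the quotient of the
  complement of \<open>arrangement n I\<close> by the scalar action, sending \<open>\<infinity>\<close> to \<open>[1:\<dots>:1]\<close>, is identified
  with the tuple of monic polynomials of degree \<open>d\<close> which represents it on the finite part of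
  the sphere.
\<close>

definition hol_space :: "nat \<Rightarrow> nat set set \<Rightarrow> nat \<Rightarrow> (nat \<Rightarrow> complex poly) topology" where
  "hol_space n I d =
     subtopology (product_topology (\<lambda>_. monic_poly_space d) {..<n})
       {f. \<forall>\<sigma>\<in>I. \<not> (\<exists>z. \<forall>j\<in>\<sigma>. poly (f j) z = 0)}"

lemma topspace_monic_poly_space: "topspace (monic_poly_space d) = monic_polys d"
  by (auto simp: monic_poly_space_def topspace_pullback_topology)

lemma topspace_hol_space:
  "topspace (hol_space n I d) =
     {f \<in> {..<n} \<rightarrow>\<^sub>E monic_polys d. \<forall>\<sigma>\<in>I. \<not> (\<exists>z. \<forall>j\<in>\<sigma>. poly (f j) z = 0)}"
  by (auto simp: hol_space_def topspace_subtopology topspace_monic_poly_space)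

lemma hol_space_avoids_arrangement:
  assumes "I \<subseteq> Pow {..<n}"
  shows "topspace (hol_space n I d) =
     {f \<in> {..<n} \<rightarrow>\<^sub>E monic_polys d. \<forall>z. (\<lambda>i\<in>{..<n}. poly (f i) z) \<notin> arrangement n I}"
proof -
  have "(\<forall>j\<in>\<sigma>. (\<lambda>i\<in>{..<n}. poly (f i) z) j = 0) \<longleftrightarrow> (\<forall>j\<in>\<sigma>. poly (f j) z = 0)"
    if "\<sigma> \<in> I" for \<sigma> z and f :: "nat \<Rightarrow> complex poly"
    using assms that by (intro ball_cong) auto
  then show ?thesis
    unfolding topspace_hol_space arrangement_def coord_subspace_def by auto
qed

section \<open>The stabilization map\<close>

text \<open>
  Elements of a symmetric product are multisets. The symmetric products and the configuration
  spaces below serve only to describe the stabilization map as a composite of functions, hence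
  they are given as sets; the spaces compared in homology are the spaces \<open>hol_space n I d\<close>.
\<close>

definition sym_prod :: "nat \<Rightarrow> 'a set \<Rightarrow> 'a multiset set" where
  "sym_prod d X = {\<xi>. set_mset \<xi> \<subseteq> X \<and> size \<xi> = d}"

definition config_set ::
    "nat \<Rightarrow> nat set set \<Rightarrow> nat \<Rightarrow> 'a set \<Rightarrow> (nat \<Rightarrow> 'a multiset) set" where
  "config_set n I d X =
     {\<xi> \<in> {..<n} \<rightarrow>\<^sub>E sym_prod d X. \<forall>\<sigma>\<in>I. (\<Inter>j\<in>\<sigma>. set_mset (\<xi> j)) = {}}"

definition half_plane :: "nat \<Rightarrow> complex set" where
  "half_plane d = {x. Re x < real d}"

definition roots_map :: "nat \<Rightarrow> (nat \<Rightarrow> complex poly) \<Rightarrow> nat \<Rightarrow> complex multiset" where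
  "roots_map n f = (\<lambda>i\<in>{..<n}. proots (f i))"

definition poly_map :: "nat \<Rightarrow> (nat \<Rightarrow> complex multiset) \<Rightarrow> nat \<Rightarrow> complex poly" where
  "poly_map n \<xi> = (\<lambda>i\<in>{..<n}. \<Prod>x\<in>#\<xi> i. [:- x, 1:])"

definition config_image :: "nat \<Rightarrow> ('a \<Rightarrow> 'b) \<Rightarrow> (nat \<Rightarrow> 'a multiset) \<Rightarrow> nat \<Rightarrow> 'b multiset" where
  "config_image n \<phi> \<xi> = (\<lambda>i\<in>{..<n}. image_mset \<phi> (\<xi> i))"

definition add_points :: "nat \<Rightarrow> (nat \<Rightarrow> 'a) \<Rightarrow> (nat \<Rightarrow> 'a multiset) \<Rightarrow> nat \<Rightarrow> 'a multiset" where
  "add_points n x \<xi> = (\<lambda>i\<in>{..<n}. add_mset (x i) (\<xi> i))"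

text \<open>
  In the stabilization map in degree \<open>d\<close>, the functions \<open>\<phi>\<close> and \<open>\<psi>\<close> are homeomorphisms from the
  complex plane onto \<open>half_plane d\<close> and \<open>half_plane (Suc d)\<close>.
\<close>

definition stab_map ::
    "nat \<Rightarrow> (complex \<Rightarrow> complex) \<Rightarrow> (complex \<Rightarrow> complex) \<Rightarrow> (nat \<Rightarrow> complex) \<Rightarrow>
      (nat \<Rightarrow> complex poly) \<Rightarrow> nat \<Rightarrow> complex poly" where
  "stab_map n \<phi> \<psi> x =
     poly_map n \<circ> config_image n (inv_into UNIV \<psi>) \<circ> add_points n x \<circ> config_image n \<phi> \<circ> roots_map n"

lemma proots_prod_linear: "proots (\<Prod>x\<in>#A. [:- x, 1:]) = (A :: complex multiset)"
proof (induction A)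
  case (add x A)
  have "(\<Prod>x\<in>#A. [:- x, 1:]) \<noteq> 0" by (auto simp: prod_mset_zero_iff)
  with add show ?case by (simp add: proots_mult del: mult_pCons_left)
qed simp

lemma monic_polys_prod_linear:
  "(\<Prod>x\<in>#A. [:- x, 1:]) \<in> monic_polys (size (A :: complex multiset))"
proof -
  have "lead_coeff (\<Prod>x\<in>#A. [:- x, 1:]) = 1"
  proof (induction A)
    case (add x A)
    have "lead_coeff (\<Prod>x\<in>#add_mset x A. [:- x, 1:])
        = lead_coeff [:- x, 1:] * lead_coeff (\<Prod>x\<in>#A. [:- x, 1:])"
      by (simp only: image_mset_add_mset prod_mset.add_mset lead_coeff_mult)
    also have "\<dots> = 1" unfolding add.IH by simp
    finally show ?case .
  qed simp
  moreover have "degree (\<Prod>x\<in>#A. [:- x, 1:]) = size A"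
    using size_proots_complex[of "\<Prod>x\<in>#A. [:- x, 1:]"] by (simp only: proots_prod_linear)
  ultimately show ?thesis by (simp only: monic_polys_def mem_Collect_eq)
qed

lemma set_proots_monic: "p \<in> monic_polys d \<Longrightarrow> set_mset (proots p) = {z. poly p z = 0}"
  by (intro set_count_proots) (auto simp: monic_polys_def)

lemma poly_map_hol_space:
  assumes "I \<subseteq> Pow {..<n}" and \<xi>: "\<xi> \<in> config_set n I d UNIV"
  shows "poly_map n \<xi> \<in> topspace (hol_space n I d)"
proof -
  have m: "poly_map n \<xi> i \<in> monic_polys d" "proots (poly_map n \<xi> i) = \<xi> i" if "i < n" for i
    using that \<xi> monic_polys_prod_linear[of "\<xi> i"]
    by (auto simp: poly_map_def proots_prod_linear config_set_def sym_prod_def PiE_iff)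
  have "\<not> (\<exists>z. \<forall>j\<in>\<sigma>. poly (poly_map n \<xi> j) z = 0)" if "\<sigma> \<in> I" for \<sigma>
  proof -
    have "(\<Inter>j\<in>\<sigma>. set_mset (\<xi> j)) = (\<Inter>j\<in>\<sigma>. {z. poly (poly_map n \<xi> j) z = 0})"
    proof (intro INF_cong refl)
      fix j assume "j \<in> \<sigma>"
      then have "j < n" using assms that by auto
      then show "set_mset (\<xi> j) = {z. poly (poly_map n \<xi> j) z = 0}"
        using m set_proots_monic by metis
    qed
    then show ?thesis using \<xi> that by (auto simp: config_set_def)
  qed
  then show ?thesis
    using m by (auto simp: topspace_hol_space poly_map_def PiE_iff)
qed

lemma bij_betw_roots_map:
  assumes "I \<subseteq> Pow {..<n}"
  shows "bij_betw (roots_map n) (topspace (hol_space n I d)) (config_set n I d UNIV)"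
proof (rule bij_betw_byWitness[where f' = "poly_map n"])
  have inv: "(\<Prod>x\<in>#proots p. [:- x, 1:]) = p" if "p \<in> monic_polys d" for p
  proof -
    have "lead_coeff p = 1" using that unfolding monic_polys_def by blast
    then show ?thesis using complex_poly_decompose_multiset[of p] by (simp only: smult_1_left)
  qed
  show "\<forall>f\<in>topspace (hol_space n I d). poly_map n (roots_map n f) = f"
    unfolding topspace_hol_space
    by (auto simp: poly_map_def roots_map_def inv PiE_iff extensional_def)
  show "\<forall>\<xi>\<in>config_set n I d UNIV. roots_map n (poly_map n \<xi>) = \<xi>"
    by (auto simp: poly_map_def roots_map_def config_set_def proots_prod_linear PiE_iff
        extensional_def)
  show "roots_map n ` topspace (hol_space n I d) \<subseteq> config_set n I d UNIV"
  proof clarify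
    fix f assume f: "f \<in> topspace (hol_space n I d)"
    then have fm: "f i \<in> monic_polys d" if "i < n" for i
      using that by (auto simp: topspace_hol_space)
    have "(\<Inter>j\<in>\<sigma>. set_mset (roots_map n f j)) = {}" if "\<sigma> \<in> I" for \<sigma>
    proof -
      have "(\<Inter>j\<in>\<sigma>. set_mset (roots_map n f j)) = (\<Inter>j\<in>\<sigma>. {z. poly (f j) z = 0})"
      proof (intro INF_cong refl)
        fix j assume "j \<in> \<sigma>"
        then have "j < n" using assms that by auto
        then show "set_mset (roots_map n f j) = {z. poly (f j) z = 0}"
          using set_proots_monic[OF fm] by (simp add: roots_map_def)
      qed
      moreover have "\<not> (\<exists>z. \<forall>j\<in>\<sigma>. poly (f j) z = 0)"
        using f that unfolding topspace_hol_space by blast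
      ultimately show ?thesis by auto
    qed
    moreover have "roots_map n f \<in> {..<n} \<rightarrow>\<^sub>E sym_prod d UNIV"
      using fm by (auto simp: roots_map_def sym_prod_def size_proots_complex monic_polys_def)
    ultimately show "roots_map n f \<in> config_set n I d UNIV"
      by (auto simp: config_set_def)
  qed
  show "poly_map n ` config_set n I d UNIV \<subseteq> topspace (hol_space n I d)"
    using poly_map_hol_space[OF assms] by blast
qed

lemma config_image_config_set:
  assumes "I \<subseteq> Pow {..<n}" "{} \<notin> I" "inj_on \<phi> X" "\<phi> ` X \<subseteq> Y" "\<xi> \<in> config_set n I d X"
  shows "config_image n \<phi> \<xi> \<in> config_set n I d Y"
proof -
  have sub: "set_mset (\<xi> i) \<subseteq> X" "size (\<xi> i) = d" if "i < n" for i
    using assms(5) that by (auto simp: config_set_def sym_prod_def PiE_iff)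
  have "(\<Inter>j\<in>\<sigma>. set_mset (config_image n \<phi> \<xi> j)) = {}" if "\<sigma> \<in> I" for \<sigma>
  proof -
    have \<sigma>: "\<sigma> \<noteq> {}" "\<And>j. j \<in> \<sigma> \<Longrightarrow> j < n" using assms(1,2) that by auto
    have "(\<Inter>j\<in>\<sigma>. set_mset (config_image n \<phi> \<xi> j)) = (\<Inter>j\<in>\<sigma>. \<phi> ` set_mset (\<xi> j))"
      using \<sigma> by (intro INF_cong) (auto simp: config_image_def)
    also have "\<dots> = \<phi> ` (\<Inter>j\<in>\<sigma>. set_mset (\<xi> j))"
    proof -
      obtain k where k: "k \<in> \<sigma>" using \<sigma>(1) by blast
      have "\<forall>j\<in>\<sigma>. set_mset (\<xi> j) \<subseteq> X" using \<sigma>(2) sub(1) by blast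
      then show ?thesis by (rule image_INT[OF assms(3) _ k, symmetric])
    qed
    finally show ?thesis using assms(5) that by (simp add: config_set_def)
  qed
  moreover have "config_image n \<phi> \<xi> \<in> {..<n} \<rightarrow>\<^sub>E sym_prod d Y"
  proof (rule PiE_I)
    fix i assume "i \<in> {..<n}"
    then have i: "i < n" by simp
    have "\<phi> ` set_mset (\<xi> i) \<subseteq> Y" using sub(1)[OF i] assms(4) by blast
    then show "config_image n \<phi> \<xi> i \<in> sym_prod d Y"
      using sub(2)[OF i] i by (simp add: config_image_def sym_prod_def)
  qed (simp add: config_image_def)
  ultimately show ?thesis by (simp add: config_set_def)
qed

lemma add_points_config_set:
  assumes "I \<subseteq> Pow {..<n}" "\<And>\<sigma>. \<sigma> \<in> I \<Longrightarrow> card \<sigma> \<ge> 2" "inj_on x {..<n}"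
    and "\<And>k. k < n \<Longrightarrow> real d < Re (x k) \<and> Re (x k) < real d + 1"
    and "\<xi> \<in> config_set n I d (half_plane d)"
  shows "add_points n x \<xi> \<in> config_set n I (Suc d) (half_plane (Suc d))"
proof -
  have sub: "set_mset (\<xi> i) \<subseteq> half_plane d" "size (\<xi> i) = d" if "i < n" for i
    using assms(5) that by (auto simp: config_set_def sym_prod_def PiE_iff)
  have xn: "x k \<notin> set_mset (\<xi> i)" if "i < n" "k < n" for i k
    using sub(1)[OF that(1)] assms(4)[OF that(2)] by (force simp: half_plane_def)
  have "(\<Inter>j\<in>\<sigma>. set_mset (add_points n x \<xi> j)) = {}" if "\<sigma> \<in> I" for \<sigma>
  proof (rule ccontr)
    assume "(\<Inter>j\<in>\<sigma>. set_mset (add_points n x \<xi> j)) \<noteq> {}"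
    then obtain z where z: "\<And>j. j \<in> \<sigma> \<Longrightarrow> z \<in># add_points n x \<xi> j" by blast
    have \<sigma>: "\<And>j. j \<in> \<sigma> \<Longrightarrow> j < n" using assms(1) that by auto
    have z': "z = x j \<or> z \<in># \<xi> j" if "j \<in> \<sigma>" for j
      using z[OF that] \<sigma>[OF that] by (auto simp: add_points_def)
    have "2 \<le> card \<sigma>" using assms(2) that by blast
    then obtain T where "T \<subseteq> \<sigma>" "card T = 2"
      by (meson obtain_subset_with_card_n)
    then obtain a b where ab: "a \<in> \<sigma>" "b \<in> \<sigma>" "a \<noteq> b"
      by (auto simp: card_2_iff)
    show False
    proof (cases "\<exists>j\<in>\<sigma>. z = x j")
      case True
      then obtain j where j: "j \<in> \<sigma>" "z = x j" by blast
      have *: "z = x k" if "k \<in> \<sigma>" for k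
        using z'[OF that] xn[OF \<sigma>[OF that] \<sigma>[OF j(1)]] j(2) by simp
      have "x a = x b" using *[OF ab(1)] *[OF ab(2)] by simp
      then show False using ab \<sigma> inj_onD[OF assms(3)] by simp
    next
      case False
      then have "z \<in> (\<Inter>j\<in>\<sigma>. set_mset (\<xi> j))" using z' by blast
      moreover have "(\<Inter>j\<in>\<sigma>. set_mset (\<xi> j)) = {}"
        using assms(5) that unfolding config_set_def by blast
      ultimately show False by blast
    qed
  qed
  moreover have "add_points n x \<xi> \<in> {..<n} \<rightarrow>\<^sub>E sym_prod (Suc d) (half_plane (Suc d))"
  proof (rule PiE_I)
    fix i assume "i \<in> {..<n}"
    then have i: "i < n" by simp
    have "half_plane d \<subseteq> half_plane (Suc d)" by (auto simp: half_plane_def)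
    moreover have "x i \<in> half_plane (Suc d)" using assms(4)[OF i] by (simp add: half_plane_def)
    ultimately show "add_points n x \<xi> i \<in> sym_prod (Suc d) (half_plane (Suc d))"
      using sub[OF i] i by (auto simp: add_points_def sym_prod_def)
  qed (simp add: add_points_def)
  ultimately show ?thesis by (simp add: config_set_def)
qed

lemma stab_map_hol_space:
  assumes "I \<subseteq> Pow {..<n}" "\<And>\<sigma>. \<sigma> \<in> I \<Longrightarrow> card \<sigma> \<ge> 2" "inj_on x {..<n}"
    and "\<And>k. k < n \<Longrightarrow> real d < Re (x k) \<and> Re (x k) < real d + 1"
    and "bij_betw \<phi> UNIV (half_plane d)" "bij_betw \<psi> UNIV (half_plane (Suc d))"
    and "f \<in> topspace (hol_space n I d)"
  shows "stab_map n \<phi> \<psi> x f \<in> topspace (hol_space n I (Suc d))"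
proof -
  have ne: "{} \<notin> I" using assms(2) by force
  have "roots_map n f \<in> config_set n I d UNIV"
    using bij_betwE[OF bij_betw_roots_map[OF assms(1)]] assms(7) by blast
  then have "config_image n \<phi> (roots_map n f) \<in> config_set n I d (half_plane d)"
    using assms(5) by (intro config_image_config_set[OF assms(1) ne]) (auto simp: bij_betw_def)
  then have "add_points n x (config_image n \<phi> (roots_map n f))
      \<in> config_set n I (Suc d) (half_plane (Suc d))"
    by (intro add_points_config_set[OF assms(1-4)])
  then have "config_image n (inv_into UNIV \<psi>) (add_points n x (config_image n \<phi> (roots_map n f)))
      \<in> config_set n I (Suc d) UNIV"
    using bij_betw_inv_into[OF assms(6)]
    by (intro config_image_config_set[OF assms(1) ne]) (auto simp: bij_betw_def)
  then show ?thesis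
    using poly_map_hol_space[OF assms(1)] by (simp add: stab_map_def)
qed

section \<open>Homology equivalences through a dimension\<close>

definition homology_equivalence_through ::
    "'a topology \<Rightarrow> 'b topology \<Rightarrow> ('a \<Rightarrow> 'b) \<Rightarrow> int \<Rightarrow> bool" where
  "homology_equivalence_through X Y f D \<longleftrightarrow>
     continuous_map X Y f \<and>
     (\<forall>k\<le>D. hom_induced k X {} Y {} f \<in> iso (homology_group k X) (homology_group k Y))"

end

theory Submission
  imports Defs "HOL-Analysis.Urysohn"
begin

text \<open>
  The proof adds one root to one component \<open>f\<^sub>i\<close> at a time, and therefore works with tuples of monic
  polynomials of varying degrees \<open>D j\<close>, subject to an arbitrary system \<open>J\<close> of index sets over which no
  common root is allowed. Up to homotopy, stabilization at \<open>i\<close> is the inclusion into this space \<open>X\<close> of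
  the open set of tuples for which \<open>f\<^sub>i\<close> has exactly one root, a simple one, in a right half plane
  while all other roots of all components lie in the complementary left half plane. Let \<open>K\<close> be the
  complement of that open set. The claim is that \<open>H\<^sub>q(X, X - K) = 0\<close> for \<open>q < (2r - 3) D i\<close>, where \<open>r\<close>
  is a lower bound for the cardinalities of the members of \<open>J\<close> containing \<open>i\<close>.

  This is shown by induction on \<open>D i\<close> and on the number of members of \<open>J\<close> containing \<open>i\<close>. If there are
  none, then \<open>f\<^sub>i\<close> is unconstrained and the inclusion is a homotopy equivalence. Otherwise drop a
  member \<open>\<sigma>\<close> containing \<open>i\<close> and stratify the resulting larger space by the degree \<open>k\<close> of the greatest
  common divisor \<open>h\<close> of the \<open>f\<^sub>j\<close> with \<open>j \<in> \<sigma>\<close>. The stratum of degree \<open>k\<close> is again a space of the same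
  kind, in the polynomials \<open>h\<close> and \<open>f\<^sub>j / h\<close>; it has complex codimension \<open>k (card \<sigma> - 1)\<close>, and \<open>D i\<close> has
  dropped by \<open>k\<close>.

  The Thom isomorphism of a stratum needs no tubular neighbourhood. After multiplication with the
  space of monic polynomials of degree \<open>k\<close>, replace the stratum by the graph of the map \<open>h\<close>. On the
  one hand \<open>h\<close> extends continuously by Tietze's theorem, so a shear moves the graph to the zero
  section. On the other hand division with remainder \<open>f\<^sub>j = h g\<^sub>j + t\<^sub>j\<close> gives global coordinates in
  which the graph is the locus \<open>t = 0\<close>. Both descriptions are suspensions.
\<close>

section \<open>Vanishing of homology along a closed set\<close>

text \<open>The factor \<open>2 r - 3\<close> balances two losses. A stratum of degree
  \<open>k\<close> has real codimension at least \<open>2 k (r - 1)\<close>, deleting it costs one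
  more degree in the exact sequence of a triple, and \<open>D i\<close> falls by \<open>k\<close>.
  The bound survives because \<open>2 k (r - 1) - 1 \<ge> (2 r - 3) k\<close> for
  \<open>k \<ge> 1\<close>, with equality at \<open>k = 1\<close>. Cardinalities are bounded only
  for members containing \<open>i\<close>, because the strata force this: if
  \<open>\<tau> \<in> J\<close> meets \<open>\<sigma>\<close>, then \<open>h\<close> and the
  \<open>f\<^sub>j\<close> with \<open>j \<in> \<tau> - \<sigma>\<close> must not share a root
  either. This index set may be a singleton, but it never contains \<open>i\<close>. The other
  obstacle is that the topology is that of the coefficients, whereas most deformations are given on
  the roots. The bridge is the map from ordered roots to coefficients. Roots are bounded in terms of
  coefficients, so the map is proper, and properness, unlike being a quotient map, survives products
  with parameter spaces. The same map shows that the common divisor on a stratum is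
  continuous.\<close>

lemma continuous_map_fst_comp: "continuous_map X Z g \<Longrightarrow> continuous_map (prod_topology X Y) Z (\<lambda>p. g (fst p))"
  using continuous_map_compose[OF continuous_map_fst] by (simp add: o_def)

lemma continuous_map_snd_comp: "continuous_map Y Z g \<Longrightarrow> continuous_map (prod_topology X Y) Z (\<lambda>p. g (snd p))"
  using continuous_map_compose[OF continuous_map_snd] by (simp add: o_def)

text \<open>Vanishing of the local homology along \<open>K\<close>. For closed \<open>K\<close> it
  depends only on an open neighbourhood of \<open>K\<close>, which is why statements are phrased in
  terms of \<open>K\<close> and not of its complement. The degree is an integer so that shifts may
  become negative, where the predicate holds trivially.\<close>

definition null_along :: "int \<Rightarrow> 'a topology \<Rightarrow> 'a set \<Rightarrow> bool" where
  "null_along q X K \<longleftrightarrow> trivial_group (relative_homology_group q X (topspace X - K))"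

lemma iso_imp_trivial_group_iff:
  assumes "h \<in> iso G H" "group G" "group H"
  shows "trivial_group G \<longleftrightarrow> trivial_group H"
  using assms isomorphic_group_triviality is_isoI by blast

lemma null_along_negative: "q < 0 \<Longrightarrow> null_along q X K"
  by (simp add: null_along_def)

lemma null_along_empty: "null_along q X {}"
  by (simp add: null_along_def trivial_relative_homology_group_topspace)

lemma null_along_homeomorphic:
  assumes "homeomorphic_map X Y f" "K \<subseteq> topspace X"
  shows "null_along q X K \<longleftrightarrow> null_along q Y (f ` K)"
proof -
  have f: "f ` topspace X = topspace Y" "inj_on f (topspace X)"
    using assms(1) by (auto simp: homeomorphic_eq_everything_map)
  have "f ` (topspace X - K) = topspace Y - f ` K"
    using f assms(2) by (metis inj_on_image_set_diff order_refl Diff_subset)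
  then have "hom_induced q X (topspace X - K) Y (topspace Y - f ` K) f
      \<in> iso (relative_homology_group q X (topspace X - K)) (relative_homology_group q Y (topspace Y - f ` K))"
    by (intro homeomorphic_map_relative_homology_iso assms) auto
  then show ?thesis
    unfolding null_along_def by (intro iso_imp_trivial_group_iff) auto
qed

text \<open>The closed set \<open>topspace X - N\<close> lies in the open set
  \<open>topspace X - K\<close> and is excised.\<close>

lemma null_along_subtopology_open:
  assumes "openin X N" "closedin X K" "K \<subseteq> N"
  shows "null_along q (subtopology X N) K \<longleftrightarrow> null_along q X K"
proof -
  have N: "N \<subseteq> topspace X" using assms(1) openin_subset by blast
  let ?U = "topspace X - N" and ?T = "topspace X - K"
  have 1: "X closure_of ?U \<subseteq> X interior_of ?T"
  proof -
    have "closedin X ?U" "openin X ?T" using assms by auto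
    then show ?thesis using assms(3) by (simp add: closure_of_closedin interior_of_openin) blast
  qed
  have "hom_induced q (subtopology X (topspace X - ?U)) (?T - ?U) (subtopology X (topspace X)) ?T id
    \<in> iso (relative_homology_group q (subtopology X (topspace X - ?U)) (?T - ?U))
          (relative_homology_group q (subtopology X (topspace X)) ?T)"
    by (rule homology_excision_axiom[OF 1]) auto
  moreover have "topspace X - ?U = N" "?T - ?U = topspace (subtopology X N) - K"
    using N by auto
  ultimately show ?thesis
    unfolding null_along_def by (intro iso_imp_trivial_group_iff) (auto simp: subtopology_topspace)
qed

section \<open>Exact sequences of triples\<close>

lemma trivial_middle:
  assumes "exact_seq ([G1, G2, G3], [h1, h2])" "trivial_group G1" "trivial_group G3"
  shows "trivial_group G2"
proof -
  have h: "group_hom G3 G2 h2" "group_hom G2 G1 h1" "h2 ` carrier G3 = kernel G2 G1 h1"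
    using assms(1) by (auto simp: group_hom_def group_hom_axioms_def elim!: exact_seq.cases)
  interpret a: group_hom G3 G2 h2 by fact
  interpret b: group_hom G2 G1 h1 by fact
  have "carrier G2 = kernel G2 G1 h1" using b.kernel_to_trivial_group[OF assms(2)] by simp
  then have "carrier G2 = {\<one>\<^bsub>G2\<^esub>}" using h(3) a.image_from_trivial_group[OF assms(3)] by simp
  then show ?thesis by (simp add: trivial_group_def a.H.is_group)
qed

text \<open>This lemma, the next one and \<open>triple_trivial_total\<close> are the three positions
  in the long exact sequence of the triple \<open>T \<subseteq> S \<subseteq> X\<close>: a term
  vanishes when both neighbours do.\<close>

lemma triple_trivial_subspace:
  assumes "T \<subseteq> S" "trivial_group (relative_homology_group (q + 1) X S)"
    "trivial_group (relative_homology_group q X T)"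
  shows "trivial_group (relative_homology_group q (subtopology X S) T)"
  using trivial_middle[OF homology_exactness_triple_2[OF assms(1), of "q+1" X]] assms by simp

lemma triple_trivial_quotient:
  assumes "T \<subseteq> S" "trivial_group (relative_homology_group (q - 1) (subtopology X S) T)"
    "trivial_group (relative_homology_group q X T)"
  shows "trivial_group (relative_homology_group q X S)"
  using trivial_middle[OF homology_exactness_triple_1[OF assms(1), of q X]] assms by simp

text \<open>The sequence of the triple
  \<open>X - K \<subseteq> X - (K \<inter> S) \<subseteq> X\<close> gives vanishing along
  \<open>K - S\<close> inside \<open>X - (K \<inter> S)\<close>; excision then shrinks this space to
  its open subset \<open>X - S\<close>. The boundary map is what demands degree \<open>q + 1\<close>
  along \<open>K \<inter> S\<close>.\<close>

lemma null_along_diff_closed: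
  assumes "closedin X K" "closedin X S"
    and "null_along q X K" "null_along (q + 1) X (K \<inter> S)"
  shows "null_along q (subtopology X (topspace X - S)) (K - S)"
proof -
  let ?S = "topspace X - K \<inter> S" and ?T = "topspace X - K"
  have "trivial_group (relative_homology_group q (subtopology X ?S) ?T)"
    using assms(3,4) by (intro triple_trivial_subspace) (auto simp: null_along_def)
  moreover have "topspace (subtopology X ?S) - (K - S) = ?T" by auto
  ultimately have "null_along q (subtopology X ?S) (K - S)"
    unfolding null_along_def by simp
  moreover have "closedin (subtopology X ?S) (K - S)"
    using assms(1) closedin_subset[OF assms(1)] by (auto simp: closedin_subtopology)
  moreover have "openin (subtopology X ?S) (topspace X - S)"
    using assms(2) by (auto simp: openin_subtopology intro!: exI[of _ "topspace X - S"])
  ultimately have "null_along q (subtopology (subtopology X ?S) (topspace X - S)) (K - S)"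
    using closedin_subset[OF assms(1)] by (subst null_along_subtopology_open) auto
  moreover have "?S \<inter> (topspace X - S) = topspace X - S" by auto
  ultimately show ?thesis by (simp add: subtopology_subtopology)
qed

lemma triple_trivial_total:
  assumes "T \<subseteq> S" "trivial_group (relative_homology_group q (subtopology X S) T)"
    "trivial_group (relative_homology_group q X S)"
  shows "trivial_group (relative_homology_group q X T)"
  using trivial_middle[OF homology_exactness_triple_3[OF assms(1), of q X]] assms by simp

section \<open>Suspension\<close>

text \<open>The straight-line homotopy in the real coordinate. \<open>S\<close> is the subspace in
  which it takes place, and \<open>C\<close> is a subset kept at all times, for deformations of
  pairs.\<close>

lemma homotopic_with_times_real:
  fixes m :: "real \<Rightarrow> real"
  assumes m: "continuous_on UNIV m"
    and S: "\<And>x t s. (x, t) \<in> S \<Longrightarrow> 0 \<le> s \<Longrightarrow> s \<le> 1 \<Longrightarrow> (x, (1 - s) * m t + s * t) \<in> S"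
    and C: "\<And>x t s. (x, t) \<in> C \<Longrightarrow> 0 \<le> s \<Longrightarrow> s \<le> 1 \<Longrightarrow> (x, (1 - s) * m t + s * t) \<in> C"
  shows "homotopic_with (\<lambda>h. h \<in> C \<rightarrow> C) (subtopology (prod_topology X euclideanreal) S)
    (subtopology (prod_topology X euclideanreal) S) (\<lambda>(x, t). (x, m t)) id"
proof -
  let ?Z = "subtopology (prod_topology X euclideanreal) S"
  let ?W = "prod_topology (top_of_set {0..1::real}) ?Z"
  let ?h = "\<lambda>p. (fst (snd p), (1 - fst p) * m (snd (snd p)) + fst p * snd (snd p))"
  have f: "continuous_map ?W euclideanreal fst"
    using continuous_map_fst continuous_map_in_subtopology by blast
  have z: "continuous_map ?W (prod_topology X euclideanreal) snd"
    using continuous_map_snd continuous_map_in_subtopology by blast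
  have x: "continuous_map ?W X (\<lambda>p. fst (snd p))"
    using continuous_map_fst_of[OF z] by (simp add: o_def)
  have t: "continuous_map ?W euclideanreal (\<lambda>p. snd (snd p))"
    using continuous_map_snd_of[OF z] by (simp add: o_def)
  have mt: "continuous_map ?W euclideanreal (\<lambda>p. m (snd (snd p)))"
    using continuous_map_compose[OF t, of euclideanreal m] m by (simp add: o_def)
  have "continuous_map ?W (prod_topology X euclideanreal) ?h"
    by (intro continuous_map_pairedI continuous_intros f x t mt) auto
  moreover have "?h \<in> topspace ?W \<rightarrow> S" using S by (auto simp: Pi_iff)
  ultimately have "continuous_map ?W ?Z ?h" by (auto simp: continuous_map_in_subtopology)
  then show ?thesis
    unfolding homotopic_with_def
    using C by (intro exI[of _ ?h] conjI) (auto simp: Pi_iff)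
qed

text \<open>A relative Mayer-Vietoris argument: \<open>A\<close> is the union of \<open>L\<close>
  and \<open>R\<close>, whose intersection is \<open>C\<close>. Sliding the real coordinate shows
  that the pairs \<open>(Y, L)\<close> and \<open>(Y, R)\<close> have no homology. Hence the
  homology of \<open>(Y, A)\<close> in degree \<open>q + 1\<close> is that of \<open>(A, L)\<close>
  in degree \<open>q\<close>, by excision that of \<open>(R, C)\<close>, then that of
  \<open>(Y, C)\<close>, and this pair is \<open>(X, X - K)\<close> times the line.\<close>

lemma null_along_times_real:
  assumes K: "closedin X K"
  shows "null_along (q + 1) (prod_topology X euclideanreal) (K \<times> {0}) \<longleftrightarrow> null_along q X K"
proof -
  define Y where "Y = prod_topology X euclideanreal"
  have KX: "K \<subseteq> topspace X" using K closedin_subset by blast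
  have tY: "topspace Y = topspace X \<times> UNIV" by (simp add: Y_def)
  define A where "A = topspace Y - K \<times> {0}"
  define L where "L = topspace Y - K \<times> {0..}"
  define R where "R = topspace Y - K \<times> {..0}"
  define C where "C = topspace Y - K \<times> UNIV"
  have sub: "L \<subseteq> A" "C \<subseteq> R" "C \<subseteq> L"
    by (auto simp: A_def L_def R_def C_def)
  have pos: "0 < (1 - s) * a + s * b" if "0 < a" "0 < b" "0 \<le> s" "s \<le> 1" for a b s :: real
    using that by (cases "s = 1") (auto intro!: add_pos_nonneg)
  \<comment> \<open>\<open>c\<close> is the sign of the side complementary to \<open>B\<close>, and
    \<open>m\<close> clamps the real coordinate to that side. The segment from \<open>m t\<close> to
    \<open>t\<close> never enters \<open>B\<close> if \<open>t\<close> lies outside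
    \<open>B\<close>, so the sliding also preserves the subspace.\<close>
  have LR: "trivial_group (relative_homology_group p Y (topspace Y - K \<times> B))"
    if m: "continuous_on UNIV m" and B: "\<And>t. t \<notin> B \<longleftrightarrow> 0 < c * t" and mB: "\<And>t. 0 < c * m t" for B c p and m :: "real \<Rightarrow> real"
  proof (rule trivial_relative_homology_group_gen[where f = "\<lambda>(x, t). (x, m t)"])
    let ?S = "topspace Y - K \<times> B"
    have "(1 - s) * m t + s * t \<notin> B" if "t \<notin> B" "0 \<le> s" "s \<le> 1" for s t
      using pos[of "c * m t" "c * t" s] that mB[of t] by (simp add: B algebra_simps)
    then have S: "(x, (1 - s) * m t + s * t) \<in> ?S" if "(x, t) \<in> ?S" "0 \<le> s" "s \<le> 1" for x t s
      using that by (auto simp: tY)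
    have "continuous_map Y Y (\<lambda>(x, t). (x, m t))"
      unfolding Y_def using m by (simp add: continuous_map_prod_top)
    moreover have "(\<lambda>(x, t). (x, m t)) \<in> topspace Y \<rightarrow> ?S"
      using mB B by (auto simp: tY)
    ultimately show "continuous_map Y (subtopology Y ?S) (\<lambda>(x, t). (x, m t))"
      by (auto simp: continuous_map_in_subtopology)
    show "homotopic_with (\<lambda>h. True) (subtopology Y ?S) (subtopology Y ?S) (\<lambda>(x, t). (x, m t)) id"
      using homotopic_with_times_real[OF m S, of "{}" X] by (simp add: Y_def)
    show "homotopic_with (\<lambda>h. True) Y Y (\<lambda>(x, t). (x, m t)) id"
      using homotopic_with_times_real[OF m, of UNIV "{}" X] by (simp add: Y_def)
  qed
  have trL: "trivial_group (relative_homology_group p Y L)" for p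
    unfolding L_def
    by (rule LR[of "\<lambda>t. min t (-1)" _ "-1"]) (auto intro!: continuous_intros)
  have trR: "trivial_group (relative_homology_group p Y R)" for p
    unfolding R_def
    by (rule LR[of "\<lambda>t. max t 1" _ 1]) (auto intro!: continuous_intros)
  have clo: "closedin Y (K \<times> B)" if "closed B" for B
    using K that by (simp add: Y_def closedin_prod_Times_iff)
  have "null_along (q + 1) Y (K \<times> {0}) \<longleftrightarrow> trivial_group (relative_homology_group (q + 1) Y A)"
    by (simp add: null_along_def A_def)
  also have "\<dots> \<longleftrightarrow> trivial_group (relative_homology_group q (subtopology Y A) L)"
    using triple_trivial_subspace[OF sub(1) _ trL] triple_trivial_quotient[OF sub(1) _ trL, of "q + 1"] by auto
  also have "\<dots> \<longleftrightarrow> null_along q (subtopology Y A) (K \<times> {0<..})"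
  proof -
    have "topspace (subtopology Y A) - K \<times> {0<..} = L"
      using KX by (force simp: A_def L_def tY)
    then show ?thesis by (simp add: null_along_def)
  qed
  also have "\<dots> \<longleftrightarrow> null_along q (subtopology (subtopology Y A) R) (K \<times> {0<..})"
  proof (rule null_along_subtopology_open[symmetric])
    have "openin Y R" unfolding R_def using clo[of "{..0}"] by auto
    moreover have "A \<inter> R = R" by (auto simp: A_def R_def)
    ultimately show "openin (subtopology Y A) R" by (metis openin_subtopology_Int2)
    have "K \<times> {0<..} = A \<inter> (K \<times> {0..})" using KX by (force simp: A_def tY)
    then show "closedin (subtopology Y A) (K \<times> {0<..})"
      using clo[of "{0..}"] by (metis closedin_subtopology_Int_closed closed_atLeast)
    show "K \<times> {0<..} \<subseteq> R" using KX by (auto simp: R_def tY)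
  qed
  also have "\<dots> \<longleftrightarrow> trivial_group (relative_homology_group q (subtopology Y R) C)"
  proof -
    have "A \<inter> R = R" by (auto simp: A_def R_def)
    moreover have "topspace (subtopology Y R) - K \<times> {0<..} = C"
      using KX by (force simp: C_def R_def tY)
    ultimately show ?thesis by (simp add: null_along_def subtopology_subtopology)
  qed
  also have "\<dots> \<longleftrightarrow> trivial_group (relative_homology_group q Y C)"
    using triple_trivial_subspace[OF sub(2) trR] triple_trivial_total[OF sub(2) _ trR] by blast
  also have "\<dots> \<longleftrightarrow> null_along q X K"
    unfolding null_along_def
  proof (rule isomorphic_group_triviality)
    show "relative_homology_group q Y C \<cong> relative_homology_group q X (topspace X - K)"
    proof (rule homotopy_equivalent_space_imp_isomorphic_relative_homology_groups[where f = fst and g = "\<lambda>x. (x, 0)"])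
      show "homotopic_with (\<lambda>h. h \<in> C \<rightarrow> C) Y Y ((\<lambda>x. (x, 0)) \<circ> fst) id"
        using homotopic_with_times_real[of "\<lambda>_. 0" UNIV C X]
        by (simp add: Y_def C_def tY o_def case_prod_beta')
      show "homotopic_with (\<lambda>k. k \<in> topspace X - K \<rightarrow> topspace X - K) X X (fst \<circ> (\<lambda>x. (x, 0))) id"
        by (intro homotopic_with_equal) (auto simp: o_def)
    qed (auto simp: Y_def C_def tY continuous_map_fst intro!: continuous_map_pairedI)
  qed auto
  finally show ?thesis by (simp add: Y_def)
qed

lemma null_along_times_complex:
  assumes "closedin X K"
  shows "null_along (q + 2) (prod_topology X (euclidean :: complex topology)) (K \<times> {0}) \<longleftrightarrow> null_along q X K"
proof -
  let ?R2 = "prod_topology (prod_topology X euclideanreal) euclideanreal"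
  let ?f = "\<lambda>((x, a), b). (x, Complex a b)"
  have a: "continuous_map ?R2 euclideanreal (\<lambda>p. snd (fst p))"
    using continuous_map_snd_of[OF continuous_map_fst] by (simp add: o_def)
  have x: "continuous_map ?R2 X (\<lambda>p. fst (fst p))"
    using continuous_map_fst_of[OF continuous_map_fst] by (simp add: o_def)
  have 1: "continuous_map ?R2 euclidean (\<lambda>p. Complex (snd (fst p)) (snd p))"
  proof -
    have "continuous_on UNIV (\<lambda>(a, b). Complex a b)"
      unfolding case_prod_beta' by (intro continuous_intros)
    then have "continuous_map (prod_topology euclideanreal euclideanreal) euclidean (\<lambda>(a, b). Complex a b)"
      by (simp flip: euclidean_product_topology)
    from continuous_map_compose[OF continuous_map_pairedI[OF a continuous_map_snd] this]
    show ?thesis by (simp add: o_def)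
  qed
  have cs: "continuous_map (prod_topology X euclidean) euclideanreal (\<lambda>p. g (snd p))"
    if "continuous_on UNIV g" for g :: "complex \<Rightarrow> real"
  proof -
    have "continuous_map euclidean euclideanreal g" using that by simp
    then show ?thesis by (rule continuous_map_snd_comp)
  qed
  have "homeomorphic_maps ?R2 (prod_topology X euclidean) ?f (\<lambda>(x, z). ((x, Re z), Im z))"
    unfolding homeomorphic_maps_def case_prod_beta'
    by (intro conjI continuous_map_pairedI x 1 continuous_map_fst cs[OF continuous_on_Re[OF continuous_on_id]]
        cs[OF continuous_on_Im[OF continuous_on_id]]) auto
  then have h: "homeomorphic_map ?R2 (prod_topology X euclidean) ?f"
    using homeomorphic_map_maps by blast
  have im: "?f ` ((K \<times> {0}) \<times> {0}) = K \<times> {0}"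
  proof -
    have "Complex 0 0 = 0" by (simp add: complex_eq_iff)
    then show ?thesis by (auto simp: image_iff)
  qed
  have sub: "(K \<times> {0}) \<times> {0} \<subseteq> topspace ?R2"
    using closedin_subset[OF assms] by auto
  have "null_along (q + 2) (prod_topology X euclidean) (K \<times> {0 :: complex})
      \<longleftrightarrow> null_along (q + 2) ?R2 ((K \<times> {0}) \<times> {0})"
    using null_along_homeomorphic[OF h sub] unfolding im by simp
  also have "\<dots> \<longleftrightarrow> null_along (q + 1) (prod_topology X euclideanreal) (K \<times> {0})"
    using null_along_times_real[of "prod_topology X euclideanreal" "K \<times> {0}" "q + 1"] assms
    by (simp add: closedin_prod_Times_iff add.assoc)
  also have "\<dots> \<longleftrightarrow> null_along q X K" by (rule null_along_times_real[OF assms])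
  finally show ?thesis .
qed

abbreviation complex_power :: "'i set \<Rightarrow> ('i \<Rightarrow> complex) topology" where
  "complex_power A \<equiv> product_topology (\<lambda>_. euclidean) A"

lemma closedin_complex_power_point: "closedin (complex_power A) {\<lambda>a\<in>A. c a}"
  by (intro closedin_Hausdorff_singleton) (auto simp: Hausdorff_space_product_topology)

lemma null_along_times_complex_power:
  fixes A :: "'i set"
  assumes "finite A" "closedin X K"
  shows "null_along (q + 2 * int (card A)) (prod_topology X (complex_power A)) (K \<times> {\<lambda>a\<in>A. 0})
    \<longleftrightarrow> null_along q X K"
  using assms(1)
proof (induction A)
  case empty
  have "continuous_map X (complex_power ({} :: 'i set)) (\<lambda>x. \<lambda>a. undefined)"
    by (simp add: product_topology_empty_discrete)
  then have "homeomorphic_maps X (prod_topology X (complex_power ({} :: 'i set))) (\<lambda>x. (x, \<lambda>a. undefined)) fst"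
    unfolding homeomorphic_maps_def
    by (intro conjI continuous_map_pairedI continuous_map_fst) auto
  then have "homeomorphic_map X (prod_topology X (complex_power ({} :: 'i set))) (\<lambda>x. (x, \<lambda>a. undefined))"
    using homeomorphic_map_maps by blast
  moreover have "(\<lambda>x. (x, \<lambda>a. undefined)) ` K = K \<times> {\<lambda>a\<in>{}. 0}" by (auto simp: restrict_def)
  ultimately show ?case
    using null_along_homeomorphic[of X "prod_topology X (complex_power ({} :: 'i set))" "\<lambda>x. (x, \<lambda>a. undefined)" K q]
      closedin_subset[OF assms(2)] by (metis add.right_neutral card.empty mult_zero_right of_nat_0)
next
  case (insert b A)
  let ?Y = "prod_topology X (complex_power A)" and ?Z = "prod_topology X (complex_power (insert b A))"
  let ?f = "\<lambda>((x, y), c). (x, y(b := c))"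
  have x: "continuous_map (prod_topology ?Y euclidean) X (\<lambda>p. fst (fst p))"
    using continuous_map_fst_of[OF continuous_map_fst] by (simp add: o_def)
  have y: "continuous_map (prod_topology ?Y euclidean) (complex_power A) (\<lambda>p. snd (fst p))"
    using continuous_map_snd_of[OF continuous_map_fst] by (simp add: o_def)
  have ya: "continuous_map (prod_topology ?Y euclidean) euclidean (\<lambda>p. snd (fst p) a)" if "a \<in> A" for a
    using continuous_map_compose[OF y continuous_map_product_projection[OF that]] by (simp add: o_def)
  have za: "continuous_map ?Z euclidean (\<lambda>p. snd p a)" if "a \<in> insert b A" for a
    by (rule continuous_map_snd_comp[OF continuous_map_product_projection[OF that]])
  have 1: "continuous_map (prod_topology ?Y euclidean) (complex_power (insert b A)) (\<lambda>p. (snd (fst p))(b := snd p))"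
  proof (subst continuous_map_componentwise, intro conjI ballI)
    show "(\<lambda>p. (snd (fst p))(b := snd p)) ` topspace (prod_topology ?Y euclidean) \<subseteq> extensional (insert b A)"
      by (auto simp: extensional_def PiE_iff)
    show "continuous_map (prod_topology ?Y euclidean) euclidean (\<lambda>x. ((snd (fst x))(b := snd x)) k)"
      if "k \<in> insert b A" for k
      using that ya continuous_map_snd by (cases "k = b") auto
  qed
  have 2: "continuous_map ?Z (complex_power A) (\<lambda>p. restrict (snd p) A)"
    by (subst continuous_map_componentwise) (auto intro: za)
  have "homeomorphic_maps (prod_topology ?Y euclidean) ?Z ?f (\<lambda>(x, y). ((x, restrict y A), y b))"
    unfolding homeomorphic_maps_def case_prod_beta'
    using insert.hyps
    by (intro conjI continuous_map_pairedI x 1 2 continuous_map_fst za)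
       (auto simp: fun_eq_iff PiE_iff extensional_def)
  then have h: "homeomorphic_map (prod_topology ?Y euclidean) ?Z ?f"
    using homeomorphic_map_maps by blast
  have im: "?f ` ((K \<times> {\<lambda>a\<in>A. 0 :: complex}) \<times> {0 :: complex}) = K \<times> {\<lambda>a\<in>insert b A. 0}"
  proof -
    have 0: "(\<lambda>a\<in>A. 0 :: complex)(b := 0) = (\<lambda>a\<in>insert b A. 0)" by auto
    show ?thesis by (auto simp: image_iff 0)
  qed
  have sub: "(K \<times> {\<lambda>a\<in>A. 0}) \<times> {0} \<subseteq> topspace (prod_topology ?Y euclidean)"
    using closedin_subset[OF assms(2)] by auto
  have "null_along (q + 2 * int (card (insert b A))) ?Z (K \<times> {\<lambda>a\<in>insert b A. 0})
     \<longleftrightarrow> null_along (q + 2 * int (card (insert b A))) (prod_topology ?Y euclidean) ((K \<times> {\<lambda>a\<in>A. 0}) \<times> {0 :: complex})"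
    using null_along_homeomorphic[OF h sub] unfolding im by (rule sym)
  also have "\<dots> \<longleftrightarrow> null_along (q + 2 * int (card A) + 2) (prod_topology ?Y euclidean) ((K \<times> {\<lambda>a\<in>A. 0}) \<times> {0 :: complex})"
    using insert.hyps by (simp add: algebra_simps)
  also have "null_along (q + 2 * int (card A) + 2) (prod_topology ?Y euclidean) ((K \<times> {\<lambda>a\<in>A. 0}) \<times> {0 :: complex})
     \<longleftrightarrow> null_along (q + 2 * int (card A)) ?Y (K \<times> {\<lambda>a\<in>A. 0})"
    using assms(2) by (intro null_along_times_complex) (simp add: closedin_prod_Times_iff closedin_complex_power_point)
  also note insert.IH
  finally show ?case .
qed

section \<open>Graphs of continuous maps\<close>

lemma Tietze_complex:
  assumes X: "normal_space X" "closedin X T" and g: "continuous_map (subtopology X T) euclidean (g :: 'a \<Rightarrow> complex)"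
  obtains G where "continuous_map X euclidean G" "\<And>x. x \<in> T \<Longrightarrow> G x = g x"
proof -
  have *: "continuous_map (subtopology X T) euclideanreal (h \<circ> g)" if "continuous_on UNIV h" for h
    by (rule continuous_map_compose[OF g]) (use that in simp)
  have **: "\<exists>a. continuous_map X euclideanreal a \<and> (\<forall>x\<in>T. a x = h (g x))" if "continuous_on UNIV h" for h
    using Tietze_extension_realinterval[OF X is_interval_univ _ *[OF that]] by (metis UNIV_not_empty comp_apply subset_UNIV)
  obtain a b where a: "continuous_map X euclideanreal a" "\<forall>x\<in>T. a x = Re (g x)"
    and b: "continuous_map X euclideanreal b" "\<forall>x\<in>T. b x = Im (g x)"
    using **[OF continuous_on_Re[OF continuous_on_id]] **[OF continuous_on_Im[OF continuous_on_id]] by auto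
  have "continuous_on UNIV (\<lambda>(a, b). Complex a b)"
    unfolding case_prod_beta' by (intro continuous_intros)
  then have "continuous_map (prod_topology euclideanreal euclideanreal) euclidean (\<lambda>(a, b). Complex a b)"
    by (simp flip: euclidean_product_topology)
  from continuous_map_compose[OF continuous_map_pairedI[OF a(1) b(1)] this]
  show ?thesis using a(2) b(2) by (intro that[of "\<lambda>x. Complex (a x) (b x)"]) (auto simp: o_def)
qed

text \<open>Normality is for Tietze's theorem: each coordinate of \<open>g\<close> extends to a
  function \<open>G a\<close> on all of \<open>X\<close>, and adding these functions is invertible
  whatever their values off \<open>T\<close>.\<close>

lemma null_along_graph:
  assumes A: "finite A" and X: "normal_space X" "closedin X T"
    and g: "continuous_map (subtopology X T) (complex_power A) g"
  shows "null_along (q + 2 * int (card A)) (prod_topology X (complex_power A)) ((\<lambda>x. (x, g x)) ` T)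
    \<longleftrightarrow> null_along q X T"
proof -
  have "\<exists>G. continuous_map X euclidean G \<and> (\<forall>x\<in>T. G x = g x a)" if "a \<in> A" for a
  proof -
    have "continuous_map (subtopology X T) euclidean (\<lambda>x. g x a)"
      using continuous_map_compose[OF g continuous_map_product_projection[OF that]] by (simp add: o_def)
    with X show ?thesis by (rule Tietze_complex) blast
  qed
  then obtain G where G: "\<And>a. a \<in> A \<Longrightarrow> continuous_map X euclidean (G a)"
      "\<And>a x. a \<in> A \<Longrightarrow> x \<in> T \<Longrightarrow> G a x = g x a"
    by metis
  let ?Y = "prod_topology X (complex_power A)"
  have y: "continuous_map ?Y euclidean (\<lambda>p. snd p a)" if "a \<in> A" for a
    by (rule continuous_map_snd_comp[OF continuous_map_product_projection[OF that]])
  have Gf: "continuous_map ?Y euclidean (\<lambda>p. G a (fst p))" if "a \<in> A" for a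
    by (rule continuous_map_fst_comp[OF G(1)[OF that]])
  have "homeomorphic_maps ?Y ?Y (\<lambda>(x, y). (x, \<lambda>a\<in>A. y a + G a x)) (\<lambda>(x, y). (x, \<lambda>a\<in>A. y a - G a x))"
    unfolding homeomorphic_maps_def case_prod_beta'
    by (intro conjI continuous_map_pairedI continuous_map_fst; (subst continuous_map_componentwise)?)
       (auto intro!: continuous_map_add continuous_map_diff y Gf simp: fun_eq_iff PiE_iff extensional_def)
  then have h: "homeomorphic_map ?Y ?Y (\<lambda>(x, y). (x, \<lambda>a\<in>A. y a + G a x))"
    using homeomorphic_map_maps by blast
  have TX: "T \<subseteq> topspace X" using X(2) closedin_subset by blast
  have gx: "g x \<in> extensional A" if "x \<in> T" for x
    using continuous_map_image_subset_topspace[OF g] that TX by (force simp: PiE_iff)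
  have im: "(\<lambda>(x, y). (x, \<lambda>a\<in>A. y a + G a x)) ` (T \<times> {\<lambda>a\<in>A. 0}) = (\<lambda>x. (x, g x)) ` T"
  proof -
    have "(\<lambda>a\<in>A. (\<lambda>a\<in>A. 0) a + G a x) = g x" if "x \<in> T" for x
      using gx[OF that] G(2) that by (auto simp: fun_eq_iff extensional_def)
    then show ?thesis by (auto simp: image_iff)
  qed
  show ?thesis
    using null_along_homeomorphic[OF h, of "T \<times> {\<lambda>a\<in>A. 0}" "q + 2 * int (card A)"] TX
      null_along_times_complex_power[OF A X(2), of q] unfolding im by force
qed

section \<open>Spaces of monic polynomials\<close>

lemma continuous_map_complex_mult:
  fixes f g :: "'a \<Rightarrow> complex"
  shows "\<lbrakk>continuous_map X euclidean f; continuous_map X euclidean g\<rbrakk> \<Longrightarrow> continuous_map X euclidean (\<lambda>x. f x * g x)"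
  by (simp add: continuous_map_atin tendsto_mult)

text \<open>This avoids a topology on polynomials of unbounded degree. It is stable under ring
  operations, and together with membership in \<open>monic_polys d\<close> it amounts to continuity
  into \<open>monic_poly_space d\<close>.\<close>

definition coeffs_continuous :: "'a topology \<Rightarrow> ('a \<Rightarrow> complex poly) \<Rightarrow> bool" where
  "coeffs_continuous X F \<longleftrightarrow> (\<forall>l. continuous_map X euclidean (\<lambda>x. poly.coeff (F x) l))"

lemma coeffs_continuous_const [intro]: "coeffs_continuous X (\<lambda>x. p)"
  by (simp add: coeffs_continuous_def)

lemma coeffs_continuous_add [intro]:
  "coeffs_continuous X F \<Longrightarrow> coeffs_continuous X G \<Longrightarrow> coeffs_continuous X (\<lambda>x. F x + G x)"
  by (auto simp: coeffs_continuous_def intro!: continuous_map_add)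

lemma coeffs_continuous_diff [intro]:
  "coeffs_continuous X F \<Longrightarrow> coeffs_continuous X G \<Longrightarrow> coeffs_continuous X (\<lambda>x. F x - G x)"
  by (auto simp: coeffs_continuous_def intro!: continuous_map_diff)

lemma coeffs_continuous_mult [intro]:
  "coeffs_continuous X F \<Longrightarrow> coeffs_continuous X G \<Longrightarrow> coeffs_continuous X (\<lambda>x. F x * G x)"
  by (auto simp: coeffs_continuous_def coeff_mult intro!: continuous_map_sum continuous_map_complex_mult)

lemma coeffs_continuous_sum:
  "finite A \<Longrightarrow> (\<And>a. a \<in> A \<Longrightarrow> coeffs_continuous X (\<lambda>x. F x a)) \<Longrightarrow> coeffs_continuous X (\<lambda>x. \<Sum>a\<in>A. F x a)"
  by (induction A rule: finite_induct) auto

lemma coeffs_continuous_prod: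
  "finite A \<Longrightarrow> (\<And>a. a \<in> A \<Longrightarrow> coeffs_continuous X (\<lambda>x. F x a)) \<Longrightarrow> coeffs_continuous X (\<lambda>x. \<Prod>a\<in>A. F x a)"
  by (induction A rule: finite_induct) auto

lemma coeffs_continuous_monom:
  "continuous_map X euclidean c \<Longrightarrow> coeffs_continuous X (\<lambda>x. Polynomial.monom (c x) k)"
  by (auto simp: coeffs_continuous_def)

lemma coeffs_continuous_linear:
  "continuous_map X euclidean c \<Longrightarrow> coeffs_continuous X (\<lambda>x. [:- c x, 1:])"
  unfolding coeffs_continuous_def
proof
  fix l assume c: "continuous_map X euclidean c"
  show "continuous_map X euclidean (\<lambda>x. poly.coeff [:- c x, 1:] l)"
    using continuous_map_minus[OF c] by (cases l) simp_all
qed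

lemma coeffs_continuous_compose:
  "coeffs_continuous Y F \<Longrightarrow> continuous_map X Y g \<Longrightarrow> coeffs_continuous X (\<lambda>x. F (g x))"
  unfolding coeffs_continuous_def using continuous_map_compose[of X Y g] by (fastforce simp: o_def)

lemma coeff_monic_polys:
  assumes "p \<in> monic_polys d"
  shows "poly.coeff p d = 1" "d < l \<Longrightarrow> poly.coeff p l = 0"
  using assms by (auto simp: monic_polys_def coeff_eq_0)

lemma continuous_map_coeff: "continuous_map (monic_poly_space d) euclidean (\<lambda>p. poly.coeff p l)"
proof (cases "l < d")
  case True
  have "continuous_map (monic_poly_space d) euclidean ((\<lambda>c. c l) \<circ> (\<lambda>p. restrict (poly.coeff p) {..<d}))"
    unfolding monic_poly_space_def using True
    by (intro continuous_map_pullback continuous_map_product_projection) auto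
  then show ?thesis using True by (simp add: o_def)
next
  case False
  have "continuous_map (monic_poly_space d) euclidean (\<lambda>p. if l = d then 1 else 0 :: complex)" by simp
  then show ?thesis
    by (rule continuous_map_eq) (use False in \<open>auto simp: topspace_monic_poly_space coeff_monic_polys\<close>)
qed

lemma coeffs_continuous_id: "coeffs_continuous (monic_poly_space d) (\<lambda>p. p)"
  by (simp add: coeffs_continuous_def continuous_map_coeff)

lemma continuous_map_into_monic_poly_space:
  "continuous_map X (monic_poly_space d) F \<longleftrightarrow> (\<forall>x\<in>topspace X. F x \<in> monic_polys d) \<and> coeffs_continuous X F"
proof safe
  assume F: "continuous_map X (monic_poly_space d) F"
  show "F x \<in> monic_polys d" if "x \<in> topspace X" for x
    using F that by (auto simp: continuous_map_def topspace_monic_poly_space)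
  show "coeffs_continuous X F"
    using coeffs_continuous_compose[OF coeffs_continuous_id F] .
next
  assume *: "\<forall>x\<in>topspace X. F x \<in> monic_polys d" "coeffs_continuous X F"
  have "continuous_map X (product_topology (\<lambda>_. euclidean) {..<d}) ((\<lambda>p. restrict (poly.coeff p) {..<d}) \<circ> F)"
    using *(2) by (auto simp: continuous_map_componentwise coeffs_continuous_def)
  then show "continuous_map X (monic_poly_space d) F"
    unfolding monic_poly_space_def using *(1) by (intro continuous_map_pullback') auto
qed

lemma homeomorphic_maps_coeffs:
  "homeomorphic_maps (monic_poly_space d) (complex_power {..<d}) (\<lambda>p. restrict (poly.coeff p) {..<d})
     (\<lambda>c. Polynomial.monom 1 d + (\<Sum>l<d. Polynomial.monom (c l) l))"
proof -
  let ?g = "\<lambda>c. Polynomial.monom 1 d + (\<Sum>l<d. Polynomial.monom (c l) l) :: complex poly"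
  have cg: "poly.coeff (?g c) l = (if l < d then c l else if l = d then 1 else 0)" for c l
    by (simp add: coeff_sum)
  have mg: "?g c \<in> monic_polys d" for c
  proof -
    have "degree (?g c) = d"
    proof (rule antisym)
      show "degree (?g c) \<le> d" by (rule degree_le) (simp only: cg, simp)
      show "d \<le> degree (?g c)" by (rule le_degree) (simp only: cg, simp)
    qed
    then show ?thesis unfolding monic_polys_def mem_Collect_eq by (simp only: cg) simp
  qed
  show ?thesis
    unfolding homeomorphic_maps_def
  proof (intro conjI ballI)
    show "continuous_map (monic_poly_space d) (complex_power {..<d}) (\<lambda>p. restrict (poly.coeff p) {..<d})"
      by (auto simp: continuous_map_componentwise continuous_map_coeff)
    show "continuous_map (complex_power {..<d}) (monic_poly_space d) ?g"
      unfolding continuous_map_into_monic_poly_space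
      by (intro conjI ballI mg coeffs_continuous_add coeffs_continuous_const coeffs_continuous_sum
          coeffs_continuous_monom continuous_map_product_projection) auto
    show "?g (restrict (poly.coeff p) {..<d}) = p" if "p \<in> topspace (monic_poly_space d)" for p
      using that coeff_monic_polys[of p d]
      by (intro poly_eqI) (auto simp only: cg topspace_monic_poly_space restrict_apply lessThan_iff split: if_splits)
    show "restrict (poly.coeff (?g c)) {..<d} = c" if "c \<in> topspace (complex_power {..<d})" for c
    proof
      fix l
      show "restrict (poly.coeff (?g c)) {..<d} l = c l"
        using that by (cases "l < d") (simp_all only: restrict_apply cg lessThan_iff, auto simp: PiE_iff extensional_def)
    qed
  qed
qed

lemma metrizable_monic_poly_space: "metrizable_space (monic_poly_space d)"
proof -
  have "monic_poly_space d homeomorphic_space complex_power {..<d}"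
    using homeomorphic_maps_coeffs homeomorphic_space_def by blast
  moreover have "metrizable_space (complex_power {..<d})"
    by (auto simp: metrizable_space_product_topology metrizable_space_euclidean intro!: countable_finite)
  ultimately show ?thesis using homeomorphic_metrizable_space by blast
qed

lemma monic_polys_mult: "p \<in> monic_polys a \<Longrightarrow> q \<in> monic_polys b \<Longrightarrow> p * q \<in> monic_polys (a + b)"
  unfolding monic_polys_def mem_Collect_eq
  by (metis degree_mult_eq lead_coeff_mult leading_coeff_0_iff mult_1 zero_neq_one)

lemma monic_polys_linear: "[:- w, 1:] \<in> monic_polys 1"
  by (simp add: monic_polys_def)

lemma monic_polys_nonzero: "p \<in> monic_polys d \<Longrightarrow> p \<noteq> 0"
  by (auto simp: monic_polys_def)

section \<open>The map from ordered roots to coefficients\<close>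

definition root_poly :: "nat \<Rightarrow> (nat \<Rightarrow> complex) \<Rightarrow> complex poly" where
  "root_poly m z = (\<Prod>l<m. [:- z l, 1:])"

lemma root_poly_monic: "root_poly m z \<in> monic_polys m"
proof (induction m)
  case 0
  then show ?case by (simp add: root_poly_def monic_polys_def)
next
  case (Suc m)
  then show ?case
    using monic_polys_mult[OF Suc monic_polys_linear[of "z m"]] by (simp only: root_poly_def prod.lessThan_Suc) simp
qed

lemma root_poly_zero: "poly (root_poly m z) w = 0 \<longleftrightarrow> (\<exists>l<m. w = z l)"
  by (auto simp: root_poly_def poly_prod)

lemma continuous_map_root_poly:
  assumes "\<And>l. l < m \<Longrightarrow> continuous_map X euclidean (\<lambda>x. z x l)"
  shows "continuous_map X (monic_poly_space m) (\<lambda>x. root_poly m (z x))"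
  unfolding continuous_map_into_monic_poly_space root_poly_def
  using root_poly_monic[unfolded root_poly_def]
  by (auto intro!: coeffs_continuous_prod coeffs_continuous_linear assms)

lemma root_poly_eq_prod_mset: "root_poly m z = (\<Prod>x\<in>#image_mset z (mset_set {..<m}). [:- x, 1:])"
  by (simp add: root_poly_def prod_unfold_prod_mset image_mset.compositionality o_def)

lemma proots_root_poly: "proots (root_poly m z) = image_mset z (mset_set {..<m})"
  unfolding root_poly_eq_prod_mset by (rule proots_prod_linear)

lemma monic_prod_proots: "p \<in> monic_polys d \<Longrightarrow> (\<Prod>x\<in>#proots p. [:- x, 1:]) = p"
  using complex_poly_decompose_multiset[of p] by (auto simp: monic_polys_def)

lemma mset_eq_image_upto:
  obtains z where "z \<in> extensional {..<size A}" "A = image_mset z (mset_set {..<size A})"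
proof -
  obtain xs where xs: "mset xs = A" using ex_mset by blast
  have "image_mset (\<lambda>l\<in>{..<length xs}. xs ! l) (mset_set {..<length xs}) = image_mset ((!) xs) (mset_set {..<length xs})"
    by (intro image_mset_cong) auto
  also have "\<dots> = mset xs"
    by (metis atLeast0LessThan map_nth mset_map mset_upt)
  finally show ?thesis using xs by (intro that[of "\<lambda>l\<in>{..<length xs}. xs ! l"]) auto
qed

lemma root_poly_surj:
  assumes "p \<in> monic_polys m"
  obtains z where "z \<in> topspace (complex_power {..<m})" "p = root_poly m z"
proof -
  have "size (proots p) = m" using assms by (simp add: size_proots_complex monic_polys_def)
  then obtain z where "z \<in> extensional {..<m}" "proots p = image_mset z (mset_set {..<m})"
    using mset_eq_image_upto[of "proots p"] by metis
  then show ?thesis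
    using that[of z] monic_prod_proots[OF assms] by (simp add: root_poly_eq_prod_mset PiE_def)
qed


text \<open>Cauchy's estimate: if \<open>norm w > 1\<close>, every lower power of
  \<open>norm w\<close> is at most \<open>norm w ^ (m - 1)\<close>, so \<open>poly p w = 0\<close>
  forces \<open>norm w ^ m \<le> m * B * norm w ^ (m - 1)\<close>.\<close>

lemma monic_root_bound:
  assumes p: "p \<in> monic_polys m" "poly p w = 0" and B: "\<And>l. l < m \<Longrightarrow> norm (poly.coeff p l) \<le> B"
  shows "norm w \<le> max 1 (real m * B)"
proof (rule ccontr)
  assume "\<not> norm w \<le> max 1 (real m * B)"
  then have w: "1 < norm w" "real m * B < norm w" by auto
  have m: "degree p = m" "poly.coeff p m = 1" using p(1) by (auto simp: monic_polys_def)
  have m0: "0 < m"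
  proof (rule ccontr)
    assume "\<not> 0 < m"
    then have "p = 1" using m by (auto elim: degree_eq_zeroE)
    then show False using p(2) by simp
  qed
  have "poly p w = (\<Sum>l<m. poly.coeff p l * w ^ l) + w ^ m"
    using m by (simp add: poly_altdef lessThan_Suc_atMost[symmetric])
  then have "w ^ m = - (\<Sum>l<m. poly.coeff p l * w ^ l)" using p(2) by (simp add: add_eq_0_iff2)
  then have "norm w ^ m = norm (\<Sum>l<m. poly.coeff p l * w ^ l)" by (metis norm_minus_cancel norm_power)
  also have "\<dots> \<le> (\<Sum>l<m. B * norm w ^ (m - 1))"
  proof (rule sum_norm_le)
    fix l assume l: "l \<in> {..<m}"
    have "norm w ^ l \<le> norm w ^ (m - 1)" using l w by (intro power_increasing) auto
    moreover have "0 \<le> B" using B[of l] l norm_ge_zero order_trans by blast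
    ultimately show "norm (poly.coeff p l * w ^ l) \<le> B * norm w ^ (m - 1)"
      using B[of l] l by (simp add: norm_mult norm_power mult_mono)
  qed
  also have "\<dots> = real m * B * norm w ^ (m - 1)" by simp
  also have "\<dots> < norm w * norm w ^ (m - 1)" using w by (intro mult_strict_right_mono zero_less_power) auto
  also have "\<dots> = norm w ^ m" using m0 by (metis Suc_diff_1 power_Suc)
  finally show False by simp
qed

text \<open>On a compact set the coefficients are bounded, hence so are the roots, and the preimage
  is a closed subset of a compact polydisc. Compactness of preimages suffices for properness because
  the target is metrizable.\<close>

lemma proper_map_root_poly: "proper_map (complex_power {..<m}) (monic_poly_space m) (root_poly m)"
proof (rule compact_imp_proper_map)
  show "k_space (monic_poly_space m)" by (rule metrizable_imp_k_space[OF metrizable_monic_poly_space])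
  have H: "Hausdorff_space (monic_poly_space m)" by (rule metrizable_imp_Hausdorff_space[OF metrizable_monic_poly_space])
  then show "kc_space (monic_poly_space m)" by (rule Hausdorff_imp_kc_space)
  show "root_poly m \<in> topspace (complex_power {..<m}) \<rightarrow> topspace (monic_poly_space m)"
    by (auto simp: topspace_monic_poly_space root_poly_monic)
  have c: "continuous_map (complex_power {..<m}) (monic_poly_space m) (root_poly m)"
    by (rule continuous_map_root_poly) (auto intro: continuous_map_product_projection)
  then show "continuous_map (complex_power {..<m}) (monic_poly_space m) (root_poly m) \<or> kc_space (complex_power {..<m})" ..
  show "compactin (complex_power {..<m}) {z \<in> topspace (complex_power {..<m}). root_poly m z \<in> L}" (is "compactin _ ?Q")
    if L: "compactin (monic_poly_space m) L" for L
  proof -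
    have "\<exists>B. \<forall>p\<in>L. norm (poly.coeff p l) \<le> B" for l
    proof -
      have "compactin euclidean ((\<lambda>p. poly.coeff p l) ` L)" by (rule image_compactin[OF L continuous_map_coeff])
      then have "bounded ((\<lambda>p. poly.coeff p l) ` L)" by (simp add: compact_imp_bounded)
      then show ?thesis by (auto simp: bounded_iff)
    qed
    then obtain B where B: "\<And>l p. p \<in> L \<Longrightarrow> norm (poly.coeff p l) \<le> B l" by metis
    define C where "C = Max (insert 0 (B ` {..<m}))"
    have C: "norm (poly.coeff p l) \<le> C" if "p \<in> L" "l < m" for p l
    proof -
      have "B l \<le> C" unfolding C_def using that by (intro Max_ge) auto
      then show ?thesis using B[OF that(1), of l] by simp
    qed
    let ?K = "PiE {..<m} (\<lambda>_. cball 0 (max 1 (real m * C))) :: (nat \<Rightarrow> complex) set"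
    have K: "compactin (complex_power {..<m}) ?K"
      by (simp add: compactin_PiE)
    have "closedin (complex_power {..<m}) ?Q"
      by (rule closedin_continuous_map_preimage[OF c compactin_imp_closedin[OF H L]])
    moreover have "?Q \<subseteq> ?K"
    proof
      fix z assume z: "z \<in> ?Q"
      have "norm (z l) \<le> max 1 (real m * C)" if "l < m" for l
        using z that C root_poly_zero[of m z "z l"] by (intro monic_root_bound[OF root_poly_monic[of m z]]) auto
      then show "z \<in> ?K" using z by (auto simp: PiE_iff)
    qed
    ultimately show ?thesis using closed_compactin[OF K] by blast
  qed
qed

lemma root_poly_image: "root_poly m ` topspace (complex_power {..<m}) = topspace (monic_poly_space m)"
proof
  show "topspace (monic_poly_space m) \<subseteq> root_poly m ` topspace (complex_power {..<m})"
    unfolding topspace_monic_poly_space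
  proof
    fix p assume "p \<in> monic_polys m"
    then obtain z where "z \<in> topspace (complex_power {..<m})" "p = root_poly m z" by (rule root_poly_surj)
    then show "p \<in> root_poly m ` topspace (complex_power {..<m})" by (intro image_eqI[of p "root_poly m" z])
  qed
  show "root_poly m ` topspace (complex_power {..<m}) \<subseteq> topspace (monic_poly_space m)"
    by (simp add: image_subset_iff topspace_monic_poly_space root_poly_monic)
qed

lemma quotient_map_root_poly: "quotient_map (complex_power {..<m}) (monic_poly_space m) (root_poly m)"
  by (intro continuous_closed_imp_quotient_map root_poly_image proper_imp_closed_map proper_map_root_poly
      continuous_map_root_poly continuous_map_product_projection) auto

text \<open>The product of a quotient map with an identity need not be a quotient map; the product
  of a proper map with an identity is proper. This permits an arbitrary parameter space
  \<open>T\<close>.\<close>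

lemma closed_map_times_root_poly:
  "closed_map (prod_topology T (complex_power {..<m})) (prod_topology T (monic_poly_space m)) (\<lambda>(t, z). (t, root_poly m z))"
proof (rule proper_imp_closed_map)
  show "proper_map (prod_topology T (complex_power {..<m})) (prod_topology T (monic_poly_space m)) (\<lambda>(t, z). (t, root_poly m z))"
    using proper_map_prod[of T "complex_power {..<m}" T "monic_poly_space m" id "root_poly m"] proper_map_root_poly
    by (simp add: proper_map_id[unfolded id_def] id_def)
qed

lemma quotient_map_times_root_poly:
  fixes T :: "'a topology"
  shows "quotient_map (prod_topology T (complex_power {..<m})) (prod_topology T (monic_poly_space m)) (\<lambda>(t, z). (t, root_poly m z))"
proof (rule continuous_closed_imp_quotient_map[OF _ closed_map_times_root_poly])
  show "continuous_map (prod_topology T (complex_power {..<m})) (prod_topology T (monic_poly_space m)) (\<lambda>(t, z). (t, root_poly m z))"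
    using quotient_imp_continuous_map[OF quotient_map_root_poly] by (simp add: continuous_map_prod_top)
  show "(\<lambda>(t, z). (t, root_poly m z)) ` topspace (prod_topology T (complex_power {..<m})) = topspace (prod_topology T (monic_poly_space m))"
  proof -
    have "(\<lambda>(t, z). (t, f z)) ` (A \<times> B) = A \<times> f ` B" for f :: "(nat \<Rightarrow> complex) \<Rightarrow> complex poly" and A :: "'a set" and B
      by force
    then show ?thesis by (simp only: topspace_prod_topology root_poly_image)
  qed
qed

section \<open>Moving roots by maps of the plane\<close>

definition monic_with_roots :: "nat \<Rightarrow> complex set \<Rightarrow> complex poly set" where
  "monic_with_roots m \<Omega> = {p \<in> monic_polys m. \<forall>w. poly p w = 0 \<longrightarrow> w \<in> \<Omega>}"

lemma root_poly_in_monic_with_roots: "root_poly m z \<in> monic_with_roots m \<Omega> \<longleftrightarrow> (\<forall>l<m. z l \<in> \<Omega>)"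
proof -
  have "(\<forall>w. (\<exists>l<m. w = z l) \<longrightarrow> w \<in> \<Omega>) \<longleftrightarrow> (\<forall>l<m. z l \<in> \<Omega>)" by blast
  then show ?thesis unfolding monic_with_roots_def by (simp only: mem_Collect_eq root_poly_monic root_poly_zero simp_thms)
qed

lemma openin_monic_poly_space_if_roots:
  assumes "openin (complex_power {..<m}) {z \<in> extensional {..<m}. root_poly m z \<in> U}" "U \<subseteq> monic_polys m"
  shows "openin (monic_poly_space m) U"
proof -
  have "topspace (complex_power {..<m}) = extensional {..<m}" by (simp add: PiE_def)
  then have "{z \<in> topspace (complex_power {..<m}). root_poly m z \<in> U} = {z \<in> extensional {..<m}. root_poly m z \<in> U}"
    by (simp only:)
  moreover have "openin (complex_power {..<m}) {z \<in> topspace (complex_power {..<m}). root_poly m z \<in> U}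
      \<longleftrightarrow> openin (monic_poly_space m) U"
    using quotient_map_root_poly[of m] assms(2) unfolding quotient_map_def topspace_monic_poly_space by blast
  ultimately show ?thesis using assms(1) by (simp only:)
qed

lemma openin_monic_with_roots:
  assumes "open \<Omega>"
  shows "openin (monic_poly_space m) (monic_with_roots m \<Omega>)"
proof (rule openin_monic_poly_space_if_roots)
  have "{z \<in> extensional {..<m}. root_poly m z \<in> monic_with_roots m \<Omega>} = PiE {..<m} (\<lambda>_. \<Omega>)"
    by (simp add: root_poly_in_monic_with_roots PiE_iff set_eq_iff) blast
  then show "openin (complex_power {..<m}) {z \<in> extensional {..<m}. root_poly m z \<in> monic_with_roots m \<Omega>}"
    using assms by (simp add: openin_PiE)
qed (auto simp: monic_with_roots_def)

text \<open>Acting on the multiset of roots needs no ordering and respects multiplicities; on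
  ordered roots it is \<open>\<theta>\<close> in each coordinate.\<close>

definition move_roots :: "(complex \<Rightarrow> complex) \<Rightarrow> complex poly \<Rightarrow> complex poly" where
  "move_roots \<theta> p = (\<Prod>x\<in>#proots p. [:- \<theta> x, 1:])"

lemma move_roots_root_poly: "move_roots \<theta> (root_poly m z) = root_poly m (\<lambda>l. \<theta> (z l))"
  unfolding move_roots_def proots_root_poly by (simp add: root_poly_eq_prod_mset image_mset.compositionality o_def)

text \<open>Continuity is evident on ordered roots and descends along the quotient map
  \<open>(t, z) \<mapsto> (t, root_poly m z)\<close>, restricted to the open set of polynomials with
  all roots in \<open>\<Omega>\<close>. The parameter \<open>t\<close> serves homotopies, and
  \<open>\<Omega>\<close> serves maps that are continuous only off a line or only on a half
  plane.\<close>

lemma continuous_map_move_roots: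
  fixes T :: "'a topology"
  assumes \<Omega>: "open \<Omega>"
    and \<theta>: "continuous_map (prod_topology T (top_of_set \<Omega>)) euclidean (\<lambda>(t, x). \<theta> t x)"
  shows "continuous_map (prod_topology T (subtopology (monic_poly_space m) (monic_with_roots m \<Omega>))) (monic_poly_space m)
    (\<lambda>(t, p). move_roots (\<theta> t) p)"
proof -
  let ?U = "topspace T \<times> PiE {..<m} (\<lambda>_. \<Omega>)" and ?V = "topspace T \<times> monic_with_roots m \<Omega>"
  let ?S = "subtopology (prod_topology T (complex_power {..<m})) ?U"
  have V: "openin (prod_topology T (monic_poly_space m)) ?V"
    using openin_monic_with_roots[OF \<Omega>] by (simp add: openin_prod_Times_iff)
  have "{x \<in> topspace (prod_topology T (complex_power {..<m})). (case x of (t, z) \<Rightarrow> (t, root_poly m z)) \<in> ?V} = ?U"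
  proof (rule Set.set_eqI)
    fix x :: "'a \<times> (nat \<Rightarrow> complex)"
    obtain t z where "x = (t, z)" by fastforce
    then show "x \<in> {x \<in> topspace (prod_topology T (complex_power {..<m})). (case x of (t, z) \<Rightarrow> (t, root_poly m z)) \<in> ?V}
      \<longleftrightarrow> x \<in> ?U"
      by (simp add: root_poly_in_monic_with_roots PiE_iff) blast
  qed
  from quotient_map_restriction[OF quotient_map_times_root_poly this disjI1[OF V]]
  have "quotient_map ?S (subtopology (prod_topology T (monic_poly_space m)) ?V) (\<lambda>(t, z). (t, root_poly m z))" .
  moreover have "continuous_map ?S (monic_poly_space m) ((\<lambda>(t, p). move_roots (\<theta> t) p) \<circ> (\<lambda>(t, z). (t, root_poly m z)))"
  proof -
    have "continuous_map ?S euclidean (\<lambda>p. \<theta> (fst p) (snd p l))" if "l < m" for l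
    proof -
      have "continuous_map ?S (complex_power {..<m}) snd"
        by (intro continuous_map_from_subtopology continuous_map_snd)
      from continuous_map_compose[OF this continuous_map_product_projection] that
      have "continuous_map ?S euclidean (\<lambda>p. snd p l)" by (simp add: o_def)
      moreover have "snd p l \<in> \<Omega>" if p: "p \<in> topspace ?S" for p
      proof -
        have "snd p \<in> PiE {..<m} (\<lambda>_. \<Omega>)" using p by (simp add: mem_Times_iff)
        then show ?thesis by (rule PiE_mem) (use \<open>l < m\<close> in simp)
      qed
      ultimately have "continuous_map ?S (top_of_set \<Omega>) (\<lambda>p. snd p l)"
        unfolding continuous_map_in_subtopology by blast
      moreover have "continuous_map ?S T fst"
        by (intro continuous_map_from_subtopology continuous_map_fst)
      ultimately have "continuous_map ?S (prod_topology T (top_of_set \<Omega>)) (\<lambda>p. (fst p, snd p l))"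
        by (intro continuous_map_pairedI)
      from continuous_map_compose[OF this \<theta>] show ?thesis by (simp add: o_def)
    qed
    then show ?thesis
      by (simp add: o_def case_prod_beta' move_roots_root_poly continuous_map_root_poly)
  qed
  ultimately have "continuous_map (subtopology (prod_topology T (monic_poly_space m)) ?V) (monic_poly_space m)
      (\<lambda>(t, p). move_roots (\<theta> t) p)"
    by (rule continuous_compose_quotient_map)
  then show ?thesis by (simp add: subtopology_Times subtopology_topspace)
qed

section \<open>Divisors and division with remainder\<close>

lemma monic_dvd_factor:
  assumes h: "h \<in> monic_polys k" and p: "p \<in> monic_polys m" and "h dvd p"
  obtains g where "g \<in> monic_polys (m - k)" "p = h * g" "k \<le> m"
proof -
  obtain g where g: "p = h * g" using \<open>h dvd p\<close> by (auto elim: dvdE)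
  have nz: "h \<noteq> 0" "g \<noteq> 0" using g monic_polys_nonzero[OF p] by auto
  have "m = k + degree g" using degree_mult_eq[OF nz] h p g by (simp add: monic_polys_def)
  moreover have "lead_coeff g = 1" using lead_coeff_mult[of h g] h p g by (auto simp: monic_polys_def)
  ultimately show ?thesis using g by (intro that[of g]) (auto simp: monic_polys_def)
qed

lemma root_poly_cong: "(\<And>l. l < m \<Longrightarrow> z l = w l) \<Longrightarrow> root_poly m z = root_poly m w"
  by (simp add: root_poly_def)

lemma root_poly_append:
  "root_poly (k + j) (\<lambda>l. if l < k then a l else b (l - k)) = root_poly k a * root_poly j b"
proof (induction j)
  case 0
  then show ?case by (simp add: root_poly_def)
next
  case (Suc j)
  then show ?case unfolding root_poly_def by (simp add: mult.assoc del: mult_pCons_left mult_pCons_right)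
qed

lemma closedin_divisor_projection:
  assumes E: "closedin (prod_topology M (monic_poly_space k)) E"
    and p: "continuous_map M (monic_poly_space m) p"
    and dvd: "\<And>x h. (x, h) \<in> E \<Longrightarrow> h dvd p x"
  shows "closedin M (fst ` E)"
proof (cases "E = {}")
  case False
  have Em: "x \<in> topspace M" "h \<in> monic_polys k" if "(x, h) \<in> E" for x h
    using closedin_subset[OF E] that by (auto simp: topspace_monic_poly_space)
  have pm: "p x \<in> monic_polys m" if "x \<in> topspace M" for x
    using p that by (simp add: continuous_map_into_monic_poly_space)
  have km: "k \<le> m"
    using False dvd Em pm monic_dvd_factor by (metis ex_in_conv old.prod.exhaust)
  let ?W = "prod_topology M (complex_power {..<m})"
  have z: "continuous_map ?W euclidean (\<lambda>w. snd w l)" if "l < m" for l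
    using continuous_map_compose[OF continuous_map_snd continuous_map_product_projection[of l "{..<m}"]] that
    by (simp add: o_def)
  have r: "continuous_map ?W (monic_poly_space j) (\<lambda>w. root_poly j (snd w))" if "j \<le> m" for j
    using that by (intro continuous_map_root_poly z) auto
  define C where "C = {w \<in> topspace ?W. root_poly m (snd w) = p (fst w)}
      \<inter> {w \<in> topspace ?W. (fst w, root_poly k (snd w)) \<in> E}"
  have "closedin ?W C"
    unfolding C_def
  proof (rule closedin_Int)
    show "closedin ?W {w \<in> topspace ?W. root_poly m (snd w) = p (fst w)}"
    proof (rule closedin_continuous_maps_eq[OF _ r[OF order_refl]])
      show "Hausdorff_space (monic_poly_space m)"
        by (rule metrizable_imp_Hausdorff_space[OF metrizable_monic_poly_space])
      show "continuous_map ?W (monic_poly_space m) (\<lambda>w. p (fst w))"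
        by (rule continuous_map_fst_comp[OF p])
    qed
    show "closedin ?W {w \<in> topspace ?W. (fst w, root_poly k (snd w)) \<in> E}"
      by (rule closedin_continuous_map_preimage[OF _ E]) (intro continuous_map_pairedI continuous_map_fst r km)
  qed
  then have D: "closedin (prod_topology M (monic_poly_space m)) ((\<lambda>(t, z). (t, root_poly m z)) ` C)"
    using closed_map_times_root_poly[of M m] by (simp add: closed_map_def)
  let ?P = "{x \<in> topspace M. (x, p x) \<in> (\<lambda>(t, z). (t, root_poly m z)) ` C}"
  have "continuous_map M (prod_topology M (monic_poly_space m)) (\<lambda>x. (x, p x))"
    by (intro continuous_map_pairedI p) auto
  from closedin_continuous_map_preimage[OF this D]
  have "closedin M ?P" .
  moreover have "?P = fst ` E"
  proof (rule equalityI; rule subsetI)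
    fix x assume "x \<in> ?P"
    then obtain z where "(x, z) \<in> C" by auto
    then have "(x, root_poly k z) \<in> E" by (simp add: C_def)
    then show "x \<in> fst ` E" by (rule rev_image_eqI) simp
  next
    fix x assume "x \<in> fst ` E"
    then obtain h where h: "(x, h) \<in> E" by auto
    have hm: "h \<in> monic_polys k" "x \<in> topspace M" using Em[OF h] by auto
    obtain g where g: "g \<in> monic_polys (m - k)" "p x = h * g"
      using monic_dvd_factor[OF hm(1) pm[OF hm(2)] dvd[OF h]] by metis
    obtain a where a: "h = root_poly k a" using root_poly_surj[OF hm(1)] by metis
    obtain b where b: "g = root_poly (m - k) b" using root_poly_surj[OF g(1)] by metis
    define z where "z = (\<lambda>l\<in>{..<m}. if l < k then a l else b (l - k))"
    have "root_poly m z = root_poly (k + (m - k)) (\<lambda>l. if l < k then a l else b (l - k))"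
      using km by (simp add: z_def root_poly_def)
    then have 1: "root_poly m z = p x" using root_poly_append a b g(2) by simp
    have 2: "root_poly k z = h"
      unfolding a using km by (intro root_poly_cong) (simp add: z_def)
    have "(x, z) \<in> C"
      using 1 2 h hm(2) by (simp add: C_def z_def)
    then have "(x, root_poly m z) \<in> (\<lambda>(t, z). (t, root_poly m z)) ` C"
      by (rule rev_image_eqI) simp
    then show "x \<in> ?P"
      using hm(2) 1 by simp
  qed
  ultimately show ?thesis by simp
qed simp

text \<open>The last claim says that the remainder has no coefficients from degree \<open>k\<close>
  on. It has the shape of \<open>coeff_sum_monom\<close>, so that the remainder can be rebuilt from
  \<open>k\<close> numbers.\<close>

lemma monic_div:
  assumes f: "f \<in> monic_polys m" and h: "h \<in> monic_polys k" and "k \<le> m"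
  shows "f div h \<in> monic_polys (m - k)" "f mod h = 0 \<or> degree (f mod h) < k"
    and "poly.coeff (f mod h) l = (if l < k then poly.coeff (f mod h) l else 0)"
proof -
  have h0: "h \<noteq> 0" "degree h = k" "poly.coeff h k = 1" using h by (auto simp: monic_polys_def)
  have f0: "degree f = m" "poly.coeff f m = 1" using f by (auto simp: monic_polys_def)
  show r: "f mod h = 0 \<or> degree (f mod h) < k" using degree_mod_less[OF h0(1), of f] h0(2) by simp
  show "poly.coeff (f mod h) l = (if l < k then poly.coeff (f mod h) l else 0)" for l
    using r by (auto simp: coeff_eq_0)
  then have c: "poly.coeff (f div h * h) l = poly.coeff f l" if "k \<le> l" for l
    using that div_mult_mod_eq[of f h] coeff_add[of "f div h * h" "f mod h" l] by (metis add.right_neutral not_le)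
  have d: "degree (f div h * h) = m"
  proof (rule antisym)
    show "degree (f div h * h) \<le> m"
    proof (rule degree_le, intro allI impI)
      fix i assume "m < i"
      then show "poly.coeff (f div h * h) i = 0" using c[of i] f0 \<open>k \<le> m\<close> by (simp add: coeff_eq_0)
    qed
    show "m \<le> degree (f div h * h)"
      by (rule le_degree) (use c[OF \<open>k \<le> m\<close>] f0 in simp)
  qed
  have "f div h * h \<noteq> 0" using c[OF \<open>k \<le> m\<close>] f0 by auto
  then have "degree (f div h) + k = m" using d degree_mult_eq[of "f div h" h] h0 by auto
  moreover have "lead_coeff (f div h) = 1"
    using lead_coeff_mult[of "f div h" h] c[OF \<open>k \<le> m\<close>] d f0 h0 by simp
  ultimately show "f div h \<in> monic_polys (m - k)" by (auto simp: monic_polys_def)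
qed

text \<open>The division algorithm as a descending recursion: coefficient \<open>l\<close> of the
  quotient is a polynomial in the coefficients of \<open>f\<close>, those of \<open>h\<close> and
  the higher ones of the quotient. As \<open>h\<close> is monic, no denominators occur.\<close>

lemma coeff_monic_div:
  assumes f: "f \<in> monic_polys m" and h: "h \<in> monic_polys k" and "k \<le> m"
  shows "poly.coeff (f div h) l = poly.coeff f (l + k) - (\<Sum>i\<in>{l<..l + k}. poly.coeff (f div h) i * poly.coeff h (l + k - i))"
proof -
  have "poly.coeff f (l + k) = poly.coeff (f div h * h) (l + k) + poly.coeff (f mod h) (l + k)"
    by (metis coeff_add div_mult_mod_eq)
  also have "poly.coeff (f mod h) (l + k) = 0" using monic_div(3)[OF assms, of "l + k"] by simp
  also have "poly.coeff (f div h * h) (l + k) = (\<Sum>i\<le>l + k. poly.coeff (f div h) i * poly.coeff h (l + k - i))"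
    by (rule coeff_mult)
  also have "\<dots> = (\<Sum>i\<in>{l..l + k}. poly.coeff (f div h) i * poly.coeff h (l + k - i))"
  proof (rule sum.mono_neutral_right)
    show "\<forall>i\<in>{..l + k} - {l..l + k}. poly.coeff (f div h) i * poly.coeff h (l + k - i) = 0"
    proof
      fix i assume "i \<in> {..l + k} - {l..l + k}"
      then have "k < l + k - i" by auto
      then show "poly.coeff (f div h) i * poly.coeff h (l + k - i) = 0"
        using coeff_monic_polys(2)[OF h] by simp
    qed
  qed auto
  also have "{l..l + k} = insert l {l<..l + k}" by auto
  also have "(\<Sum>i\<in>insert l {l<..l + k}. poly.coeff (f div h) i * poly.coeff h (l + k - i))
      = poly.coeff (f div h) l + (\<Sum>i\<in>{l<..l + k}. poly.coeff (f div h) i * poly.coeff h (l + k - i))"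
    using coeff_monic_polys(1)[OF h] by simp
  finally show ?thesis by simp
qed

text \<open>Descending induction on the index along \<open>coeff_monic_div\<close>. It starts above
  \<open>m\<close>, where the coefficients of the quotient are zero.\<close>

lemma continuous_map_monic_div:
  assumes F: "continuous_map X (monic_poly_space m) F" and H: "continuous_map X (monic_poly_space k) H" and "k \<le> m"
  shows "continuous_map X (monic_poly_space (m - k)) (\<lambda>x. F x div H x)"
proof -
  have Fm: "F x \<in> monic_polys m" "H x \<in> monic_polys k" if "x \<in> topspace X" for x
    using F H that by (auto simp: continuous_map_into_monic_poly_space)
  have c: "continuous_map X euclidean (\<lambda>x. poly.coeff (F x) l)" "continuous_map X euclidean (\<lambda>x. poly.coeff (H x) l)" for l
    using F H by (auto simp: continuous_map_into_monic_poly_space coeffs_continuous_def)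
  have "continuous_map X euclidean (\<lambda>x. poly.coeff (F x div H x) l)" for l
  proof (induction "Suc m - l" arbitrary: l rule: less_induct)
    case less
    show ?case
    proof (cases "l \<le> m")
      case True
      have "continuous_map X euclidean (\<lambda>x. poly.coeff (F x) (l + k)
          - (\<Sum>i\<in>{l<..l + k}. poly.coeff (F x div H x) i * poly.coeff (H x) (l + k - i)))"
        using True less
        by (intro continuous_map_diff continuous_map_sum continuous_map_complex_mult c) auto
      then show ?thesis
        by (rule continuous_map_eq) (use coeff_monic_div[OF Fm \<open>k \<le> m\<close>] in metis)
    next
      case False
      have "continuous_map X euclidean (\<lambda>x. 0 :: complex)" by simp
      then show ?thesis
      proof (rule continuous_map_eq)
        fix x assume "x \<in> topspace X"
        then show "0 = poly.coeff (F x div H x) l"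
          using False coeff_monic_polys(2)[OF monic_div(1)[OF Fm \<open>k \<le> m\<close>]] by simp
      qed
    qed
  qed
  then show ?thesis
    using monic_div(1)[OF Fm \<open>k \<le> m\<close>] by (simp add: continuous_map_into_monic_poly_space coeffs_continuous_def)
qed

lemma coeffs_continuous_mod:
  assumes F: "continuous_map X (monic_poly_space m) F" and H: "continuous_map X (monic_poly_space k) H" and "k \<le> m"
  shows "coeffs_continuous X (\<lambda>x. F x mod H x)"
  using continuous_map_monic_div[OF assms] F H
  unfolding continuous_map_into_monic_poly_space minus_div_mult_eq_mod[symmetric]
  by (intro coeffs_continuous_diff coeffs_continuous_mult) auto

lemma continuous_map_monic_mult:
  assumes "continuous_map X (monic_poly_space a) F" "continuous_map X (monic_poly_space b) G"
  shows "continuous_map X (monic_poly_space (a + b)) (\<lambda>x. F x * G x)"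
  using assms by (auto simp: continuous_map_into_monic_poly_space intro: monic_polys_mult)

section \<open>Common factors of tuples\<close>

abbreviation tuple_space :: "nat \<Rightarrow> (nat \<Rightarrow> nat) \<Rightarrow> (nat \<Rightarrow> complex poly) topology" where
  "tuple_space n D \<equiv> product_topology (\<lambda>i. monic_poly_space (D i)) {..<n}"

definition common_factor :: "nat set \<Rightarrow> nat \<Rightarrow> (nat \<Rightarrow> complex poly) \<Rightarrow> bool" where
  "common_factor \<sigma> k f \<longleftrightarrow> (\<exists>h\<in>monic_polys k. \<forall>j\<in>\<sigma>. h dvd f j)"

lemma tuple_monic: "f \<in> topspace (tuple_space n D) \<Longrightarrow> i < n \<Longrightarrow> f i \<in> monic_polys (D i)"
  by (auto simp: topspace_monic_poly_space)

lemma closedin_coeffs_zero: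
  assumes "coeffs_continuous X F"
  shows "closedin X {x \<in> topspace X. F x = 0}"
proof -
  have "closedin X {x \<in> topspace X. poly.coeff (F x) l \<in> {0}}" for l
    using assms by (intro closedin_continuous_map_preimage[of X euclidean]) (auto simp: coeffs_continuous_def)
  then have "closedin X (\<Inter>l. {x \<in> topspace X. poly.coeff (F x) l \<in> {0}})"
    by (intro closedin_INT) auto
  moreover have "(\<Inter>l. {x \<in> topspace X. poly.coeff (F x) l \<in> {0}}) = {x \<in> topspace X. F x = 0}"
    by (auto simp: poly_eq_iff)
  ultimately show ?thesis by simp
qed

lemma closedin_dvd:
  assumes F: "continuous_map X (monic_poly_space m) F" and H: "continuous_map X (monic_poly_space k) H"
  shows "closedin X {x \<in> topspace X. H x dvd F x}"
proof (cases "k \<le> m")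
  case True
  show ?thesis
    using closedin_coeffs_zero[OF coeffs_continuous_mod[OF assms True]] by (simp add: dvd_eq_mod_eq_0)
next
  case False
  have "\<not> H x dvd F x" if "x \<in> topspace X" for x
    using F H that monic_dvd_factor[of "H x" k "F x" m] False
    by (auto simp: continuous_map_into_monic_poly_space)
  then have "{x \<in> topspace X. H x dvd F x} = {}" by blast
  then show ?thesis by (simp only: closedin_empty)
qed

lemma closedin_common_divisors:
  assumes p: "\<And>j. j \<in> \<sigma> \<Longrightarrow> continuous_map X (monic_poly_space (D j)) (\<lambda>x. p x j)"
    and "\<sigma> \<noteq> {}"
  shows "closedin (prod_topology X (monic_poly_space k))
     {w \<in> topspace (prod_topology X (monic_poly_space k)). \<forall>j\<in>\<sigma>. snd w dvd p (fst w) j}"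
proof -
  let ?W = "prod_topology X (monic_poly_space k)"
  have "closedin ?W {w \<in> topspace ?W. snd w dvd p (fst w) j}" if "j \<in> \<sigma>" for j
    using that by (intro closedin_dvd[where m = "D j" and k = k] continuous_map_snd continuous_map_fst_comp p)
  then have "closedin ?W (\<Inter>j\<in>\<sigma>. {w \<in> topspace ?W. snd w dvd p (fst w) j})"
    using \<open>\<sigma> \<noteq> {}\<close> by (intro closedin_INT)
  moreover have "(\<Inter>j\<in>\<sigma>. {w \<in> topspace ?W. snd w dvd p (fst w) j}) = {w \<in> topspace ?W. \<forall>j\<in>\<sigma>. snd w dvd p (fst w) j}"
    using \<open>\<sigma> \<noteq> {}\<close> by blast
  ultimately show ?thesis by simp
qed

lemma continuous_map_tuple_component:
  "i < n \<Longrightarrow> continuous_map (tuple_space n D) (monic_poly_space (D i)) (\<lambda>f. f i)"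
  by (rule continuous_map_product_projection) simp

lemma continuous_map_into_tuple_space:
  assumes "\<And>j. j < n \<Longrightarrow> continuous_map Z (monic_poly_space (D j)) (\<lambda>w. F w j)"
  shows "continuous_map Z (tuple_space n D) (\<lambda>w. \<lambda>j\<in>{..<n}. F w j)"
  unfolding continuous_map_componentwise
proof (intro conjI ballI)
  show "(\<lambda>w. \<lambda>j\<in>{..<n}. F w j) ` topspace Z \<subseteq> extensional {..<n}" by (intro image_subsetI restrict_extensional)
qed (use assms in simp)

text \<open>A single component \<open>f j\<close> with \<open>j \<in> \<sigma>\<close> confines the
  possible divisors enough for the projection of the pairs (tuple, divisor) to be closed.\<close>

lemma closedin_common_factor:
  assumes "\<sigma> \<subseteq> {..<n}" "\<sigma> \<noteq> {}"
  shows "closedin (tuple_space n D) {f \<in> topspace (tuple_space n D). common_factor \<sigma> k f}"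
proof -
  let ?W = "prod_topology (tuple_space n D) (monic_poly_space k)"
  let ?E = "{w \<in> topspace ?W. \<forall>j\<in>\<sigma>. snd w dvd fst w j}"
  obtain j where j: "j \<in> \<sigma>" "j < n" using assms by auto
  have "closedin ?W ?E"
    using assms by (intro closedin_common_divisors[where D = D] continuous_map_tuple_component) auto
  then have "closedin (tuple_space n D) (fst ` ?E)"
    using j by (intro closedin_divisor_projection[OF _ continuous_map_tuple_component[OF j(2)]]) auto
  moreover have "fst ` ?E = {f \<in> topspace (tuple_space n D). common_factor \<sigma> k f}"
  proof (intro equalityI subsetI)
    fix f assume "f \<in> fst ` ?E"
    then show "f \<in> {f \<in> topspace (tuple_space n D). common_factor \<sigma> k f}"
      by (auto simp: common_factor_def topspace_monic_poly_space)
  next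
    fix f assume f: "f \<in> {f \<in> topspace (tuple_space n D). common_factor \<sigma> k f}"
    then obtain h where "h \<in> monic_polys k" "\<forall>j\<in>\<sigma>. h dvd f j" by (auto simp: common_factor_def)
    then have "(f, h) \<in> ?E" using f by (simp add: topspace_monic_poly_space)
    then show "f \<in> fst ` ?E" by (rule rev_image_eqI) simp
  qed
  ultimately show ?thesis by simp
qed

text \<open>At every point \<open>w\<close> some cofactor \<open>g j\<close> does not vanish, so
  \<open>h * g j\<close> has there the order of \<open>h\<close>, which bounds the order of
  \<open>h'\<close>. Thus \<open>h\<close> is the greatest common divisor.\<close>

lemma proots_common_divisor_subset:
  assumes nz: "\<And>j. j \<in> \<sigma> \<Longrightarrow> h * g j \<noteq> 0" and no: "\<not> (\<exists>w. \<forall>j\<in>\<sigma>. poly (g j) w = 0)"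
    and h': "h' \<noteq> 0" "\<And>j. j \<in> \<sigma> \<Longrightarrow> h' dvd h * g j"
  shows "proots h' \<subseteq># proots h"
proof -
  have "count (proots h') w \<le> count (proots h) w" for w
  proof -
    obtain j where j: "j \<in> \<sigma>" "poly (g j) w \<noteq> 0" using no by blast
    then have h: "h \<noteq> 0" and o: "order w (h * g j) = order w h"
      using nz[OF j(1)] by (auto simp: order_mult order_0I)
    have "order w h' \<le> order w h"
      using dvd_imp_order_le[OF nz[OF j(1)] h'(2)[OF j(1)], of w] by (simp only: o)
    then show ?thesis using h h'(1) by simp
  qed
  then show ?thesis by (rule mset_subset_eqI)
qed

lemma common_factor_1: "common_factor \<sigma> 1 f \<longleftrightarrow> (\<exists>z. \<forall>j\<in>\<sigma>. poly (f j) z = 0)"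
proof -
  have "\<exists>z. h = [:- z, 1:]" if "h \<in> monic_polys 1" for h
    using root_poly_surj[OF that] by (auto simp: root_poly_def)
  then show ?thesis
    unfolding common_factor_def poly_eq_0_iff_dvd using monic_polys_linear by metis
qed

lemma common_factor_Suc_if_common_root:
  assumes h: "h \<in> monic_polys k" and w: "\<And>j. j \<in> \<sigma> \<Longrightarrow> f j = h * g j" "\<And>j. j \<in> \<sigma> \<Longrightarrow> poly (g j) w = 0"
  shows "common_factor \<sigma> (Suc k) f"
proof -
  have "h * [:- w, 1:] \<in> monic_polys (Suc k)" using monic_polys_mult[OF h monic_polys_linear[of w]] by simp
  moreover have "h * [:- w, 1:] dvd f j" if "j \<in> \<sigma>" for j
    unfolding w(1)[OF that] using w(2)[OF that] by (intro mult_dvd_mono dvd_refl) (simp only: poly_eq_0_iff_dvd)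
  ultimately show ?thesis unfolding common_factor_def by blast
qed

lemma common_factor_SucD:
  assumes "common_factor \<sigma> (Suc k) f"
  shows "common_factor \<sigma> k f"
proof -
  obtain h where h: "h \<in> monic_polys (Suc k)" "\<forall>j\<in>\<sigma>. h dvd f j" using assms by (auto simp: common_factor_def)
  obtain z where "h = root_poly (Suc k) z" using root_poly_surj[OF h(1)] by metis
  then have "root_poly k z dvd h" by (simp only: root_poly_def prod.lessThan_Suc dvd_triv_left)
  then show ?thesis using h(2) root_poly_monic dvd_trans unfolding common_factor_def by blast
qed

lemma monic_eq_if_proots_subset:
  assumes "h \<in> monic_polys k" "h' \<in> monic_polys k" "proots h' \<subseteq># proots h"
  shows "h = h'"
proof -
  have "size (proots h') = size (proots h)"
    using assms(1,2) by (simp add: size_proots_complex monic_polys_def)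
  then have "proots h' = proots h"
    using assms(3) by (metis mset_subset_size nat_neq_iff subset_mset.le_neq_trans)
  then show ?thesis using monic_prod_proots[OF assms(1)] monic_prod_proots[OF assms(2)] by simp
qed

text \<open>If the cofactors of \<open>h\<close> had a common root, a linear factor could be moved
  into \<open>h\<close>, giving a common factor of degree \<open>Suc k\<close>. Hence the roots of
  \<open>h'\<close> are among those of \<open>h\<close>, and the degrees agree.\<close>

lemma common_divisor_unique:
  assumes f: "\<And>j. j \<in> \<sigma> \<Longrightarrow> f j \<noteq> 0" and no: "\<not> common_factor \<sigma> (Suc k) f"
    and h: "h \<in> monic_polys k" "\<And>j. j \<in> \<sigma> \<Longrightarrow> h dvd f j"
    and h': "h' \<in> monic_polys k" "\<And>j. j \<in> \<sigma> \<Longrightarrow> h' dvd f j"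
  shows "h = h'"
proof -
  have "\<forall>j\<in>\<sigma>. \<exists>g. f j = h * g" using h(2) by (auto elim: dvdE)
  then obtain g where "\<forall>j\<in>\<sigma>. f j = h * g j" unfolding bchoice_iff ..
  then have g: "f j = h * g j" if "j \<in> \<sigma>" for j using that by (rule bspec)
  have "\<not> (\<exists>w. \<forall>j\<in>\<sigma>. poly (g j) w = 0)"
  proof
    assume "\<exists>w. \<forall>j\<in>\<sigma>. poly (g j) w = 0"
    then obtain w where w: "\<forall>j\<in>\<sigma>. poly (g j) w = 0" ..
    have "common_factor \<sigma> (Suc k) f"
    proof (rule common_factor_Suc_if_common_root[OF h(1)])
      show "f j = h * g j" if "j \<in> \<sigma>" for j by (rule g[OF that])
      show "poly (g j) w = 0" if "j \<in> \<sigma>" for j using w that by blast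
    qed
    then show False using no by contradiction
  qed
  then have "proots h' \<subseteq># proots h"
  proof (rule proots_common_divisor_subset[rotated])
    show "h' \<noteq> 0" by (rule monic_polys_nonzero[OF h'(1)])
    show "h * g j \<noteq> 0" "h' dvd h * g j" if "j \<in> \<sigma>" for j
      using f[OF that] h'(2)[OF that] by (simp_all only: g[OF that] not_False_eq_True)
  qed
  then show ?thesis by (rule monic_eq_if_proots_subset[OF h(1) h'(1)])
qed

section \<open>The Thom isomorphism of a stratum\<close>

lemma null_along_homeomorphic_maps:
  assumes "homeomorphic_maps X Y f g" "K \<subseteq> topspace X"
  shows "null_along q X K \<longleftrightarrow> null_along q Y (f ` K)"
  using assms null_along_homeomorphic homeomorphic_map_maps by blast

text \<open>By uniqueness of the common divisor, the set in the product is the graph of a function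
  \<open>g\<close> on \<open>T\<close>. Once \<open>g\<close> is known to be continuous,
  \<open>null_along_graph\<close> applies with the \<open>k\<close> coefficients of
  \<open>g x\<close> as coordinates.\<close>

lemma null_along_common_divisors:
  assumes X: "metrizable_space X" and "closedin X T" and \<sigma>: "\<sigma> \<noteq> {}"
    and p: "\<And>j. j \<in> \<sigma> \<Longrightarrow> continuous_map X (monic_poly_space (D j)) (\<lambda>x. p x j)"
    and no: "\<And>x. x \<in> T \<Longrightarrow> \<not> common_factor \<sigma> (Suc k) (p x)"
    and T: "\<And>x. x \<in> T \<Longrightarrow> common_factor \<sigma> k (p x)"
  shows "null_along (q + 2 * int k) (prod_topology X (monic_poly_space k))
      {w \<in> T \<times> monic_polys k. \<forall>j\<in>\<sigma>. snd w dvd p (fst w) j} \<longleftrightarrow> null_along q X T"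
proof -
  have TX: "T \<subseteq> topspace X" using \<open>closedin X T\<close> closedin_subset by blast
  have nz: "p x j \<noteq> 0" if "x \<in> topspace X" "j \<in> \<sigma>" for x j
    using p[OF that(2)] that(1) by (auto simp: continuous_map_into_monic_poly_space dest: monic_polys_nonzero)
  define g where "g x = (SOME h. h \<in> monic_polys k \<and> (\<forall>j\<in>\<sigma>. h dvd p x j))" for x
  have g: "g x \<in> monic_polys k" "\<forall>j\<in>\<sigma>. g x dvd p x j" if "x \<in> T" for x
    using someI_ex[of "\<lambda>h. h \<in> monic_polys k \<and> (\<forall>j\<in>\<sigma>. h dvd p x j)"] T[OF that]
    by (auto simp: g_def common_factor_def)
  have gu: "h = g x" if "x \<in> T" "h \<in> monic_polys k" "\<forall>j\<in>\<sigma>. h dvd p x j" for x h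
    using common_divisor_unique[of \<sigma> "p x" k h "g x"] nz no g that TX by blast
  obtain j where j: "j \<in> \<sigma>" using \<sigma> by blast
  let ?W = "prod_topology X (monic_poly_space k)"
  let ?E = "{w \<in> T \<times> monic_polys k. \<forall>j\<in>\<sigma>. snd w dvd p (fst w) j}"
  have Eg: "?E = (\<lambda>x. (x, g x)) ` T" using g gu by auto
  have cont: "continuous_map (subtopology X T) (monic_poly_space k) g"
    unfolding continuous_map_closedin
  proof (intro conjI allI impI)
    show "g \<in> topspace (subtopology X T) \<rightarrow> topspace (monic_poly_space k)"
      using g(1) by (simp add: topspace_monic_poly_space)
    fix B assume B: "closedin (monic_poly_space k) B"
    \<comment> \<open>The preimage of a closed set \<open>B\<close> under \<open>g\<close> is the
      projection of a closed set of pairs (point, divisor); such projections are closed.\<close>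
    let ?F = "T \<times> B \<inter> {w \<in> topspace ?W. \<forall>j\<in>\<sigma>. snd w dvd p (fst w) j}"
    have "closedin ?W (T \<times> B)" using \<open>closedin X T\<close> B by (simp add: closedin_prod_Times_iff)
    then have "closedin ?W ?F"
      using p \<sigma> by (intro closedin_Int closedin_common_divisors[where D = D]) auto
    then have "closedin X (fst ` ?F)"
      using j by (intro closedin_divisor_projection[OF _ p[OF j]]) auto
    moreover have "fst ` ?F = {x \<in> T. g x \<in> B}"
    proof (intro equalityI subsetI)
      fix x assume "x \<in> fst ` ?F"
      then obtain h where h: "x \<in> T" "h \<in> B" "h \<in> monic_polys k" "\<forall>j\<in>\<sigma>. h dvd p x j"
        by (auto simp: topspace_monic_poly_space)
      have "h = g x" using h by (intro gu)
      then show "x \<in> {x \<in> T. g x \<in> B}" using h by simp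
    next
      fix x assume x: "x \<in> {x \<in> T. g x \<in> B}"
      then have "(x, g x) \<in> ?F"
        using g[of x] TX by (auto simp: topspace_monic_poly_space)
      then show "x \<in> fst ` ?F"
        by (rule rev_image_eqI) simp
    qed
    ultimately have "closedin X {x \<in> T. g x \<in> B}" by simp
    then have "closedin (subtopology X T) {x \<in> T. g x \<in> B}"
      using \<open>closedin X T\<close> by (auto simp: closedin_closed_subtopology)
    moreover have "{x \<in> topspace (subtopology X T). g x \<in> B} = {x \<in> T. g x \<in> B}" using TX by auto
    ultimately show "closedin (subtopology X T) {x \<in> topspace (subtopology X T). g x \<in> B}" by simp
  qed
  let ?c = "\<lambda>p. restrict (poly.coeff p) {..<k}"
  let ?d = "\<lambda>c. Polynomial.monom 1 k + (\<Sum>l<k. Polynomial.monom (c l) l) :: complex poly"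
  have "homeomorphic_maps ?W (prod_topology X (complex_power {..<k})) (\<lambda>(x, h). (x, ?c h)) (\<lambda>(x, h). (x, ?d h))"
    using homeomorphic_maps_coeffs[of k] by (subst homeomorphic_maps_prod) (simp add: homeomorphic_maps_def)
  moreover have "?E \<subseteq> topspace ?W" using TX by (auto simp: topspace_monic_poly_space)
  ultimately have "null_along (q + 2 * int k) ?W ?E
      \<longleftrightarrow> null_along (q + 2 * int k) (prod_topology X (complex_power {..<k})) ((\<lambda>(x, h). (x, ?c h)) ` ?E)"
    by (rule null_along_homeomorphic_maps)
  also have "(\<lambda>(x, h). (x, ?c h)) ` ?E = (\<lambda>x. (x, (?c \<circ> g) x)) ` T"
    unfolding Eg image_image by simp
  also have "null_along (q + 2 * int k) (prod_topology X (complex_power {..<k})) ((\<lambda>x. (x, (?c \<circ> g) x)) ` T)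
      \<longleftrightarrow> null_along q X T"
  proof -
    have "continuous_map (monic_poly_space k) (complex_power {..<k}) ?c"
      using homeomorphic_maps_coeffs[of k] by (simp add: homeomorphic_maps_def)
    from null_along_graph[OF _ metrizable_imp_normal_space[OF X] \<open>closedin X T\<close> continuous_map_compose[OF cont this], of q]
    show ?thesis by simp
  qed
  finally show ?thesis .
qed

text \<open>Both sides agree by excision with the local homology inside
  \<open>N \<inter> N'\<close>. This is for a change of coordinates under which the chosen open
  neighbourhoods of \<open>K\<close> do not correspond.\<close>

lemma null_along_open_independent:
  assumes "openin Y N" "openin Y N'" "K \<subseteq> N \<inter> N'"
    and "closedin (subtopology Y N) K" "closedin (subtopology Y N') K"
  shows "null_along p (subtopology Y N) K \<longleftrightarrow> null_along p (subtopology Y N') K"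
proof -
  have *: "null_along p (subtopology Y (A \<inter> B)) K \<longleftrightarrow> null_along p (subtopology Y A) K"
    if "openin Y B" "K \<subseteq> B" "closedin (subtopology Y A) K" for A B
  proof -
    have "subtopology Y (A \<inter> B) = subtopology (subtopology Y A) (A \<inter> B)"
      by (simp add: subtopology_subtopology Int_absorb2)
    moreover have "openin (subtopology Y A) (A \<inter> B)" using that(1) by (rule openin_subtopology_Int2)
    moreover have "K \<subseteq> A \<inter> B" using that(2) closedin_subset[OF that(3)] by auto
    ultimately show ?thesis using null_along_subtopology_open[of "subtopology Y A" "A \<inter> B" K p] that(3) by simp
  qed
  from *[of N' N] *[of N N'] show ?thesis using assms by (simp add: Int_commute)
qed

text \<open>
  In the tuples describing a stratum, the additional component with index \<open>n\<close> is the common factor.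
\<close>

definition quotient_degrees :: "nat \<Rightarrow> nat set \<Rightarrow> nat \<Rightarrow> (nat \<Rightarrow> nat) \<Rightarrow> nat \<Rightarrow> nat" where
  "quotient_degrees n \<sigma> k D = (\<lambda>j. if j = n then k else if j \<in> \<sigma> then D j - k else D j)"

definition merge_factor :: "nat \<Rightarrow> nat set \<Rightarrow> (nat \<Rightarrow> complex poly) \<Rightarrow> nat \<Rightarrow> complex poly" where
  "merge_factor n \<sigma> F = (\<lambda>j\<in>{..<n}. if j \<in> \<sigma> then F n * F j else F j)"

definition divide_out :: "nat \<Rightarrow> nat set \<Rightarrow> nat \<Rightarrow> (nat \<Rightarrow> complex poly) \<times> complex poly
    \<Rightarrow> (nat \<Rightarrow> complex poly) \<times> (nat \<times> nat \<Rightarrow> complex)" where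
  "divide_out n \<sigma> k = (\<lambda>(f, h). (\<lambda>j\<in>{..<Suc n}. if j = n then h else if j \<in> \<sigma> then f j div h else f j,
     restrict (\<lambda>(j, l). poly.coeff (f j mod h) l) (\<sigma> \<times> {..<k})))"

definition multiply_back :: "nat \<Rightarrow> nat set \<Rightarrow> nat \<Rightarrow> (nat \<Rightarrow> complex poly) \<times> (nat \<times> nat \<Rightarrow> complex)
    \<Rightarrow> (nat \<Rightarrow> complex poly) \<times> complex poly" where
  "multiply_back n \<sigma> k = (\<lambda>(F, t). (\<lambda>j\<in>{..<n}. if j \<in> \<sigma> then F n * F j + (\<Sum>l<k. Polynomial.monom (t (j, l)) l) else F j, F n))"

lemma monic_polys_add_low:
  assumes p: "p \<in> monic_polys m" and r: "\<And>l. m \<le> l \<Longrightarrow> poly.coeff r l = 0"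
  shows "p + r \<in> monic_polys m"
proof -
  have c: "poly.coeff (p + r) l = poly.coeff p l" if "m \<le> l" for l using r[OF that] by simp
  have "degree (p + r) = m"
  proof (rule antisym)
    show "degree (p + r) \<le> m"
      by (rule degree_le) (use c coeff_monic_polys(2)[OF p] in simp)
    show "m \<le> degree (p + r)"
      by (rule le_degree) (use c coeff_monic_polys(1)[OF p] in simp)
  qed
  then show ?thesis using c[of m] coeff_monic_polys(1)[OF p] by (simp add: monic_polys_def)
qed

lemma coeff_sum_monom: "poly.coeff (\<Sum>l<k. Polynomial.monom (c l) l) i = (if i < k then c i else 0)"
  by (simp add: coeff_sum)

lemma div_mod_monic:
  assumes h: "h \<in> monic_polys k" and r: "\<And>l. k \<le> l \<Longrightarrow> poly.coeff r l = 0"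
  shows "(h * q + r) div h = q" "(h * q + r) mod h = r"
proof -
  have h0: "h \<noteq> 0" "degree h = k" using h by (auto simp: monic_polys_def)
  have "r = 0 \<or> degree r < degree h"
  proof (rule ccontr)
    assume "\<not> (r = 0 \<or> degree r < degree h)"
    then show False using r[of "degree r"] h0 by auto
  qed
  then have "r div h = 0" "r mod h = r" by (auto simp: div_poly_less mod_poly_less)
  then show "(h * q + r) div h = q" "(h * q + r) mod h = r"
    using h0 by (simp_all add: poly_div_add_left poly_mod_add_left)
qed

text \<open>Division by a monic polynomial is unique and continuous for every pair
  \<open>(f, h)\<close>, whether or not \<open>h\<close> divides anything, so the coordinates are
  defined on the whole product.\<close>

lemma homeomorphic_maps_divide_out:
  assumes \<sigma>: "\<sigma> \<subseteq> {..<n}" and k: "\<And>j. j \<in> \<sigma> \<Longrightarrow> k \<le> D j"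
  shows "homeomorphic_maps (prod_topology (tuple_space n D) (monic_poly_space k))
     (prod_topology (tuple_space (Suc n) (quotient_degrees n \<sigma> k D)) (complex_power (\<sigma> \<times> {..<k})))
     (divide_out n \<sigma> k) (multiply_back n \<sigma> k)"
proof -
  let ?D = "quotient_degrees n \<sigma> k D"
  let ?W = "prod_topology (tuple_space n D) (monic_poly_space k)"
  let ?Y = "prod_topology (tuple_space (Suc n) ?D) (complex_power (\<sigma> \<times> {..<k}))"
  have Dn: "?D n = k" by (simp add: quotient_degrees_def)
  have D\<sigma>: "?D j = D j - k" if "j \<in> \<sigma>" for j using that \<sigma> by (auto simp: quotient_degrees_def)
  have D': "?D j = D j" if "j \<notin> \<sigma>" "j < n" for j using that by (auto simp: quotient_degrees_def)
  have f: "continuous_map ?W (monic_poly_space (D j)) (\<lambda>w. fst w j)" if "j < n" for j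
    by (rule continuous_map_fst_comp[OF continuous_map_tuple_component[OF that]])
  have h: "continuous_map ?W (monic_poly_space k) snd" by (rule continuous_map_snd)
  have F: "continuous_map ?Y (monic_poly_space (?D j)) (\<lambda>w. fst w j)" if "j < Suc n" for j
    by (rule continuous_map_fst_comp[OF continuous_map_tuple_component[OF that]])
  have t: "continuous_map ?Y euclidean (\<lambda>w. snd w a)" if "a \<in> \<sigma> \<times> {..<k}" for a
    by (rule continuous_map_snd_comp[OF continuous_map_product_projection[OF that]])
  have 1: "continuous_map ?W (tuple_space (Suc n) ?D)
      (\<lambda>w. \<lambda>j\<in>{..<Suc n}. if j = n then snd w else if j \<in> \<sigma> then fst w j div snd w else fst w j)"
  proof (rule continuous_map_into_tuple_space)
    fix j assume "j < Suc n"
    then consider "j = n" | "j \<in> \<sigma>" "j < n" | "j \<notin> \<sigma>" "j < n" using \<sigma> by force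
    then show "continuous_map ?W (monic_poly_space (?D j)) (\<lambda>w. if j = n then snd w else if j \<in> \<sigma> then fst w j div snd w else fst w j)"
    proof cases
      case 1
      then show ?thesis using h Dn by simp
    next
      case 2
      then show ?thesis using continuous_map_monic_div[OF f h k] D\<sigma> by simp
    next
      case 3
      then show ?thesis using f D' by simp
    qed
  qed
  have 2: "continuous_map ?W (complex_power (\<sigma> \<times> {..<k}))
      (\<lambda>w. restrict (\<lambda>(j, l). poly.coeff (fst w j mod snd w) l) (\<sigma> \<times> {..<k}))"
    unfolding continuous_map_componentwise
  proof (intro conjI ballI)
    fix a assume a: "a \<in> \<sigma> \<times> {..<k}"
    then obtain j l where jl: "a = (j, l)" "j \<in> \<sigma>" by auto
    then have "j < n" using \<sigma> by auto
    then show "continuous_map ?W euclidean (\<lambda>w. restrict (\<lambda>(j, l). poly.coeff (fst w j mod snd w) l) (\<sigma> \<times> {..<k}) a)"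
      using coeffs_continuous_mod[OF f h k[OF jl(2)]] a jl by (simp add: coeffs_continuous_def)
  qed auto
  have 3: "continuous_map ?Y (tuple_space n D)
      (\<lambda>w. \<lambda>j\<in>{..<n}. if j \<in> \<sigma> then fst w n * fst w j + (\<Sum>l<k. Polynomial.monom (snd w (j, l)) l) else fst w j)"
  proof (rule continuous_map_into_tuple_space)
    fix j assume j: "j < n"
    show "continuous_map ?Y (monic_poly_space (D j))
      (\<lambda>w. if j \<in> \<sigma> then fst w n * fst w j + (\<Sum>l<k. Polynomial.monom (snd w (j, l)) l) else fst w j)"
    proof (cases "j \<in> \<sigma>")
      case True
      have "continuous_map ?Y (monic_poly_space (?D n + ?D j)) (\<lambda>w. fst w n * fst w j)"
        using j by (intro continuous_map_monic_mult F) auto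
      moreover have "?D n + ?D j = D j" using Dn D\<sigma>[OF True] k[OF True] by simp
      ultimately have m: "continuous_map ?Y (monic_poly_space (D j)) (\<lambda>w. fst w n * fst w j)" by simp
      have "continuous_map ?Y (monic_poly_space (D j)) (\<lambda>w. fst w n * fst w j + (\<Sum>l<k. Polynomial.monom (snd w (j, l)) l))"
        unfolding continuous_map_into_monic_poly_space
      proof (intro conjI ballI)
        fix w assume "w \<in> topspace ?Y"
        then have "fst w n * fst w j \<in> monic_polys (D j)" using m unfolding continuous_map_into_monic_poly_space by blast
        then show "fst w n * fst w j + (\<Sum>l<k. Polynomial.monom (snd w (j, l)) l) \<in> monic_polys (D j)"
          by (rule monic_polys_add_low) (use k[OF True] in \<open>simp add: coeff_sum_monom\<close>)
      next
        show "coeffs_continuous ?Y (\<lambda>w. fst w n * fst w j + (\<Sum>l<k. Polynomial.monom (snd w (j, l)) l))"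
          using m True unfolding continuous_map_into_monic_poly_space
          by (intro coeffs_continuous_add coeffs_continuous_sum coeffs_continuous_monom t) auto
      qed
      then show ?thesis using True j by simp
    next
      case False
      then show ?thesis using F[of j] D'[OF False j] j by simp
    qed
  qed
  show ?thesis
    unfolding homeomorphic_maps_def
  proof (intro conjI ballI)
    show "continuous_map ?W ?Y (divide_out n \<sigma> k)"
      unfolding divide_out_def case_prod_unfold using 1 2[unfolded case_prod_unfold] by (intro continuous_map_pairedI)
    show "continuous_map ?Y ?W (multiply_back n \<sigma> k)"
      unfolding multiply_back_def case_prod_unfold using 3 F[of n] Dn by (intro continuous_map_pairedI) auto
  next
    fix w assume w: "w \<in> topspace ?W"
    obtain f h where w': "w = (f, h)" by fastforce
    have fm: "f j \<in> monic_polys (D j)" if "j < n" for j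
      using w that tuple_monic[of f D n j] by (simp add: w')
    have fe: "f \<in> extensional {..<n}" using w by (simp add: w' PiE_def)
    have hm: "h \<in> monic_polys k" using w by (simp add: w' topspace_monic_poly_space)
    have "h * (f j div h) + (\<Sum>l<k. Polynomial.monom (restrict (\<lambda>(j, l). poly.coeff (f j mod h) l) (\<sigma> \<times> {..<k}) (j, l)) l) = f j"
      if j: "j \<in> \<sigma>" for j
    proof -
      have jn: "j < n" using j \<sigma> by auto
      have "(\<Sum>l<k. Polynomial.monom (restrict (\<lambda>(j, l). poly.coeff (f j mod h) l) (\<sigma> \<times> {..<k}) (j, l)) l)
          = (\<Sum>l<k. Polynomial.monom (poly.coeff (f j mod h) l) l)"
        using j by (intro sum.cong) auto
      also have "\<dots> = f j mod h"
        by (rule poly_eqI) (use monic_div(3)[OF fm[OF jn] hm k[OF j]] coeff_sum_monom in metis)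
      finally show ?thesis by (simp add: mult.commute)
    qed
    then show "multiply_back n \<sigma> k (divide_out n \<sigma> k w) = w"
      using fe \<sigma> by (auto simp: w' multiply_back_def divide_out_def fun_eq_iff extensional_def)
  next
    fix w assume w: "w \<in> topspace ?Y"
    obtain F t where w': "w = (F, t)" by fastforce
    have Fe: "F \<in> extensional {..<Suc n}" and te: "t \<in> extensional (\<sigma> \<times> {..<k})"
      using w by (auto simp: w' PiE_def)
    have Fn: "F n \<in> monic_polys k" using w tuple_monic[of F ?D "Suc n" n] Dn by (simp add: w')
    let ?r = "\<lambda>j. \<Sum>l<k. Polynomial.monom (t (j, l)) l"
    have dm: "(F n * F j + ?r j) div F n = F j" "?r j mod F n = ?r j" for j
      using div_mod_monic[OF Fn, of "?r j" "F j"] by (simp_all add: coeff_sum_monom)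
    show "divide_out n \<sigma> k (multiply_back n \<sigma> k w) = w"
    proof -
      have "(\<lambda>j\<in>{..<Suc n}. if j = n then F n else if j \<in> \<sigma> then (\<lambda>j\<in>{..<n}. if j \<in> \<sigma> then F n * F j + ?r j else F j) j div F n
          else (\<lambda>j\<in>{..<n}. if j \<in> \<sigma> then F n * F j + ?r j else F j) j) = F"
      proof
        fix j
        show "(\<lambda>j\<in>{..<Suc n}. if j = n then F n else if j \<in> \<sigma> then (\<lambda>j\<in>{..<n}. if j \<in> \<sigma> then F n * F j + ?r j else F j) j div F n
          else (\<lambda>j\<in>{..<n}. if j \<in> \<sigma> then F n * F j + ?r j else F j) j) j = F j"
          using Fe \<sigma> by (cases "j < n") (auto simp: dm extensional_def less_Suc_eq)
      qed
      moreover have "restrict (\<lambda>(j, l). poly.coeff ((\<lambda>j\<in>{..<n}. if j \<in> \<sigma> then F n * F j + ?r j else F j) j mod F n) l) (\<sigma> \<times> {..<k}) = t"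
      proof
        fix a
        show "restrict (\<lambda>(j, l). poly.coeff ((\<lambda>j\<in>{..<n}. if j \<in> \<sigma> then F n * F j + ?r j else F j) j mod F n) l) (\<sigma> \<times> {..<k}) a = t a"
          using te \<sigma> by (cases a; cases "a \<in> \<sigma> \<times> {..<k}") (auto simp: dm coeff_sum_monom extensional_def)
      qed
      ultimately show ?thesis by (simp add: w' divide_out_def multiply_back_def)
    qed
  qed
qed

text \<open>Adjoining the common divisor as a new variable raises the degree by \<open>2 k\<close>.
  In the coordinates of \<open>divide_out\<close> the resulting set is \<open>T'\<close> at
  remainder zero, and splitting off the \<open>k * card \<sigma>\<close> complex remainder
  coordinates lowers the degree by \<open>2 k * card \<sigma>\<close>. The net shift is the real
  codimension \<open>2 k (card \<sigma> - 1)\<close>.\<close>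

lemma null_along_common_factor:
  assumes \<sigma>: "\<sigma> \<subseteq> {..<n}" "\<sigma> \<noteq> {}" and k: "\<And>j. j \<in> \<sigma> \<Longrightarrow> k \<le> D j"
    and N: "openin (tuple_space n D) N" and T: "closedin (subtopology (tuple_space n D) N) T"
    and no: "\<And>f. f \<in> T \<Longrightarrow> \<not> common_factor \<sigma> (Suc k) f"
    and cf: "\<And>f. f \<in> T \<Longrightarrow> common_factor \<sigma> k f"
    and N': "openin (tuple_space (Suc n) (quotient_degrees n \<sigma> k D)) N'"
    and T': "closedin (subtopology (tuple_space (Suc n) (quotient_degrees n \<sigma> k D)) N') T'"
    and TT: "T' = {F \<in> topspace (tuple_space (Suc n) (quotient_degrees n \<sigma> k D)). merge_factor n \<sigma> F \<in> T}"
  shows "null_along q (subtopology (tuple_space n D) N) T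
    \<longleftrightarrow> null_along (q + 2 * int k - 2 * int (card \<sigma> * k)) (subtopology (tuple_space (Suc n) (quotient_degrees n \<sigma> k D)) N') T'"
proof -
  let ?D = "quotient_degrees n \<sigma> k D"
  let ?X = "subtopology (tuple_space n D) N"
  let ?W = "prod_topology (tuple_space n D) (monic_poly_space k)"
  let ?A = "\<sigma> \<times> {..<k}"
  let ?Y = "prod_topology (tuple_space (Suc n) ?D) (complex_power ?A)"
  let ?z = "\<lambda>a\<in>?A. 0 :: complex"
  let ?\<Psi> = "divide_out n \<sigma> k" and ?\<Phi> = "multiply_back n \<sigma> k"
  let ?E = "{w \<in> T \<times> monic_polys k. \<forall>j\<in>\<sigma>. snd w dvd fst w j}"
  let ?N1 = "N \<times> topspace (monic_poly_space k)"
  have hm: "homeomorphic_maps ?W ?Y ?\<Psi> ?\<Phi>" by (rule homeomorphic_maps_divide_out[OF \<sigma>(1) k])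
  have TN: "T \<subseteq> N" "T \<subseteq> topspace (tuple_space n D)"
    using closedin_subset[OF T] by auto
  have NX: "N \<subseteq> topspace (tuple_space n D)" using N by (rule openin_subset)
  have met: "metrizable_space ?X"
    by (intro metrizable_space_subtopology) (auto simp: metrizable_space_product_topology metrizable_monic_poly_space intro: countable_finite)
  have comp: "continuous_map ?X (monic_poly_space (D j)) (\<lambda>f. f j)" if "j \<in> \<sigma>" for j
    using that \<sigma>(1) by (intro continuous_map_from_subtopology continuous_map_tuple_component) auto
  have prodX: "prod_topology ?X (monic_poly_space k) = subtopology ?W ?N1"
    by (rule prod_topology_subtopology(1))
  have E: "closedin (subtopology ?W ?N1) ?E"
  proof -
    let ?V = "prod_topology ?X (monic_poly_space k)"
    have "closedin ?V ((T \<times> topspace (monic_poly_space k)) \<inter> {w \<in> topspace ?V. \<forall>j\<in>\<sigma>. snd w dvd fst w j})"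
      using T by (intro closedin_Int closedin_common_divisors[where D = D] comp \<sigma>(2)) (simp_all add: closedin_prod_Times_iff)
    moreover have "(T \<times> topspace (monic_poly_space k)) \<inter> {w \<in> topspace ?V. \<forall>j\<in>\<sigma>. snd w dvd fst w j} = ?E"
      using closedin_subset[OF T] by (auto simp: topspace_monic_poly_space)
    ultimately show ?thesis unfolding prodX by simp
  qed
  have N1: "openin ?W ?N1" using N by (simp add: openin_prod_Times_iff)
  have N1W: "?N1 \<subseteq> topspace ?W" using N1 by (rule openin_subset)
  have EN1: "?E \<subseteq> ?N1" using TN by (auto simp: topspace_monic_poly_space)
  have h: "homeomorphic_map ?W ?Y ?\<Psi>" using hm homeomorphic_map_maps by blast
  have hY: "?\<Psi> ` topspace ?W = topspace ?Y" using h by (rule homeomorphic_imp_surjective_map)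
  have h1: "homeomorphic_map (subtopology ?W ?N1) (subtopology ?Y (?\<Psi> ` ?N1)) ?\<Psi>"
  proof (rule homeomorphic_map_subtopologies[OF h])
    have "?\<Psi> ` ?N1 \<subseteq> topspace ?Y" using hY N1W by blast
    then have 1: "topspace ?Y \<inter> ?\<Psi> ` ?N1 = ?\<Psi> ` ?N1" by (rule Int_absorb1)
    have 2: "topspace ?W \<inter> ?N1 = ?N1" using N1W by (rule Int_absorb1)
    show "?\<Psi> ` (topspace ?W \<inter> ?N1) = topspace ?Y \<inter> ?\<Psi> ` ?N1" unfolding 1 2 ..
  qed
  have mult_z: "?\<Phi> (F, ?z) = (merge_factor n \<sigma> F, F n)" for F
  proof -
    have "(\<Sum>l<k. Polynomial.monom (?z (j, l)) l) = 0" if "j \<in> \<sigma>" for j using that by simp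
    then show ?thesis unfolding multiply_back_def merge_factor_def by (auto simp: fun_eq_iff)
  qed
  have im: "?\<Psi> ` ?E = T' \<times> {?z}"
  proof (intro equalityI subsetI)
    fix y assume "y \<in> ?\<Psi> ` ?E"
    then obtain f h where fh: "f \<in> T" "h \<in> monic_polys k" "\<forall>j\<in>\<sigma>. h dvd f j" "y = ?\<Psi> (f, h)" by auto
    have fW: "(f, h) \<in> topspace ?W" using fh TN by (auto simp: topspace_monic_poly_space)
    obtain F t where y: "y = (F, t)" by fastforce
    have yY: "(F, t) \<in> topspace ?Y" using hY fW fh(4) y by auto
    have t: "t = ?z"
      using fh(3,4) y by (auto simp: divide_out_def fun_eq_iff mod_eq_0_iff_dvd)
    have "?\<Phi> (F, t) = (f, h)" using hm fW fh(4) y by (auto simp: homeomorphic_maps_def)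
    then have "merge_factor n \<sigma> F = f"
      unfolding t mult_z by simp
    then have "F \<in> T'" unfolding TT using yY fh(1) by simp
    then show "y \<in> T' \<times> {?z}" using y t by simp
  next
    fix y assume "y \<in> T' \<times> {?z}"
    then obtain F where y: "y = (F, ?z)" and F: "F \<in> topspace (tuple_space (Suc n) ?D)" "merge_factor n \<sigma> F \<in> T"
      unfolding TT by auto
    have yY: "y \<in> topspace ?Y" using F(1) y by simp
    have e1: "?\<Phi> y = (merge_factor n \<sigma> F, F n)"
      unfolding y by (rule mult_z)
    have e2: "?\<Psi> (?\<Phi> y) = y" using hm yY unfolding homeomorphic_maps_def by blast
    have e3: "(merge_factor n \<sigma> F, F n) \<in> ?E"
    proof -
      have "F n \<in> monic_polys k" using tuple_monic[OF F(1), of n] by (simp add: quotient_degrees_def)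
      then show ?thesis using F(2) \<sigma>(1) by (auto simp: merge_factor_def)
    qed
    have "y = ?\<Psi> (merge_factor n \<sigma> F, F n)" using e2 unfolding e1 by (rule sym)
    then show "y \<in> ?\<Psi> ` ?E" using e3 by (rule image_eqI)
  qed
  have "null_along q ?X T \<longleftrightarrow> null_along (q + 2 * int k) (prod_topology ?X (monic_poly_space k)) ?E"
    using null_along_common_divisors[OF met T \<sigma>(2), of D "\<lambda>f. f" k q] comp no cf by simp
  also have "\<dots> \<longleftrightarrow> null_along (q + 2 * int k) (subtopology ?Y (?\<Psi> ` ?N1)) (T' \<times> {?z})"
    unfolding prodX im[symmetric]
    by (rule null_along_homeomorphic[OF h1]) (use E closedin_subset in blast)
  \<comment> \<open>The image of \<open>?N1\<close> is in general not a product, whereas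
    desuspension needs one. Both sets are open neighbourhoods in which
    \<open>T' \<times> {?z}\<close> is closed.\<close>
  also have "\<dots> \<longleftrightarrow> null_along (q + 2 * int k) (subtopology ?Y (N' \<times> topspace (complex_power ?A))) (T' \<times> {?z})"
  proof (rule null_along_open_independent)
    show "openin ?Y (?\<Psi> ` ?N1)" using homeomorphic_map_openness[OF h N1W] N1 by simp
    show "openin ?Y (N' \<times> topspace (complex_power ?A))"
      unfolding openin_prod_Times_iff using N' by (intro disjI2 conjI openin_topspace)
    have "T' \<subseteq> N'" using closedin_subset[OF T'] by auto
    moreover have "?z \<in> topspace (complex_power ?A)" by (rule subsetD[OF closedin_subset[OF closedin_complex_power_point]]) simp
    ultimately have "T' \<times> {?z} \<subseteq> N' \<times> topspace (complex_power ?A)" by blast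
    moreover have "T' \<times> {?z} \<subseteq> ?\<Psi> ` ?N1" unfolding im[symmetric] using EN1 by (rule image_mono)
    ultimately show "T' \<times> {?z} \<subseteq> ?\<Psi> ` ?N1 \<inter> (N' \<times> topspace (complex_power ?A))" by blast
    show "closedin (subtopology ?Y (?\<Psi> ` ?N1)) (T' \<times> {?z})"
      unfolding im[symmetric] using homeomorphic_map_closedness[OF h1] E closedin_subset by blast
    show "closedin (subtopology ?Y (N' \<times> topspace (complex_power ?A))) (T' \<times> {?z})"
      unfolding prod_topology_subtopology(1)[symmetric] closedin_prod_Times_iff
      by (intro disjI2 conjI T' closedin_complex_power_point)
  qed
  also have "\<dots> \<longleftrightarrow> null_along (q + 2 * int k - 2 * int (card \<sigma> * k)) (subtopology (tuple_space (Suc n) ?D) N') T'"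
  proof -
    have "finite ?A" using \<sigma>(1) finite_subset by auto
    from null_along_times_complex_power[OF this T', of "q + 2 * int k - 2 * int (card \<sigma> * k)"]
    show ?thesis unfolding prod_topology_subtopology(1) by (simp add: card_cartesian_product)
  qed
  finally show ?thesis .
qed

section \<open>Splitting off a root\<close>

definition coprime_on :: "nat set set \<Rightarrow> (nat \<Rightarrow> complex poly) set" where
  "coprime_on J = {f. \<forall>\<sigma>\<in>J. \<not> (\<exists>z. \<forall>j\<in>\<sigma>. poly (f j) z = 0)}"

abbreviation coprime_space :: "nat \<Rightarrow> nat set set \<Rightarrow> (nat \<Rightarrow> nat) \<Rightarrow> (nat \<Rightarrow> complex poly) topology" where
  "coprime_space n J D \<equiv> subtopology (tuple_space n D) (coprime_on J)"

text \<open>A factorization rather than a condition on the set of roots, since the root on the right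
  has to be simple. Both inequalities are strict to make the condition open.\<close>

definition single_right :: "real \<Rightarrow> complex poly \<Rightarrow> bool" where
  "single_right a p \<longleftrightarrow> (\<exists>w g. a < Re w \<and> p = [:- w, 1:] * g \<and> (\<forall>z. poly g z = 0 \<longrightarrow> Re z < a))"

definition split_at :: "real \<Rightarrow> nat \<Rightarrow> nat \<Rightarrow> (nat \<Rightarrow> complex poly) \<Rightarrow> bool" where
  "split_at a n i f \<longleftrightarrow> single_right a (f i) \<and> (\<forall>j<n. j \<noteq> i \<longrightarrow> (\<forall>z. poly (f j) z = 0 \<longrightarrow> Re z < a))"

lemma openin_coprime_on:
  assumes "J \<subseteq> Pow {..<n}"
  shows "openin (tuple_space n D) (topspace (tuple_space n D) \<inter> coprime_on J)"
proof (cases "{} \<in> J")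
  case True
  then have "coprime_on J = {}" by (auto simp: coprime_on_def)
  then show ?thesis by (simp only: Int_empty_right openin_empty)
next
  case False
  let ?C = "\<Union>\<sigma>\<in>J. {f \<in> topspace (tuple_space n D). common_factor \<sigma> 1 f}"
  have "finite J" using assms by (rule finite_subset) simp
  then have "closedin (tuple_space n D) ?C"
    by (intro closedin_Union finite_imageI) (use assms False closedin_common_factor in blast)+
  then have "openin (tuple_space n D) (topspace (tuple_space n D) - ?C)"
    by (rule openin_diff[OF openin_topspace])
  moreover have "topspace (tuple_space n D) - ?C
      = topspace (tuple_space n D) \<inter> coprime_on J"
    unfolding coprime_on_def common_factor_1 by blast
  ultimately show ?thesis by (simp only:)
qed

lemma open_Re_halfplanes: "open {x. Re x < a}" "open {x. a < Re x}"
  by (intro open_Collect_less continuous_intros)+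

text \<open>On ordered roots the condition becomes a union of open boxes, one for each position of
  the root on the right; openness is read off from this.\<close>

lemma single_right_root_poly:
  "single_right a (root_poly m z) \<longleftrightarrow> (\<exists>l<m. a < Re (z l) \<and> (\<forall>l'<m. l' \<noteq> l \<longrightarrow> Re (z l') < a))"
proof
  assume "single_right a (root_poly m z)"
  then obtain w g where w: "a < Re w" "root_poly m z = [:- w, 1:] * g" "\<And>x. poly g x = 0 \<Longrightarrow> Re x < a"
    by (auto simp: single_right_def)
  have g0: "g \<noteq> 0" using w(2) monic_polys_nonzero[OF root_poly_monic[of m z]] by auto
  have "image_mset z (mset_set {..<m}) = proots ([:- w, 1:] * g)" using w(2) proots_root_poly by metis
  also have "\<dots> = add_mset w (proots g)" using g0 by (subst proots_mult) auto
  finally have im: "image_mset z (mset_set {..<m}) = add_mset w (proots g)" .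
  then have "w \<in># image_mset z (mset_set {..<m})" by simp
  then obtain l where l: "l < m" "w = z l" by auto
  have "mset_set {..<m} = add_mset l (mset_set ({..<m} - {l}))"
    using l(1) by (metis finite_lessThan lessThan_iff mset_set.remove)
  then have "image_mset z (mset_set ({..<m} - {l})) = proots g" using im l(2) by simp
  moreover have "z l' \<in># image_mset z (mset_set ({..<m} - {l}))" if "l' < m" "l' \<noteq> l" for l'
    using that by simp
  ultimately have "poly g (z l') = 0" if "l' < m" "l' \<noteq> l" for l' using that g0 by auto
  then show "\<exists>l<m. a < Re (z l) \<and> (\<forall>l'<m. l' \<noteq> l \<longrightarrow> Re (z l') < a)" using l w by blast
next
  assume "\<exists>l<m. a < Re (z l) \<and> (\<forall>l'<m. l' \<noteq> l \<longrightarrow> Re (z l') < a)"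
  then obtain l where l: "l < m" "a < Re (z l)" "\<And>l'. l' < m \<Longrightarrow> l' \<noteq> l \<Longrightarrow> Re (z l') < a" by blast
  have "root_poly m z = [:- z l, 1:] * (\<Prod>l'\<in>{..<m} - {l}. [:- z l', 1:])"
    unfolding root_poly_def using l(1) by (intro prod.remove) auto
  moreover have "Re x < a" if "poly (\<Prod>l'\<in>{..<m} - {l}. [:- z l', 1:]) x = 0" for x
    using that l(3) by (auto simp: poly_prod)
  ultimately show "single_right a (root_poly m z)" unfolding single_right_def using l(2) by blast
qed

lemma openin_single_right: "openin (monic_poly_space m) {p \<in> monic_polys m. single_right a p}" (is "openin _ ?U")
proof (rule openin_monic_poly_space_if_roots)
  let ?B = "\<lambda>l l'. if l' = l then {x. a < Re x} else {x. Re x < a}"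
  have "openin (complex_power {..<m}) (PiE {..<m} (?B l))" for l
    by (simp add: openin_PiE open_Re_halfplanes)
  then have "openin (complex_power {..<m}) (\<Union>l<m. PiE {..<m} (?B l))" by blast
  moreover have "(\<Union>l<m. PiE {..<m} (?B l)) = {z \<in> extensional {..<m}. root_poly m z \<in> ?U}"
  proof (rule Set.set_eqI)
    fix z
    have "z \<in> PiE {..<m} (?B l) \<longleftrightarrow> z \<in> extensional {..<m} \<and> a < Re (z l) \<and> (\<forall>l'<m. l' \<noteq> l \<longrightarrow> Re (z l') < a)" if "l < m" for l
      using that by (auto simp: PiE_iff)
    then have "z \<in> (\<Union>l<m. PiE {..<m} (?B l)) \<longleftrightarrow> z \<in> extensional {..<m} \<and> single_right a (root_poly m z)"
      unfolding single_right_root_poly by blast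
    then show "z \<in> (\<Union>l<m. PiE {..<m} (?B l)) \<longleftrightarrow> z \<in> {z \<in> extensional {..<m}. root_poly m z \<in> ?U}"
      by (simp add: root_poly_monic)
  qed
  ultimately show "openin (complex_power {..<m}) {z \<in> extensional {..<m}. root_poly m z \<in> ?U}" by (simp only:)
qed blast

lemma openin_split_at:
  assumes "i < n"
  shows "openin (tuple_space n D) {f \<in> topspace (tuple_space n D). split_at a n i f}"
proof -
  let ?B = "\<lambda>j. if j = i then {p \<in> monic_polys (D j). single_right a p} else monic_with_roots (D j) {x. Re x < a}"
  have "openin (tuple_space n D) (PiE {..<n} ?B)"
  proof (subst openin_PiE_gen, intro disjI2 conjI ballI)
    fix j
    show "openin (monic_poly_space (D j)) (?B j)"
      by (simp add: openin_single_right openin_monic_with_roots open_Re_halfplanes)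
  qed auto
  moreover have "PiE {..<n} ?B = {f \<in> topspace (tuple_space n D). split_at a n i f}"
  proof (rule Set.set_eqI)
    fix f
    show "f \<in> PiE {..<n} ?B \<longleftrightarrow> f \<in> {f \<in> topspace (tuple_space n D). split_at a n i f}"
      using assms by (auto simp: PiE_iff split_at_def monic_with_roots_def topspace_monic_poly_space split: if_splits)
  qed
  ultimately show ?thesis by (simp only:)
qed

section \<open>Moving the roots of tuples\<close>

lemma move_roots_monic: "p \<in> monic_polys m \<Longrightarrow> move_roots \<theta> p \<in> monic_polys m"
  using monic_polys_prod_linear[of "image_mset \<theta> (proots p)"]
  by (auto simp: move_roots_def image_mset.compositionality o_def size_proots_complex monic_polys_def)

lemma poly_move_roots: "p \<noteq> 0 \<Longrightarrow> poly (move_roots \<theta> p) w = 0 \<longleftrightarrow> (\<exists>z. poly p z = 0 \<and> w = \<theta> z)"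
  by (auto simp: move_roots_def poly_prod_mset prod_mset_zero_iff image_mset.compositionality)

lemma move_roots_id: "p \<in> monic_polys m \<Longrightarrow> move_roots (\<lambda>z. z) p = p"
  by (simp add: move_roots_def monic_prod_proots)

lemma move_roots_cong: "p \<noteq> 0 \<Longrightarrow> (\<And>z. poly p z = 0 \<Longrightarrow> \<theta> z = \<kappa> z) \<Longrightarrow> move_roots \<theta> p = move_roots \<kappa> p"
  unfolding move_roots_def by (intro arg_cong[of _ _ prod_mset] image_mset_cong) simp

lemma proots_move_roots: "proots (move_roots \<theta> p) = image_mset \<theta> (proots p)"
  using proots_prod_linear[of "image_mset \<theta> (proots p)"] by (simp add: move_roots_def image_mset.compositionality o_def)

lemma move_roots_move_roots: "move_roots \<theta> (move_roots \<kappa> p) = move_roots (\<lambda>z. \<theta> (\<kappa> z)) p"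
  by (simp only: move_roots_def[of \<theta>] proots_move_roots) (simp add: move_roots_def image_mset.compositionality o_def)

lemma move_roots_mult: "p \<noteq> 0 \<Longrightarrow> q \<noteq> 0 \<Longrightarrow> move_roots \<theta> (p * q) = move_roots \<theta> p * move_roots \<theta> q"
  by (simp add: move_roots_def proots_mult)

lemma move_roots_linear: "move_roots \<theta> [:- w, 1:] = [:- \<theta> w, 1:]"
  by (simp add: move_roots_def)

lemma continuous_map_move_roots_along:
  assumes \<Omega>: "open \<Omega>"
    and \<theta>: "continuous_map (prod_topology T (top_of_set \<Omega>)) euclidean (\<lambda>(t, x). \<theta> t x)"
    and F: "continuous_map Z (monic_poly_space m) F" "\<And>x z. x \<in> topspace Z \<Longrightarrow> poly (F x) z = 0 \<Longrightarrow> z \<in> \<Omega>"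
    and t: "continuous_map Z T t"
  shows "continuous_map Z (monic_poly_space m) (\<lambda>x. move_roots (\<theta> (t x)) (F x))"
proof -
  have "continuous_map Z (subtopology (monic_poly_space m) (monic_with_roots m \<Omega>)) F"
    using F unfolding continuous_map_in_subtopology by (auto simp: monic_with_roots_def continuous_map_into_monic_poly_space)
  from continuous_map_compose[OF continuous_map_pairedI[OF t this] continuous_map_move_roots[OF \<Omega> \<theta>]]
  show ?thesis by (simp add: o_def)
qed


text \<open>Injectivity traces a common root of the moved polynomials back to a single point. The
  tuple \<open>g\<close> is prescribed only at indices that occur in members of \<open>J\<close>, so
  that an unconstrained component may be deformed in another way.\<close>

lemma coprime_on_move_roots:
  assumes f: "\<And>j. j < n \<Longrightarrow> f j \<noteq> 0" and J: "J \<subseteq> Pow {..<n}" and co: "f \<in> coprime_on J"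
    and \<theta>: "inj_on \<theta> \<Omega>" and \<Omega>: "\<And>j z. j < n \<Longrightarrow> poly (f j) z = 0 \<Longrightarrow> z \<in> \<Omega>"
    and g: "\<And>\<tau> j. \<tau> \<in> J \<Longrightarrow> j \<in> \<tau> \<Longrightarrow> g j = move_roots \<theta> (f j)"
  shows "g \<in> coprime_on J"
  unfolding coprime_on_def
proof (intro CollectI ballI notI)
  fix \<tau> assume \<tau>: "\<tau> \<in> J" and "\<exists>w. \<forall>j\<in>\<tau>. poly (g j) w = 0"
  then obtain w where w: "\<And>j. j \<in> \<tau> \<Longrightarrow> poly (g j) w = 0" by blast
  have *: "\<exists>z\<in>\<Omega>. poly (f j) z = 0 \<and> w = \<theta> z" if "j \<in> \<tau>" for j
  proof -
    have "j < n" using J \<tau> that by blast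
    then show ?thesis using w[OF that] g[OF \<tau> that] poly_move_roots[OF f] \<Omega> by auto
  qed
  show False
  proof (cases "\<tau> = {}")
    case True
    then show False using co \<tau> by (auto simp: coprime_on_def)
  next
    case False
    then obtain j z where z: "j \<in> \<tau>" "z \<in> \<Omega>" "w = \<theta> z" using * by blast
    have "poly (f j') z = 0" if "j' \<in> \<tau>" for j'
      using *[OF that] z(2,3) inj_onD[OF \<theta>] by metis
    then show False using co \<tau> unfolding coprime_on_def by blast
  qed
qed

text \<open>
  An isotopy of embeddings of the plane from the identity (at \<open>s = 1\<close>) to an embedding into the half
  plane \<open>Re z < a\<close> (at \<open>s = 0\<close>), which preserves that half plane at all times.
\<close>

definition squeeze :: "real \<Rightarrow> real \<Rightarrow> complex \<Rightarrow> complex" where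
  "squeeze a s z = Complex (s * Re z + (1 - s) * (a - exp (- Re z))) (Im z)"

text \<open>The imaginary part is kept, and the new real part is a convex combination of two
  strictly increasing functions of \<open>Re z\<close>.\<close>

lemma inj_squeeze:
  assumes "0 \<le> s" "s \<le> 1"
  shows "inj (squeeze a s)"
proof (rule injI)
  fix z w assume "squeeze a s z = squeeze a s w"
  then have eq: "s * Re z + (1 - s) * (a - exp (- Re z)) = s * Re w + (1 - s) * (a - exp (- Re w))"
    and im: "Im z = Im w" by (auto simp: squeeze_def)
  have mono: "s * x + (1 - s) * (a - exp (- x)) < s * y + (1 - s) * (a - exp (- y))" if "x < y" for x y
  proof (cases "s = 1")
    case False
    have "s * x \<le> s * y" using that assms by (intro mult_left_mono) auto
    moreover have "(1 - s) * (a - exp (- x)) < (1 - s) * (a - exp (- y))"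
      using that assms False by (intro mult_strict_left_mono) auto
    ultimately show ?thesis by simp
  qed (use that in simp)
  have "Re z = Re w" using eq mono[of "Re z" "Re w"] mono[of "Re w" "Re z"] by (cases "Re z" "Re w" rule: linorder_cases) auto
  then show "z = w" using im by (simp add: complex_eq_iff)
qed

lemma squeeze_0: "Re (squeeze a 0 z) < a" by (simp add: squeeze_def)

lemma squeeze_1: "squeeze a 1 z = z" by (simp add: squeeze_def complex_eq_iff)

lemma convex_combination_less:
  fixes x y a s :: real
  assumes "x < a" "y < a" "0 \<le> s" "s \<le> 1"
  shows "s * x + (1 - s) * y < a"
  using convex_bound_lt[of x a y s "1 - s"] assms by simp

lemma squeeze_less: "Re z < a \<Longrightarrow> 0 \<le> s \<Longrightarrow> s \<le> 1 \<Longrightarrow> Re (squeeze a s z) < a"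
  unfolding squeeze_def complex.sel by (rule convex_combination_less) auto

lemma continuous_map_squeeze:
  "continuous_map (prod_topology (top_of_set {0..1}) (top_of_set UNIV)) euclidean (\<lambda>(s, z). squeeze a s z)"
proof -
  have "continuous_on ({0..1} \<times> UNIV) (\<lambda>(s, z). squeeze a s z)"
    unfolding squeeze_def case_prod_unfold by (intro continuous_intros)
  then show ?thesis by (simp only: prod_topology_subtopology_eu continuous_map_iff_continuous)
qed

section \<open>An unconstrained component\<close>

lemma monic_polysI: "poly.coeff p m = 1 \<Longrightarrow> (\<And>l. m < l \<Longrightarrow> poly.coeff p l = 0) \<Longrightarrow> p \<in> monic_polys m"
  unfolding monic_polys_def mem_Collect_eq
  by (metis coeff_0 degree_le le_antisym le_degree zero_neq_one)

lemma move_roots_const: "g \<in> monic_polys k \<Longrightarrow> move_roots (\<lambda>_. b) g = [:- b, 1:] ^ k"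
  by (simp add: move_roots_def size_proots_complex monic_polys_def)

lemma monic_polys_mult_linearD:
  assumes "[:- w, 1:] * g \<in> monic_polys m"
  shows "0 < m" "g \<in> monic_polys (m - 1)"
proof -
  have w: "[:- w, 1:] \<in> monic_polys 1" by (rule monic_polys_linear)
  obtain g' where g': "g' \<in> monic_polys (m - 1)" "[:- w, 1:] * g = [:- w, 1:] * g'" "1 \<le> m"
    using monic_dvd_factor[OF w assms dvd_triv_left] .
  moreover have "[:- w, 1:] \<noteq> 0" by simp
  ultimately show "0 < m" "g \<in> monic_polys (m - 1)" using mult_left_cancel by (auto simp del: mult_pCons_left)
qed

lemma single_right_move_roots:
  assumes "single_right a p" "p \<noteq> 0"
    and "\<And>z. Re z < a \<Longrightarrow> Re (\<theta> z) < b" "\<And>z. a < Re z \<Longrightarrow> b < Re (\<theta> z)"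
  shows "single_right b (move_roots \<theta> p)"
proof -
  obtain w g where w: "a < Re w" "p = [:- w, 1:] * g" "\<And>z. poly g z = 0 \<Longrightarrow> Re z < a"
    using assms(1) unfolding single_right_def by blast
  have g0: "g \<noteq> 0" using w(2) assms(2) by auto
  have "move_roots \<theta> p = [:- \<theta> w, 1:] * move_roots \<theta> g"
    unfolding w(2) by (subst move_roots_mult) (use g0 in \<open>simp_all add: move_roots_linear del: mult_pCons_left\<close>)
  moreover have "Re z < b" if "poly (move_roots \<theta> g) z = 0" for z
    using that w(3) assms(3) unfolding poly_move_roots[OF g0] by blast
  ultimately show ?thesis using assms(4)[OF w(1)] unfolding single_right_def by blast
qed

lemma single_right_roots: "single_right a p \<Longrightarrow> poly p z = 0 \<Longrightarrow> Re z \<noteq> a"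
  unfolding single_right_def by (auto simp del: mult_pCons_left simp: poly_mult)

text \<open>
  The quotient is the sign of \<open>Re z - a\<close>, written so as to be visibly continuous off the line
  \<open>Re z = a\<close>; on the line it has the junk value \<open>0\<close>.
\<close>

definition side :: "real \<Rightarrow> complex \<Rightarrow> complex" where
  "side a z = complex_of_real (a + (Re z - a) / \<bar>Re z - a\<bar>)"

text \<open>At \<open>s = 0\<close> everything left of the line collapses to \<open>a - 1\<close>
  and everything right of it to \<open>a + 1\<close>. This is far from injective and can only be
  applied to a component that occurs in no member of \<open>J\<close>.\<close>

definition gather :: "real \<Rightarrow> real \<Rightarrow> complex \<Rightarrow> complex" where
  "gather a s z = of_real s * z + of_real (1 - s) * side a z"

lemma Re_gather:
  assumes "0 \<le> s" "s \<le> 1"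
  shows "Re z < a \<Longrightarrow> Re (gather a s z) < a" "a < Re z \<Longrightarrow> a < Re (gather a s z)"
proof -
  show "Re (gather a s z) < a" if "Re z < a"
  proof -
    have "(Re z - a) / \<bar>Re z - a\<bar> = -1" using that by (simp add: abs_if field_simps)
    then have "Re (gather a s z) = s * Re z + (1 - s) * (a - 1)" by (simp add: gather_def side_def)
    also have "\<dots> < a" using assms that by (intro convex_combination_less) auto
    finally show ?thesis .
  qed
  show "a < Re (gather a s z)" if "a < Re z"
  proof -
    have "(Re z - a) / \<bar>Re z - a\<bar> = 1" using that by (simp add: abs_if field_simps)
    then have "Re (gather a s z) = s * Re z + (1 - s) * (a + 1)" by (simp add: gather_def side_def)
    then have "- Re (gather a s z) = s * (- Re z) + (1 - s) * (- (a + 1))" by (simp add: algebra_simps)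
    also have "\<dots> < - a" using assms that by (intro convex_combination_less) auto
    finally show ?thesis by simp
  qed
qed

lemma continuous_map_gather:
  "continuous_map (prod_topology (top_of_set {0..1}) (top_of_set {z. Re z \<noteq> a})) euclidean (\<lambda>(s, z). gather a s z)"
proof -
  have "continuous_on ({0..1} \<times> {z. Re z \<noteq> a}) (\<lambda>(s, z). gather a s z)"
    unfolding gather_def side_def case_prod_unfold by (intro continuous_intros) auto
  then show ?thesis by (simp only: prod_topology_subtopology_eu continuous_map_iff_continuous)
qed

lemma move_roots_gather_0:
  assumes "single_right a p" "p \<in> monic_polys m"
  shows "move_roots (gather a 0) p = [:- of_real (a + 1), 1:] * [:- of_real (a - 1), 1:] ^ (m - 1)"
proof -
  obtain w g where w: "a < Re w" "p = [:- w, 1:] * g" "\<And>z. poly g z = 0 \<Longrightarrow> Re z < a"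
    using assms(1) unfolding single_right_def by blast
  have g: "g \<in> monic_polys (m - 1)" using assms(2) unfolding w(2) by (rule monic_polys_mult_linearD)
  have g0: "g \<noteq> 0" by (rule monic_polys_nonzero[OF g])
  have l: "gather a 0 z = of_real (a - 1)" if "Re z < a" for z
    using that by (simp add: gather_def side_def abs_if field_simps)
  have r: "gather a 0 w = of_real (a + 1)"
    using w(1) by (simp add: gather_def side_def abs_if field_simps)
  have "move_roots (gather a 0) g = move_roots (\<lambda>_. of_real (a - 1)) g"
    using w(3) l g0 by (intro move_roots_cong) auto
  also have "\<dots> = [:- of_real (a - 1), 1:] ^ (m - 1)" by (rule move_roots_const[OF g])
  finally have e: "move_roots (gather a 0) g = [:- of_real (a - 1), 1:] ^ (m - 1)" .
  have "move_roots (gather a 0) p = move_roots (gather a 0) [:- w, 1:] * move_roots (gather a 0) g"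
    unfolding w(2) by (rule move_roots_mult) (use g0 in simp_all)
  then show ?thesis by (simp only: e move_roots_linear r)
qed

text \<open>The map \<open>r\<close> replaces component \<open>i\<close> by the fixed split
  polynomial \<open>p0\<close> and squeezes the other components into the left half plane. Relative
  homology vanishes because \<open>r\<close> maps into the split set and is homotopic to the
  identity both on the whole space and within the split set. Both homotopies have the form
  \<open>?H G\<close> and differ only in component \<open>i\<close>.\<close>

lemma null_along_free_component:
  assumes i: "i < n" "1 \<le> D i" and J: "J \<subseteq> Pow {..<n}" "\<And>\<tau>. \<tau> \<in> J \<Longrightarrow> i \<notin> \<tau>"
  shows "null_along q (coprime_space n J D) {f \<in> topspace (coprime_space n J D). \<not> split_at a n i f}"
proof -
  let ?X = "coprime_space n J D" and ?S = "{f. split_at a n i f}" and ?I = "top_of_set {0..1::real}"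
  let ?H = "\<lambda>G w. \<lambda>j\<in>{..<n}. if j = i then G (fst w) (snd w) else move_roots (squeeze a (fst w)) (snd w j)"
  define p0 where "p0 = [:- complex_of_real (a + 1), 1:] * [:- complex_of_real (a - 1), 1:] ^ (D i - 1)"
  define r where "r f = (\<lambda>j\<in>{..<n}. if j = i then p0 else move_roots (squeeze a 0) (f j))" for f
  have fm: "f j \<in> monic_polys (D j)" if "f \<in> topspace ?X" "j < n" for f j
    using that tuple_monic[of f D n j] by simp
  have ZD: "0 \<le> fst w" "fst w \<le> 1" "snd w \<in> topspace ?X" "snd w \<in> S"
    if "w \<in> topspace (prod_topology ?I (subtopology ?X S))" for w S
  proof -
    have "fst w \<in> {0..1} \<and> snd w \<in> topspace ?X \<and> snd w \<in> S"
      using that by (simp only: topspace_prod_topology topspace_subtopology mem_Times_iff topspace_euclidean Int_iff UNIV_I simp_thms)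
    then show "0 \<le> fst w" "fst w \<le> 1" "snd w \<in> topspace ?X" "snd w \<in> S" by simp_all
  qed
  have lin: "[:- complex_of_real (a - 1), 1:] ^ (D i - 1) \<in> monic_polys (D i - 1)"
    using move_roots_monic[OF root_poly_monic] move_roots_const[OF root_poly_monic] by metis
  have p0: "p0 \<in> monic_polys (D i)"
    using monic_polys_mult[OF monic_polys_linear lin, of "complex_of_real (a + 1)"] i(2) by (simp only: p0_def) simp
  have p0r: "single_right a p0"
    unfolding single_right_def p0_def
  proof (intro exI[of _ "complex_of_real (a + 1)"] exI[of _ "[:- complex_of_real (a - 1), 1:] ^ (D i - 1)"] conjI allI impI refl)
    show "Re z < a" if "poly ([:- complex_of_real (a - 1), 1:] ^ (D i - 1)) z = 0" for z
    proof -
      have "- complex_of_real (a - 1) + z = 0" using that by (simp add: poly_power split: if_splits)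
      then have "Re (- complex_of_real (a - 1) + z) = 0" by (simp only: zero_complex.simps)
      then show ?thesis by simp
    qed
  qed simp
  have f: "continuous_map (prod_topology ?I (subtopology ?X S)) (monic_poly_space (D j)) (\<lambda>w. snd w j)" if "j < n" for j S
    by (intro continuous_map_snd_comp continuous_map_from_subtopology continuous_map_tuple_component that)
  have H: "continuous_map (prod_topology ?I (subtopology ?X S)) ?X (?H G)"
    if G: "continuous_map (prod_topology ?I (subtopology ?X S)) (monic_poly_space (D i)) (\<lambda>w. G (fst w) (snd w))" for G S
  proof -
    let ?Z = "prod_topology ?I (subtopology ?X S)"
    have s: "continuous_map ?Z ?I fst" by (rule continuous_map_fst)
    have 1: "continuous_map ?Z (tuple_space n D) (?H G)"
    proof (rule continuous_map_into_tuple_space)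
      fix j assume j: "j < n"
      have "continuous_map ?Z (monic_poly_space (D j)) (\<lambda>w. move_roots (squeeze a (fst w)) (snd w j))"
        by (rule continuous_map_move_roots_along[OF open_UNIV continuous_map_squeeze f[OF j] _ s]) simp
      then show "continuous_map ?Z (monic_poly_space (D j))
          (\<lambda>w. if j = i then G (fst w) (snd w) else move_roots (squeeze a (fst w)) (snd w j))"
        using G by (cases "j = i") simp_all
    qed
    have 2: "?H G w \<in> coprime_on J" if w: "w \<in> topspace ?Z" for w
    proof -
      note s = ZD(1,2)[OF w] and fX = ZD(3)[OF w]
      show ?thesis
      proof (rule coprime_on_move_roots[OF _ J(1) _ inj_squeeze[OF s]])
        show "snd w j \<noteq> 0" if "j < n" for j using fm[OF fX that] by (rule monic_polys_nonzero)
        show "snd w \<in> coprime_on J" using fX by simp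
        show "z \<in> UNIV" for z :: complex ..
        show "?H G w j = move_roots (squeeze a (fst w)) (snd w j)" if "\<tau> \<in> J" "j \<in> \<tau>" for \<tau> j
          using that J by auto
      qed
    qed
    show ?thesis using 1 2 unfolding continuous_map_in_subtopology by blast
  qed
  have r0: "?H G (0, f) = r f" if "G 0 f = p0" for G f using that by (simp add: r_def cong: if_cong)
  have r1: "?H G (1, f) = id f" if "G 1 f = f i" "f \<in> topspace ?X" for G f
  proof
    fix j
    show "?H G (1, f) j = id f j"
      using that fm[OF that(2), of j] move_roots_id[of "f j"] ext[of "squeeze a 1" "\<lambda>z. z", OF squeeze_1]
      by (cases "j < n") (auto simp: PiE_def extensional_def cong: if_cong)
  qed
  have hX: "homotopic_with (\<lambda>h. True) ?X ?X r id"
  proof (subst homotopic_with, simp, intro exI conjI ballI)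
    \<comment> \<open>Monic polynomials of fixed degree form an affine space, and component
      \<open>i\<close> is unconstrained, so a segment of coefficients is admissible.\<close>
    let ?G = "\<lambda>s f. Polynomial.smult (of_real (1 - s)) p0 + Polynomial.smult (of_real s) (f i)"
    let ?Z = "prod_topology ?I (subtopology ?X UNIV)"
    have "continuous_map ?Z (monic_poly_space (D i)) (\<lambda>w. ?G (fst w) (snd w))"
      unfolding continuous_map_into_monic_poly_space
    proof (intro conjI ballI)
      fix w assume w: "w \<in> topspace ?Z"
      have fi: "snd w i \<in> monic_polys (D i)" by (rule fm[OF ZD(3)[OF w] i(1)])
      show "?G (fst w) (snd w) \<in> monic_polys (D i)"
        by (rule monic_polysI) (simp_all add: coeff_monic_polys[OF fi] coeff_monic_polys[OF p0])
    next
      have "continuous_map ?Z euclidean (\<lambda>w. complex_of_real (h (fst w)))" if "continuous_on UNIV h" for h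
      proof -
        have "continuous_map ?I euclidean (\<lambda>s. complex_of_real (h s))"
          using that by (auto intro!: continuous_intros elim: continuous_on_subset)
        then show ?thesis by (rule continuous_map_fst_comp)
      qed
      moreover have "continuous_map ?Z euclidean (\<lambda>w. poly.coeff (snd w i) l)" for l
      proof -
        have "continuous_map ?Z (monic_poly_space (D i)) (\<lambda>w. snd w i)"
          by (rule f[OF i(1)])
        from continuous_map_compose[OF this continuous_map_coeff] show ?thesis by (simp add: o_def)
      qed
      ultimately show "coeffs_continuous ?Z (\<lambda>w. ?G (fst w) (snd w))"
        unfolding coeffs_continuous_def coeff_add coeff_smult
        by (intro allI continuous_map_add continuous_map_complex_mult) (auto intro!: continuous_intros)
    qed
    then have "continuous_map ?Z ?X (?H ?G)" by (rule H)
    then show "continuous_map (prod_topology ?I ?X) ?X (?H ?G)" by (simp only: subtopology_UNIV)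
    show "?H ?G (0, f) = r f" for f by (rule r0) simp
    show "?H ?G (1, f) = id f" if "f \<in> topspace ?X" for f by (rule r1[OF _ that]) simp
  qed auto
  have rS: "r f \<in> ?S" if "f \<in> topspace ?X" for f
  proof -
    have "Re z < a" if "j < n" "poly (move_roots (squeeze a 0) (f j)) z = 0" for j z
      using that squeeze_0 poly_move_roots[OF monic_polys_nonzero[OF fm[OF \<open>f \<in> topspace ?X\<close> that(1)]]] by auto
    then show ?thesis using p0r i(1) by (simp add: r_def split_at_def)
  qed
  have hS: "homotopic_with (\<lambda>h. True) (subtopology ?X ?S) (subtopology ?X ?S) r id"
  proof (subst homotopic_with, simp, intro exI conjI ballI)
    \<comment> \<open>A segment of coefficients could leave the split set. Moving the roots by
      \<open>gather\<close> keeps each on its side of the line and ends at the same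
      \<open>p0\<close>.\<close>
    let ?G = "\<lambda>s f. move_roots (gather a s) (f i)"
    let ?Z = "prod_topology ?I (subtopology ?X ?S)"
    have op: "open {z. Re z \<noteq> a}"
      by (intro open_Collect_neq continuous_intros)
    have "continuous_map ?Z (monic_poly_space (D i)) (\<lambda>w. move_roots (gather a (fst w)) (snd w i))"
    proof (rule continuous_map_move_roots_along[OF op continuous_map_gather f[OF i(1)] _ continuous_map_fst])
      fix w z assume "w \<in> topspace ?Z" "poly (snd w i) z = 0"
      then show "z \<in> {z. Re z \<noteq> a}"
        using single_right_roots[of a "snd w i" z] ZD(4)[of w ?S] by (simp add: split_at_def)
    qed
    then have 1: "continuous_map ?Z ?X (?H ?G)" by (rule H)
    have 2: "?H ?G w \<in> ?S" if w: "w \<in> topspace ?Z" for w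
    proof -
      note s = ZD(1,2)[OF w] and fX = ZD(3)[OF w]
      have fS: "split_at a n i (snd w)" using ZD(4)[OF w] by simp
      have "single_right a (?H ?G w i)"
        using single_right_move_roots[of a "snd w i" "gather a (fst w)" a] fS Re_gather[OF s]
          monic_polys_nonzero[OF fm[OF fX i(1)]] i(1) by (auto simp: split_at_def)
      moreover have "Re z < a" if j: "j < n" "j \<noteq> i" "poly (?H ?G w j) z = 0" for j z
      proof -
        have "poly (move_roots (squeeze a (fst w)) (snd w j)) z = 0" using j by simp
        then obtain y where "poly (snd w j) y = 0" "z = squeeze a (fst w) y"
          using poly_move_roots[OF monic_polys_nonzero[OF fm[OF fX j(1)]]] by blast
        then show ?thesis using squeeze_less[OF _ s] fS j by (auto simp: split_at_def)
      qed
      ultimately show ?thesis unfolding split_at_def by blast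
    qed
    show "continuous_map ?Z (subtopology ?X ?S) (?H ?G)"
      using 1 2 unfolding continuous_map_in_subtopology[of _ ?X] by blast
    show "?H ?G (0, f) = r f" if f: "f \<in> topspace (subtopology ?X ?S)" for f
    proof (rule r0)
      show "move_roots (gather a 0) (f i) = p0"
        unfolding p0_def using f fm[of f i] i(1) by (intro move_roots_gather_0) (auto simp: split_at_def)
    qed
    show "?H ?G (1, f) = id f" if f: "f \<in> topspace (subtopology ?X ?S)" for f
    proof (rule r1)
      have "gather a 1 = (\<lambda>z. z)" by (auto simp: gather_def)
      then show "move_roots (gather a 1) (f i) = f i"
        using f fm[of f i] i(1) by (simp add: move_roots_id)
    qed (use f in simp)
  qed auto
  have "trivial_group (relative_homology_group q ?X ?S)"
  proof (rule trivial_relative_homology_group_gen[OF _ hS hX])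
    show "continuous_map ?X (subtopology ?X ?S) r"
      using homotopic_with_imp_continuous_maps[OF hX] rS unfolding continuous_map_in_subtopology[of _ ?X] by blast
  qed
  moreover have "topspace ?X - {f \<in> topspace ?X. \<not> split_at a n i f} = topspace ?X \<inter> ?S" by blast
  ultimately show ?thesis unfolding null_along_def by (simp only: relative_homology_group_restrict)
qed

section \<open>The coprimality system of a stratum\<close>

text \<open>The member \<open>\<sigma>\<close> says that the cofactors have no common root, so that
  \<open>h\<close>, at index \<open>n\<close>, is the greatest common divisor. For
  \<open>\<tau>\<close> meeting \<open>\<sigma>\<close>, a common root of the merged tuple over
  \<open>\<tau>\<close> is either one of the components over \<open>\<tau>\<close> or a root of
  \<open>h\<close> at which the components over \<open>\<tau> - \<sigma>\<close> vanish.\<close>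

definition quotient_system :: "nat \<Rightarrow> nat set \<Rightarrow> nat set set \<Rightarrow> nat set set" where
  "quotient_system n \<sigma> J = insert \<sigma> (J \<union> (\<lambda>\<tau>. insert n (\<tau> - \<sigma>)) ` {\<tau> \<in> J. \<tau> \<inter> \<sigma> \<noteq> {}})"

lemma quotient_system_subset:
  assumes "\<sigma> \<subseteq> {..<n}" "J \<subseteq> Pow {..<n}"
  shows "quotient_system n \<sigma> J \<subseteq> Pow {..<Suc n}"
proof -
  have "j < Suc n" if "\<tau> \<in> insert \<sigma> J" "j \<in> \<tau>" for \<tau> j
    using assms that by (blast intro: less_SucI)
  then show ?thesis unfolding quotient_system_def by auto
qed

lemma merge_factor_apply: "j < n \<Longrightarrow> merge_factor n \<sigma> F j = (if j \<in> \<sigma> then F n * F j else F j)"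
  by (simp add: merge_factor_def)

context
  fixes n k :: nat and \<sigma> :: "nat set" and D :: "nat \<Rightarrow> nat" and F :: "nat \<Rightarrow> complex poly"
  assumes \<sigma>: "\<sigma> \<subseteq> {..<n}" and k: "\<And>j. j \<in> \<sigma> \<Longrightarrow> k \<le> D j"
    and F: "F \<in> topspace (tuple_space (Suc n) (quotient_degrees n \<sigma> k D))"
begin

lemma quotient_tuple_monic:
  "F n \<in> monic_polys k" "j \<in> \<sigma> \<Longrightarrow> F j \<in> monic_polys (D j - k)" "j < n \<Longrightarrow> j \<notin> \<sigma> \<Longrightarrow> F j \<in> monic_polys (D j)"
  "j \<le> n \<Longrightarrow> F j \<noteq> 0"
proof -
  note m = tuple_monic[OF F]
  show "F n \<in> monic_polys k" using m[of n] by (simp add: quotient_degrees_def)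
  show "F j \<in> monic_polys (D j - k)" if "j \<in> \<sigma>" using m[of j] that \<sigma> by (auto simp: quotient_degrees_def)
  show "F j \<in> monic_polys (D j)" if "j < n" "j \<notin> \<sigma>" using m[of j] that by (simp add: quotient_degrees_def)
  show "F j \<noteq> 0" if "j \<le> n" using m[of j] that monic_polys_nonzero by auto
qed

lemma merge_factor_topspace: "merge_factor n \<sigma> F \<in> topspace (tuple_space n D)"
  unfolding topspace_product_topology topspace_monic_poly_space
proof (rule PiE_I)
  fix j assume "j \<in> {..<n}"
  then have j: "j < n" by simp
  show "merge_factor n \<sigma> F j \<in> monic_polys (D j)"
  proof (cases "j \<in> \<sigma>")
    case True
    then show ?thesis
      using monic_polys_mult[OF quotient_tuple_monic(1) quotient_tuple_monic(2)[OF True]] k[OF True] j by (simp add: merge_factor_apply)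
  next
    case False
    then show ?thesis using quotient_tuple_monic(3)[OF j] j by (simp add: merge_factor_apply)
  qed
qed (simp add: merge_factor_def)

lemma common_factor_merge_factor: "common_factor \<sigma> k (merge_factor n \<sigma> F)"
  unfolding common_factor_def
proof (intro bexI ballI)
  show "F n dvd merge_factor n \<sigma> F j" if "j \<in> \<sigma>" for j
    using that \<sigma> by (auto simp: merge_factor_def)
qed (rule quotient_tuple_monic(1))

text \<open>If the cofactors have no common root, \<open>F n\<close> is the greatest common divisor,
  and a divisor with \<open>Suc k\<close> roots cannot fit into its \<open>k\<close> roots.\<close>

lemma common_factor_Suc_merge_factor:
  "common_factor \<sigma> (Suc k) (merge_factor n \<sigma> F) \<longleftrightarrow> (\<exists>z. \<forall>j\<in>\<sigma>. poly (F j) z = 0)"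
proof
  have m: "merge_factor n \<sigma> F j = F n * F j" if "j \<in> \<sigma>" for j
    using that \<sigma> by (auto simp: merge_factor_def)
  show "common_factor \<sigma> (Suc k) (merge_factor n \<sigma> F)" if "\<exists>z. \<forall>j\<in>\<sigma>. poly (F j) z = 0"
  proof -
    obtain z where "\<forall>j\<in>\<sigma>. poly (F j) z = 0" using \<open>\<exists>z. \<forall>j\<in>\<sigma>. poly (F j) z = 0\<close> ..
    then show ?thesis by (intro common_factor_Suc_if_common_root[OF quotient_tuple_monic(1) m]) auto
  qed
  show "\<exists>z. \<forall>j\<in>\<sigma>. poly (F j) z = 0" if cf: "common_factor \<sigma> (Suc k) (merge_factor n \<sigma> F)"
  proof (rule ccontr)
    assume no: "\<not> (\<exists>z. \<forall>j\<in>\<sigma>. poly (F j) z = 0)"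
    obtain h where h: "h \<in> monic_polys (Suc k)" "\<And>j. j \<in> \<sigma> \<Longrightarrow> h dvd F n * F j"
      using cf m unfolding common_factor_def by auto
    have "proots h \<subseteq># proots (F n)"
    proof (rule proots_common_divisor_subset[OF _ no monic_polys_nonzero[OF h(1)] h(2)])
      show "F n * F j \<noteq> 0" if "j \<in> \<sigma>" for j
        using quotient_tuple_monic(4)[of j] quotient_tuple_monic(4)[of n] that \<sigma> by auto
    qed
    then have "size (proots h) \<le> size (proots (F n))" by (rule size_mset_mono)
    then show False using h(1) quotient_tuple_monic(1) by (simp add: size_proots_complex monic_polys_def)
  qed
qed

lemma coprime_on_quotient_system:
  assumes J: "J \<subseteq> Pow {..<n}"
  shows "F \<in> coprime_on (quotient_system n \<sigma> J)
    \<longleftrightarrow> merge_factor n \<sigma> F \<in> coprime_on J \<and> \<not> common_factor \<sigma> (Suc k) (merge_factor n \<sigma> F)"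
proof -
  define Z where "Z f \<tau> \<longleftrightarrow> (\<exists>z. \<forall>j\<in>\<tau>. poly (f j) z = (0 :: complex))" for f :: "nat \<Rightarrow> complex poly" and \<tau>
  have Z: "Z (merge_factor n \<sigma> F) \<tau> \<longleftrightarrow> Z F \<tau> \<or> (\<tau> \<inter> \<sigma> \<noteq> {} \<and> Z F (insert n (\<tau> - \<sigma>)))" if "\<tau> \<in> J" for \<tau>
  proof -
    have \<tau>: "\<tau> \<subseteq> {..<n}" using that J by blast
    have "(\<forall>j\<in>\<tau>. poly (merge_factor n \<sigma> F j) z = 0)
        \<longleftrightarrow> (\<forall>j\<in>\<tau>. poly (F j) z = 0) \<or> (\<tau> \<inter> \<sigma> \<noteq> {} \<and> (\<forall>j\<in>insert n (\<tau> - \<sigma>). poly (F j) z = 0))" for z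
    proof -
      have "poly (merge_factor n \<sigma> F j) z = 0 \<longleftrightarrow> (j \<in> \<sigma> \<and> poly (F n) z = 0) \<or> poly (F j) z = 0" if "j \<in> \<tau>" for j
        using that \<tau> by (auto simp: merge_factor_def)
      then show ?thesis by auto
    qed
    then show ?thesis unfolding Z_def by blast
  qed
  have co: "f \<in> coprime_on A \<longleftrightarrow> (\<forall>\<tau>\<in>A. \<not> Z f \<tau>)" for f A
    unfolding coprime_on_def Z_def by (rule mem_Collect_eq)
  show ?thesis
    unfolding co common_factor_Suc_merge_factor Z_def[symmetric] quotient_system_def
    using Z by (auto simp only: ball_Un ball_simps)
qed

text \<open>The second index \<open>j\<close> in \<open>\<sigma>\<close> is essential:
  \<open>h\<close> divides component \<open>j\<close>, whose roots are all on the left. So the root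
  of component \<open>i\<close> on the right belongs to the cofactor \<open>F i\<close>, and
  \<open>h\<close> is just one more component with all roots on the left.\<close>

lemma split_at_merge_factor:
  assumes i: "i \<in> \<sigma>" and j: "j \<in> \<sigma>" "j \<noteq> i"
  shows "split_at a n i (merge_factor n \<sigma> F) \<longleftrightarrow> split_at a (Suc n) i F"
proof -
  let ?f = "merge_factor n \<sigma> F"
  have l: "i < n" "j < n" using i j \<sigma> by auto
  have mi: "?f i = F n * F i" and mj: "?f j = F n * F j" using i j l by (simp_all add: merge_factor_apply)
  have left: "(\<forall>z. poly (?f j') z = 0 \<longrightarrow> Re z < a) \<longleftrightarrow> (\<forall>z. poly (F j') z = 0 \<longrightarrow> Re z < a)"
    if "j' < n" "\<And>z. poly (F n) z = 0 \<Longrightarrow> Re z < a" for j'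
    using that by (auto simp: merge_factor_apply)
  show ?thesis
  proof
    assume s: "split_at a n i ?f"
    have h: "Re z < a" if "poly (F n) z = 0" for z
      using s that j l by (auto simp: split_at_def mj)
    obtain w g where w: "a < Re w" "F n * F i = [:- w, 1:] * g" "\<And>z. poly g z = 0 \<Longrightarrow> Re z < a"
      using s unfolding split_at_def single_right_def mi by blast
    have "poly (F n * F i) w = 0" unfolding w(2) by (simp del: mult_pCons_left)
    then have "poly (F i) w = 0" using h[of w] w(1) by auto
    then obtain g' where g': "F i = [:- w, 1:] * g'" unfolding poly_eq_0_iff_dvd by (auto elim: dvdE)
    have "[:- w, 1:] * (F n * g') = [:- w, 1:] * g" using w(2) unfolding g' by (simp only: mult.left_commute)
    then have "F n * g' = g" by (subst (asm) mult_left_cancel) auto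
    then have "single_right a (F i)" unfolding single_right_def using w g' by fastforce
    moreover have "Re z < a" if "j' < Suc n" "j' \<noteq> i" "poly (F j') z = 0" for j' z
      using left[OF _ h] s h that unfolding split_at_def by (cases "j' = n") (auto simp: less_Suc_eq)
    ultimately show "split_at a (Suc n) i F" unfolding split_at_def by blast
  next
    assume s: "split_at a (Suc n) i F"
    have h: "Re z < a" if "poly (F n) z = 0" for z
      using s that l by (auto simp: split_at_def)
    obtain w g where w: "a < Re w" "F i = [:- w, 1:] * g" "\<And>z. poly g z = 0 \<Longrightarrow> Re z < a"
      using s unfolding split_at_def single_right_def by blast
    have "?f i = [:- w, 1:] * (F n * g)" unfolding mi w(2) by (rule mult.left_commute)
    moreover have "Re z < a" if "poly (F n * g) z = 0" for z using that h w(3) by auto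
    ultimately have "single_right a (?f i)" unfolding single_right_def using w(1) by blast
    moreover have "Re z < a" if "j' < n" "j' \<noteq> i" "poly (?f j') z = 0" for j' z
    proof -
      have "\<forall>z. poly (F j') z = 0 \<longrightarrow> Re z < a" using s that(1,2) less_SucI unfolding split_at_def by blast
      then show ?thesis using left[OF that(1) h] that(3) by blast
    qed
    ultimately show "split_at a n i ?f" unfolding split_at_def by blast
  qed
qed

end

text \<open>Tuples over the stratum become arbitrary tuples for \<open>quotient_system\<close>,
  split at the same index \<open>i\<close>. If \<open>k\<close> exceeds some \<open>D j\<close> with
  \<open>j \<in> \<sigma>\<close>, the stratum is empty; hence \<open>null\<close> is
  conditional.\<close>

lemma null_along_common_factor_stratum:
  assumes i: "i \<in> \<sigma>" and j: "j \<in> \<sigma>" "j \<noteq> i" and \<sigma>: "\<sigma> \<subseteq> {..<n}" and J: "J \<subseteq> Pow {..<n}"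
    and null: "(\<And>j. j \<in> \<sigma> \<Longrightarrow> k \<le> D j) \<Longrightarrow>
      null_along (q + 2 * int k - 2 * int (card \<sigma> * k)) (coprime_space (Suc n) (quotient_system n \<sigma> J) (quotient_degrees n \<sigma> k D))
        {F \<in> topspace (coprime_space (Suc n) (quotient_system n \<sigma> J) (quotient_degrees n \<sigma> k D)). \<not> split_at a (Suc n) i F}"
  shows "null_along q (subtopology (tuple_space n D) {f \<in> topspace (coprime_space n J D). \<not> common_factor \<sigma> (Suc k) f})
    {f \<in> topspace (coprime_space n J D). \<not> common_factor \<sigma> (Suc k) f \<and> \<not> split_at a n i f \<and> common_factor \<sigma> k f}"
    (is "null_along q (subtopology _ ?N) ?T")
proof (cases "\<forall>j\<in>\<sigma>. k \<le> D j")
  case True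
  then have k: "k \<le> D j" if "j \<in> \<sigma>" for j using that by blast
  let ?D = "quotient_degrees n \<sigma> k D" and ?J = "quotient_system n \<sigma> J" and ?P = "tuple_space n D"
  let ?P' = "tuple_space (Suc n) ?D"
  let ?N' = "topspace ?P' \<inter> coprime_on ?J" and ?T' = "{F \<in> topspace (coprime_space (Suc n) ?J ?D). \<not> split_at a (Suc n) i F}"
  let ?C = "\<lambda>k. {f \<in> topspace ?P. common_factor \<sigma> k f}" and ?V = "{f \<in> topspace ?P. split_at a n i f}"
    and ?V' = "{f \<in> topspace ?P'. split_at a (Suc n) i f}"
  have \<sigma>0: "\<sigma> \<noteq> {}" and "i < n" using i \<sigma> by auto
  note C = closedin_common_factor[OF \<sigma> \<sigma>0]
  have null': "null_along (q + 2 * int k - 2 * int (card \<sigma> * k)) (subtopology ?P' ?N') ?T'"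
    using null[OF k] by (simp only: subtopology_restrict)
  then show ?thesis
  proof (subst null_along_common_factor[OF \<sigma> \<sigma>0 k])
    have "?N = topspace ?P \<inter> coprime_on J - ?C (Suc k)" unfolding topspace_subtopology by blast
    then show "openin ?P ?N" using openin_diff[OF openin_coprime_on[OF J] C] by (simp only:)
    have "closedin ?P (?C k \<inter> (topspace ?P - ?V))"
      by (intro closedin_Int C closedin_diff closedin_topspace openin_split_at \<open>i < n\<close>)
    then have "closedin (subtopology ?P ?N) ((?C k \<inter> (topspace ?P - ?V)) \<inter> ?N)"
      unfolding closedin_subtopology by blast
    moreover have "(?C k \<inter> (topspace ?P - ?V)) \<inter> ?N = ?T" unfolding topspace_subtopology by blast
    ultimately show "closedin (subtopology ?P ?N) ?T" by (simp only:)
    show "openin ?P' ?N'" by (rule openin_coprime_on[OF quotient_system_subset[OF \<sigma> J]])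
    have "closedin ?P' (topspace ?P' - ?V')"
      using \<open>i < n\<close> by (intro closedin_diff closedin_topspace openin_split_at) simp
    then have "closedin (subtopology ?P' ?N') ((topspace ?P' - ?V') \<inter> ?N')"
      unfolding closedin_subtopology by blast
    moreover have "(topspace ?P' - ?V') \<inter> ?N' = ?T'" unfolding topspace_subtopology by blast
    ultimately show "closedin (subtopology ?P' ?N') ?T'" by (simp only:)
    show "?T' = {F \<in> topspace ?P'. merge_factor n \<sigma> F \<in> ?T}"
    proof (rule Set.set_eqI)
      fix F
      show "F \<in> ?T' \<longleftrightarrow> F \<in> {F \<in> topspace ?P'. merge_factor n \<sigma> F \<in> ?T}"
      proof (cases "F \<in> topspace ?P'")
        case F: True
        show ?thesis
          using coprime_on_quotient_system[OF \<sigma> k F J] split_at_merge_factor[OF \<sigma> k F i j, of a]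
            common_factor_merge_factor[OF \<sigma> k F] merge_factor_topspace[OF \<sigma> k F] F
          unfolding topspace_subtopology by blast
      next
        case False
        then show ?thesis unfolding topspace_subtopology by blast
      qed
    qed
  qed auto
next
  case False
  then obtain j where j: "j \<in> \<sigma>" "D j < k" by force
  have "\<not> common_factor \<sigma> k f" if "f \<in> topspace (coprime_space n J D)" for f
  proof
    assume "common_factor \<sigma> k f"
    then obtain h where h: "h \<in> monic_polys k" "h dvd f j" using j by (auto simp: common_factor_def)
    have "f j \<in> monic_polys (D j)" using that j \<sigma> tuple_monic[of f D n j] by auto
    then show False using monic_dvd_factor[OF h(1) _ h(2)] j(2) by (metis not_le)
  qed
  then have "?T = {}" by blast
  then show ?thesis by (simp only: null_along_empty)
qed


section \<open>Vanishing along the tuples that are not split\<close>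

text \<open>The outer induction has to leave \<open>n\<close>, \<open>J\<close>, \<open>D\<close>
  and \<open>q\<close> arbitrary, since all of them change on a stratum. Only \<open>D i\<close>
  enters the bound, and it drops there because \<open>i \<in> \<sigma>\<close>.\<close>

lemma null_along_split:
  assumes "2 \<le> r" "i < n" "J \<subseteq> Pow {..<n}" "\<And>\<tau>. \<tau> \<in> J \<Longrightarrow> i \<in> \<tau> \<Longrightarrow> r \<le> card \<tau>"
    and "q < (2 * int r - 3) * int (D i)"
  shows "null_along q (coprime_space n J D) {f \<in> topspace (coprime_space n J D). \<not> split_at a n i f}"
  using assms(2-)
proof (induction "D i" arbitrary: n J D q rule: less_induct)
  case (less D n J q)
  note outer = less.hyps
  show ?case
  proof (cases "D i = 0")
    case True
    then have "q < 0" using less.prems(4) by simp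
    then show ?thesis by (rule null_along_negative)
  next
    case False
    have J: "finite J" if "J \<subseteq> Pow {..<n}" for J using that by (rule finite_subset) simp
    show ?thesis
      using less.prems(2-)
    proof (induction "card {\<tau> \<in> J. i \<in> \<tau>}" arbitrary: J q)
      case 0
      have "i \<notin> \<tau>" if "\<tau> \<in> J" for \<tau>
        using 0(1) J[OF 0(2)] that by auto
      then show ?case using null_along_free_component[of i n D J] less.prems(1) False 0(2) by simp
    next
      case (Suc c)
      have "{\<tau> \<in> J. i \<in> \<tau>} \<noteq> {}" using Suc(2) by force
      then obtain \<sigma> where \<sigma>: "\<sigma> \<in> J" "i \<in> \<sigma>" by blast
      define J' where "J' = J - {\<sigma>}"
      have J': "J' \<subseteq> Pow {..<n}" "\<And>\<tau>. \<tau> \<in> J' \<Longrightarrow> i \<in> \<tau> \<Longrightarrow> r \<le> card \<tau>" "J = insert \<sigma> J'"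
        using Suc.prems \<sigma> by (auto simp: J'_def)
      have \<sigma>n: "\<sigma> \<subseteq> {..<n}" "\<sigma> \<noteq> {}" and r\<sigma>: "r \<le> card \<sigma>" using Suc.prems \<sigma> by blast+
      obtain j where j: "j \<in> \<sigma>" "j \<noteq> i"
      proof -
        have "\<not> \<sigma> \<subseteq> {i}"
          using r\<sigma> \<open>2 \<le> r\<close> card_mono[of "{i}" \<sigma>] by auto
        then show ?thesis using that by blast
      qed
      have "{\<tau> \<in> J'. i \<in> \<tau>} = {\<tau> \<in> J. i \<in> \<tau>} - {\<sigma>}" by (auto simp: J'_def)
      then have c: "c = card {\<tau> \<in> J'. i \<in> \<tau>}"
        using Suc(2) \<sigma> by simp
      \<comment> \<open>\<open>X k\<close> consists of the tuples, coprime over \<open>J'\<close>,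
        whose greatest common divisor over \<open>\<sigma>\<close> has degree at most
        \<open>k\<close>. \<open>X (D i)\<close> is the whole space for \<open>J'\<close> and
        \<open>X 0\<close> the space for \<open>J\<close>; passing from \<open>X k\<close> to
        \<open>X (k - 1)\<close> deletes the closed stratum of degree \<open>k\<close>.\<close>
      define X where "X k = {f \<in> topspace (coprime_space n J' D). \<not> common_factor \<sigma> (Suc k) f}" for k
      have XA: "X k \<subseteq> topspace (tuple_space n D)" for k by (auto simp: X_def)
      \<comment> \<open>\<open>m\<close> counts the degrees removed from above. Subtraction is
        truncated, so from \<open>D i\<close> on the claim merely repeats the one for
        \<open>X 0\<close>.\<close>
      have claim: "q < (2 * int r - 3) * int (D i) \<Longrightarrow> null_along q (subtopology (tuple_space n D) (X (D i - m))) {f \<in> X (D i - m). \<not> split_at a n i f}" for m q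
      proof (induction m arbitrary: q)
        case 0
        have "\<not> common_factor \<sigma> (Suc (D i)) f" if "f \<in> topspace (coprime_space n J' D)" for f
        proof
          assume "common_factor \<sigma> (Suc (D i)) f"
          then obtain h where h: "h \<in> monic_polys (Suc (D i))" "h dvd f i" using \<sigma> by (auto simp: common_factor_def)
          have "f i \<in> monic_polys (D i)" using that less.prems(1) tuple_monic[of f D n i] by auto
          then show False using monic_dvd_factor[OF h(1) _ h(2)] by (metis not_less_eq_eq le_refl)
        qed
        then have "X (D i) = topspace (coprime_space n J' D)" unfolding X_def by blast
        then have e: "subtopology (tuple_space n D) (X (D i)) = coprime_space n J' D"
          by (simp only: topspace_subtopology subtopology_restrict)
        have "null_along q (coprime_space n J' D) {f \<in> topspace (coprime_space n J' D). \<not> split_at a n i f}"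
          using Suc(1)[OF c J'(1,2) 0] .
        then show ?case
          unfolding diff_zero e unfolding \<open>X (D i) = topspace (coprime_space n J' D)\<close> .
      next
        case (Suc m)
        show ?case
        proof (cases "m < D i")
          case False
          then have "D i - Suc m = D i - m" by simp
          then show ?thesis using Suc by simp
        next
          case True
          define k where "k = D i - m"
          have k: "D i - Suc m = k - 1" "D i - m = k" "1 \<le> k" "k \<le> D i" using True by (auto simp: k_def)
          let ?Y = "subtopology (tuple_space n D) (X k)"
          let ?K = "{f \<in> X k. \<not> split_at a n i f}" and ?S = "{f \<in> X k. common_factor \<sigma> k f}"
          have tY: "topspace ?Y = X k" using XA[of k] by auto
          have K: "closedin ?Y ?K"
          proof -
            have "closedin (tuple_space n D) (topspace (tuple_space n D) - {f \<in> topspace (tuple_space n D). split_at a n i f})"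
              by (intro closedin_diff closedin_topspace openin_split_at less.prems(1))
            moreover have "?K = (topspace (tuple_space n D) - {f \<in> topspace (tuple_space n D). split_at a n i f}) \<inter> X k"
              using XA[of k] by blast
            ultimately show ?thesis unfolding closedin_subtopology by blast
          qed
          have S: "closedin ?Y ?S"
          proof -
            have "?S = {f \<in> topspace (tuple_space n D). common_factor \<sigma> k f} \<inter> X k" using XA[of k] by blast
            then show ?thesis unfolding closedin_subtopology using closedin_common_factor[OF \<sigma>n] by blast
          qed
          have "null_along q (subtopology ?Y (topspace ?Y - ?S)) (?K - ?S)"
          proof (rule null_along_diff_closed[OF K S])
            show "null_along q ?Y ?K" using Suc.IH[OF Suc.prems] by (simp only: k)
            have "null_along (q + 1) (subtopology (tuple_space n D) {f \<in> topspace (coprime_space n J' D). \<not> common_factor \<sigma> (Suc k) f})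
              {f \<in> topspace (coprime_space n J' D). \<not> common_factor \<sigma> (Suc k) f \<and> \<not> split_at a n i f \<and> common_factor \<sigma> k f}"
            proof (rule null_along_common_factor_stratum[OF \<sigma>(2) j \<sigma>n(1) J'(1)])
              let ?D = "quotient_degrees n \<sigma> k D" and ?J = "quotient_system n \<sigma> J'"
              have Di: "?D i = D i - k" using \<sigma>(2) less.prems(1) by (simp add: quotient_degrees_def)
              show "null_along (q + 1 + 2 * int k - 2 * int (card \<sigma> * k)) (coprime_space (Suc n) ?J ?D)
                {F \<in> topspace (coprime_space (Suc n) ?J ?D). \<not> split_at a (Suc n) i F}"
              proof (rule outer)
                show "?D i < D i" using Di k by simp
                show "i < Suc n" using less.prems(1) by simp
                show "?J \<subseteq> Pow {..<Suc n}" by (rule quotient_system_subset[OF \<sigma>n(1) J'(1)])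
                \<comment> \<open>The new sets \<open>insert n (\<tau> - \<sigma>)\<close>, which
                  may be small, do not contain \<open>i\<close> because
                  \<open>i \<in> \<sigma>\<close> and \<open>i < n\<close>.\<close>
                show "r \<le> card \<tau>" if "\<tau> \<in> ?J" "i \<in> \<tau>" for \<tau>
                  using that \<sigma>(2) r\<sigma> J'(2) less.prems(1) by (auto simp: quotient_system_def)
                \<comment> \<open>With \<open>card \<sigma> = r + e\<close>, the required inequality
                  follows from the bound on \<open>q\<close> as soon as
                  \<open>1 - k - 2 k e \<le> 0\<close>. It is sharp for \<open>k = 1\<close> and
                  \<open>e = 0\<close>, which is where \<open>2 r - 3\<close> comes from.\<close>
                obtain e where e: "card \<sigma> = r + e" using r\<sigma> le_Suc_ex by blast
                have nn: "0 \<le> int e * (int k * 2)" by simp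
                have "int (D i - k) = int (D i) - int k" using k by simp
                then show "q + 1 + 2 * int k - 2 * int (card \<sigma> * k) < (2 * int r - 3) * int (?D i)"
                  using Suc.prems k(3) by (simp add: Di e algebra_simps, use nn in linarith)
              qed
            qed
            moreover have "?K \<inter> ?S = {f \<in> topspace (coprime_space n J' D). \<not> common_factor \<sigma> (Suc k) f \<and> \<not> split_at a n i f \<and> common_factor \<sigma> k f}"
              unfolding X_def by blast
            ultimately show "null_along (q + 1) ?Y (?K \<inter> ?S)" by (simp only: X_def)
          qed
          moreover have X': "X k - ?S = X (k - 1)"
          proof -
            have "Suc (k - 1) = k" using k(3) by simp
            then show ?thesis using common_factor_SucD[of \<sigma> k] unfolding X_def by auto
          qed
          moreover have "?K - ?S = {f \<in> X (k - 1). \<not> split_at a n i f}" unfolding X'[symmetric] by blast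
          moreover have "subtopology ?Y (X (k - 1)) = subtopology (tuple_space n D) (X (k - 1))"
            unfolding X'[symmetric] subtopology_subtopology by (intro arg_cong[of _ _ "subtopology (tuple_space n D)"]) blast
          ultimately show ?thesis by (simp only: tY k)
        qed
      qed
      have "X 0 = topspace (coprime_space n J D)"
        unfolding X_def J'(3) topspace_subtopology coprime_on_def One_nat_def[symmetric] common_factor_1 by blast
      then have "null_along q (subtopology (tuple_space n D) (topspace (coprime_space n J D))) {f \<in> topspace (coprime_space n J D). \<not> split_at a n i f}"
        using claim[OF Suc.prems(3), of "D i"] by simp
      then show ?case by (simp only: topspace_subtopology subtopology_restrict)
    qed
  qed
qed

section \<open>Stabilization\<close>

lemma homology_equivalence_through_mono:
  "homology_equivalence_through X Y f D \<Longrightarrow> D' \<le> D \<Longrightarrow> homology_equivalence_through X Y f D'"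
  unfolding homology_equivalence_through_def by auto

lemma homology_equivalence_through_cong:
  assumes "homology_equivalence_through X Y f D" "\<And>x. x \<in> topspace X \<Longrightarrow> f x = g x"
  shows "homology_equivalence_through X Y g D"
  unfolding homology_equivalence_through_def
proof (intro conjI allI impI)
  have f: "continuous_map X Y f" using assms(1) by (simp add: homology_equivalence_through_def)
  then show "continuous_map X Y g" using assms(2) by (rule continuous_map_eq)
  have "hom_induced k X {} Y {} f = hom_induced k X {} Y {} g" for k
    using assms(2) f by (intro homology_homotopy_empty homotopic_with_equal) auto
  then show "hom_induced k X {} Y {} g \<in> iso (homology_group k X) (homology_group k Y)" if "k \<le> D" for k
    using assms(1) that by (metis homology_equivalence_through_def)
qed

lemma homology_equivalence_through_compose:
  assumes f: "homology_equivalence_through X Y f D" and g: "homology_equivalence_through Y Z g D"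
  shows "homology_equivalence_through X Z (g \<circ> f) D"
  unfolding homology_equivalence_through_def
proof (intro conjI allI impI)
  have c: "continuous_map X Y f" "continuous_map Y Z g"
    using f g by (auto simp: homology_equivalence_through_def)
  then show "continuous_map X Z (g \<circ> f)" by (rule continuous_map_compose)
  have "hom_induced k X {} Z {} (g \<circ> f) = hom_induced k Y {} Z {} g \<circ> hom_induced k X {} Y {} f" for k
    using hom_induced_compose_empty[OF c] by simp
  then show "hom_induced k X {} Z {} (g \<circ> f) \<in> iso (homology_group k X) (homology_group k Z)" if "k \<le> D" for k
    using f g that iso_set_trans unfolding homology_equivalence_through_def by metis
qed

lemma homology_equivalence_through_homotopy_equivalence:
  assumes "continuous_map X Y f" "continuous_map Y X g"
    and "homotopic_with (\<lambda>_. True) X X (g \<circ> f) id" "homotopic_with (\<lambda>_. True) Y Y (f \<circ> g) id"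
  shows "homology_equivalence_through X Y f D"
  unfolding homology_equivalence_through_def
  using assms homotopy_equivalence_homology_group_isomorphism by blast

text \<open>Injectivity in degree \<open>k\<close> uses relative homology in degree
  \<open>k + 1\<close>, surjectivity that in degree \<open>k\<close>. With vanishing strictly below
  \<open>B\<close> this leaves \<open>k \<le> B - 2\<close>.\<close>

lemma homology_equivalence_through_inclusion:
  assumes "\<And>q. q < B \<Longrightarrow> trivial_group (relative_homology_group q X S)"
  shows "homology_equivalence_through (subtopology X S) X id (B - 2)"
  unfolding homology_equivalence_through_def
proof (intro conjI allI impI)
  show "continuous_map (subtopology X S) X id" by (simp add: continuous_map_from_subtopology)
  fix k assume k: "k \<le> B - 2"
  let ?G = "homology_group k (subtopology X S)" and ?H = "homology_group k X"
  let ?i = "hom_induced k (subtopology X S) {} X {} id"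
  have "exact_seq ([?H, ?G, relative_homology_group (k + 1) X S], [?i, hom_boundary (k + 1) X S])"
    using homology_exactness_axiom_2[of "k + 1" X S] by simp
  then have 1: "group_hom (relative_homology_group (k + 1) X S) ?G (hom_boundary (k + 1) X S)" "group_hom ?G ?H ?i"
      "hom_boundary (k + 1) X S ` carrier (relative_homology_group (k + 1) X S) = kernel ?G ?H ?i"
    by (auto simp: group_hom_def group_hom_axioms_def elim!: exact_seq.cases)
  have "exact_seq ([relative_homology_group k X S, ?H, ?G], [hom_induced k X {} X S id, ?i])"
    by (rule homology_exactness_axiom_3)
  then have 2: "group_hom ?H (relative_homology_group k X S) (hom_induced k X {} X S id)"
      "?i ` carrier ?G = kernel ?H (relative_homology_group k X S) (hom_induced k X {} X S id)"
    by (auto simp: group_hom_def group_hom_axioms_def elim!: exact_seq.cases)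
  interpret i: group_hom ?G ?H ?i by (rule 1(2))
  have "trivial_group (relative_homology_group (k + 1) X S)" "trivial_group (relative_homology_group k X S)"
    using assms k by auto
  then have "kernel ?G ?H ?i = {\<one>\<^bsub>?G\<^esub>}" "?i ` carrier ?G = carrier ?H"
    using group_hom.image_from_trivial_group[OF 1(1)] group_hom.kernel_to_trivial_group[OF 2(1)] 1(3) 2(2) by auto
  then show "?i \<in> iso ?G ?H"
    using i.homh i.inj_iff_trivial_ker unfolding iso_iff by blast
qed

section \<open>Adding one root\<close>

definition half_plane_chart :: "real \<Rightarrow> (complex \<Rightarrow> complex) \<Rightarrow> (complex \<Rightarrow> complex) \<Rightarrow> bool" where
  "half_plane_chart a \<theta> \<kappa> \<longleftrightarrow> continuous_on UNIV \<theta> \<and> continuous_on {z. Re z < a} \<kappa>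
     \<and> (\<forall>z. Re (\<theta> z) < a \<and> \<kappa> (\<theta> z) = z) \<and> (\<forall>z. Re z < a \<longrightarrow> \<theta> (\<kappa> z) = z)"

text \<open>\<open>A\<close> is the set of components that receive a new root. Intermediate sets
  \<open>A\<close> occur because the roots are added one at a time.\<close>

definition stabilize :: "nat \<Rightarrow> nat set \<Rightarrow> (complex \<Rightarrow> complex) \<Rightarrow> (nat \<Rightarrow> complex) \<Rightarrow> (nat \<Rightarrow> complex poly) \<Rightarrow> nat \<Rightarrow> complex poly" where
  "stabilize n A \<theta> y f = (\<lambda>j\<in>{..<n}. if j \<in> A then [:- y j, 1:] * move_roots \<theta> (f j) else move_roots \<theta> (f j))"

definition raise_degrees :: "nat set \<Rightarrow> (nat \<Rightarrow> nat) \<Rightarrow> nat \<Rightarrow> nat" where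
  "raise_degrees A D = (\<lambda>j. if j \<in> A then Suc (D j) else D j)"

lemma continuous_map_move_roots_fixed:
  assumes \<Omega>: "open \<Omega>" and \<theta>: "continuous_on \<Omega> \<theta>"
    and F: "continuous_map Z (monic_poly_space m) F" "\<And>x z. x \<in> topspace Z \<Longrightarrow> poly (F x) z = 0 \<Longrightarrow> z \<in> \<Omega>"
  shows "continuous_map Z (monic_poly_space m) (\<lambda>x. move_roots \<theta> (F x))"
proof (rule continuous_map_move_roots_along[OF \<Omega> _ F])
  show "continuous_map (prod_topology euclideanreal (top_of_set \<Omega>)) euclidean (\<lambda>(t, x). \<theta> x)"
    using continuous_map_compose[OF continuous_map_snd[of euclideanreal "top_of_set \<Omega>"], of euclidean \<theta>] \<theta> by (simp add: o_def case_prod_unfold)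
  show "continuous_map Z euclideanreal (\<lambda>_. 0)" by simp
qed

text \<open>A member containing \<open>i\<close> has a second element, whose component has all its
  roots on the left. So a common root lies on the left, and what component \<open>i\<close> does on
  the right of the line is irrelevant to coprimality.\<close>

lemma coprime_on_alter_component:
  assumes f: "f \<in> coprime_on J" and J: "J \<subseteq> Pow {..<n}" "\<And>\<tau>. \<tau> \<in> J \<Longrightarrow> i \<in> \<tau> \<Longrightarrow> 2 \<le> card \<tau>"
    and left: "\<And>j z. j < n \<Longrightarrow> j \<noteq> i \<Longrightarrow> poly (f j) z = 0 \<Longrightarrow> Re z < a"
    and g: "\<And>j. j < n \<Longrightarrow> j \<noteq> i \<Longrightarrow> g j = f j" "\<And>z. Re z < a \<Longrightarrow> poly (g i) z = 0 \<Longrightarrow> poly (f i) z = 0"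
  shows "g \<in> coprime_on J"
  unfolding coprime_on_def
proof (intro CollectI ballI notI)
  fix \<tau> assume \<tau>: "\<tau> \<in> J" and "\<exists>z. \<forall>j\<in>\<tau>. poly (g j) z = 0"
  then obtain z where z: "\<And>j. j \<in> \<tau> \<Longrightarrow> poly (g j) z = 0" by blast
  have \<tau>n: "j < n" if "j \<in> \<tau>" for j using \<tau> J that by blast
  have "poly (f j) z = 0" if "j \<in> \<tau>" for j
  proof (cases "j = i")
    case True
    have "\<not> \<tau> \<subseteq> {i}" using J(2)[OF \<tau>] that True card_mono[of "{i}" \<tau>] by auto
    then obtain j' where j': "j' \<in> \<tau>" "j' \<noteq> i" by blast
    then have "poly (f j') z = 0" using z g(1) \<tau>n by metis
    then have "Re z < a" using left j' \<tau>n by blast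
    then show ?thesis using g(2) z that True by blast
  next
    case False
    then show ?thesis using z g(1) \<tau>n that by metis
  qed
  then show False using f \<tau> unfolding coprime_on_def by blast
qed

text \<open>The quotient is the sign of \<open>Re z - a\<close>, so the real coefficient of
  \<open>y - z\<close> is \<open>0\<close> on the left of the line and \<open>1 - s\<close> on the
  right: the left half plane is fixed while the right one is contracted linearly to
  \<open>y\<close>.\<close>

definition drag :: "real \<Rightarrow> complex \<Rightarrow> real \<Rightarrow> complex \<Rightarrow> complex" where
  "drag a y s z = z + of_real ((1 - s) * (1 + (Re z - a) / \<bar>Re z - a\<bar>) / 2) * (y - z)"

lemma drag_left: "Re z < a \<Longrightarrow> drag a y s z = z"
  by (simp add: drag_def abs_if field_simps)

lemma drag_right: "a < Re z \<Longrightarrow> drag a y s z = of_real s * z + of_real (1 - s) * y"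
  by (simp add: drag_def abs_if field_simps)

lemma Re_drag_right:
  assumes "a < Re z" "a < Re y" "0 \<le> s" "s \<le> 1"
  shows "a < Re (drag a y s z)"
  using convex_combination_less[of "- Re z" "- a" "- Re y" s] assms by (simp add: drag_right algebra_simps)

lemma continuous_map_drag:
  "continuous_map (prod_topology (top_of_set {0..1}) (top_of_set {z. Re z \<noteq> a})) euclidean (\<lambda>(s, z). drag a y s z)"
proof -
  have "continuous_on ({0..1} \<times> {z. Re z \<noteq> a}) (\<lambda>(s, z). drag a y s z)"
    unfolding drag_def case_prod_unfold by (intro continuous_intros) auto
  then show ?thesis by (simp only: prod_topology_subtopology_eu continuous_map_iff_continuous)
qed

text \<open>The factorization is chosen before \<open>s\<close>: only the linear factor depends on
  the time, while the cofactor \<open>g\<close>, with all its roots on the left, stays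
  constant.\<close>

lemma move_roots_drag:
  assumes "single_right a p" "p \<in> monic_polys (Suc m)"
  shows "\<exists>w g. a < Re w \<and> g \<in> monic_polys m \<and> (\<forall>z. poly g z = 0 \<longrightarrow> Re z < a) \<and> p = [:- w, 1:] * g
    \<and> (\<forall>s. move_roots (drag a y s) p = [:- drag a y s w, 1:] * g)"
proof -
  obtain w g where w: "a < Re w" "p = [:- w, 1:] * g" "\<And>z. poly g z = 0 \<Longrightarrow> Re z < a"
    using assms(1) unfolding single_right_def by blast
  have g: "g \<in> monic_polys m" using monic_polys_mult_linearD(2)[of w g "Suc m"] assms(2) w(2) by simp
  have g0: "g \<noteq> 0" by (rule monic_polys_nonzero[OF g])
  have "move_roots (drag a y s) p = [:- drag a y s w, 1:] * g" for s
  proof -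
    have "move_roots (drag a y s) g = move_roots (\<lambda>z. z) g"
      using w(3) drag_left by (intro move_roots_cong[OF g0]) auto
    also have "\<dots> = g" by (rule move_roots_id[OF g])
    finally have e: "move_roots (drag a y s) g = g" .
    have "move_roots (drag a y s) p = move_roots (drag a y s) [:- w, 1:] * move_roots (drag a y s) g"
      unfolding w(2) by (rule move_roots_mult) (use g0 in simp_all)
    then show ?thesis by (simp only: e move_roots_linear)
  qed
  then show ?thesis using w g by blast
qed

text \<open>Stabilization factors through the split set \<open>?S\<close>. Onto \<open>?S\<close> it
  is a homotopy equivalence, with inverse \<open>\<rho>\<close> deleting the root on the right and
  undoing \<open>\<theta>\<close>. The inclusion of \<open>?S\<close> is controlled by
  \<open>null_along_split\<close> in the target space, where component \<open>i\<close> has degree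
  \<open>Suc (D i)\<close>.\<close>

lemma homology_equivalence_stabilize_one:
  assumes "2 \<le> r" and i: "i < n" and J: "J \<subseteq> Pow {..<n}" and r: "\<And>\<tau>. \<tau> \<in> J \<Longrightarrow> i \<in> \<tau> \<Longrightarrow> r \<le> card \<tau>"
    and chart: "half_plane_chart a \<theta> \<kappa>" and y: "a < Re (y i)"
  shows "homology_equivalence_through (coprime_space n J D) (coprime_space n J (raise_degrees {i} D)) (stabilize n {i} \<theta> y)
    ((2 * int r - 3) * int (Suc (D i)) - 2)"
proof -
  define D' where "D' = raise_degrees {i} D"
  let ?X = "coprime_space n J D" and ?Y = "coprime_space n J D'" and ?S = "{f. split_at a n i f}"
  let ?YS = "subtopology ?Y ?S" and ?L = "{z. Re z < a}" and ?s = "stabilize n {i} \<theta> y" and ?I = "top_of_set {0..1::real}"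
  have D': "D' i = Suc (D i)" "\<And>j. j \<noteq> i \<Longrightarrow> D' j = D j" by (auto simp: D'_def raise_degrees_def)
  have two: "2 \<le> card \<tau>" if "\<tau> \<in> J" "i \<in> \<tau>" for \<tau> using r[OF that] \<open>2 \<le> r\<close> by simp
  have th: "continuous_on UNIV \<theta>" "continuous_on ?L \<kappa>" "\<And>z. Re (\<theta> z) < a" "\<And>z. \<kappa> (\<theta> z) = z" "\<And>z. Re z < a \<Longrightarrow> \<theta> (\<kappa> z) = z"
    using chart unfolding half_plane_chart_def by blast+
  have inj: "inj \<theta>" "inj_on \<kappa> ?L"
    by (rule inj_on_inverseI[of _ \<kappa>], rule th(4)) (rule inj_on_inverseI[of _ \<theta>], simp add: th(5))
  have fX: "f j \<in> monic_polys (D j)" if "f \<in> topspace ?X" "j < n" for f j using that tuple_monic[of f D n j] by simp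
  have fY: "f j \<in> monic_polys (D' j)" if "f \<in> topspace ?Y" "j < n" for f j using that tuple_monic[of f D' n j] by simp
  have YS: "f \<in> topspace ?Y" "f \<in> coprime_on J" "single_right a (f i)" "f i \<in> monic_polys (Suc (D i))"
      "\<And>j z. j < n \<Longrightarrow> j \<noteq> i \<Longrightarrow> poly (f j) z = 0 \<Longrightarrow> Re z < a" if "f \<in> topspace ?YS" for f
  proof -
    show fY': "f \<in> topspace ?Y" using that unfolding topspace_subtopology by blast
    then show "f \<in> coprime_on J" unfolding topspace_subtopology by blast
    show "f i \<in> monic_polys (Suc (D i))" using fY[OF fY' i] D' by simp
    have "split_at a n i f" using that unfolding topspace_subtopology by blast
    then show "single_right a (f i)" "\<And>j z. j < n \<Longrightarrow> j \<noteq> i \<Longrightarrow> poly (f j) z = 0 \<Longrightarrow> Re z < a"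
      unfolding split_at_def by blast+
  qed
  have compX: "continuous_map ?X (monic_poly_space (D j)) (\<lambda>f. f j)" if "j < n" for j
    by (intro continuous_map_from_subtopology continuous_map_tuple_component that)
  have compY: "continuous_map ?YS (monic_poly_space (D' j)) (\<lambda>f. f j)" if "j < n" for j
    by (intro continuous_map_from_subtopology continuous_map_tuple_component that)
  have lin: "continuous_map Z (monic_poly_space 1) (\<lambda>_. [:- y i, 1:])" for Z :: "'z topology"
    unfolding continuous_map_into_monic_poly_space using monic_polys_linear by blast
  have left: "Re z < a" if lf: "f \<in> topspace ?X" "j < n" "poly (move_roots \<theta> (f j)) z = 0" for f j z
  proof -
    obtain x where "z = \<theta> x"
      using lf(3) unfolding poly_move_roots[OF monic_polys_nonzero[OF fX[OF lf(1,2)]]] by (elim exE conjE)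
    then show ?thesis by (simp only: th(3))
  qed
  have contS: "continuous_map ?X ?YS ?s"
    unfolding continuous_map_in_subtopology
  proof (intro conjI)
    have m: "continuous_map ?X (monic_poly_space (D j)) (\<lambda>f. move_roots \<theta> (f j))" if "j < n" for j
      by (rule continuous_map_move_roots_fixed[OF open_UNIV th(1) compX[OF that]]) simp
    show "continuous_map ?X (tuple_space n D') ?s"
      unfolding stabilize_def[abs_def]
    proof (rule continuous_map_into_tuple_space)
      fix j assume j: "j < n"
      show "continuous_map ?X (monic_poly_space (D' j))
          (\<lambda>f. if j \<in> {i} then [:- y j, 1:] * move_roots \<theta> (f j) else move_roots \<theta> (f j))"
        using continuous_map_monic_mult[OF lin m[OF j]] m[OF j] D'
        by (cases "j = i") (simp_all del: mult_pCons_left)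
    qed
    show "?s \<in> topspace ?X \<rightarrow> coprime_on J"
    proof
      fix f assume f: "f \<in> topspace ?X"
      have "(\<lambda>j. move_roots \<theta> (f j)) \<in> coprime_on J"
      proof (rule coprime_on_move_roots[OF _ J _ inj(1)])
        show "f j \<noteq> 0" if "j < n" for j using fX[OF f that] by (rule monic_polys_nonzero)
        show "f \<in> coprime_on J" using f unfolding topspace_subtopology by blast
      qed auto
      then show "?s f \<in> coprime_on J"
      proof (rule coprime_on_alter_component[OF _ J two])
        show "Re z < a" if "j < n" "poly (move_roots \<theta> (f j)) z = 0" for j z using left[OF f that] .
        show "poly (move_roots \<theta> (f i)) z = 0" if "Re z < a" "poly (?s f i) z = 0" for z
          using that i y by (auto simp: stabilize_def)
      qed (auto simp: stabilize_def)
    qed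
    show "?s \<in> topspace ?X \<rightarrow> ?S"
    proof
      fix f assume f: "f \<in> topspace ?X"
      have "single_right a (?s f i)"
        unfolding single_right_def
      proof (intro exI conjI allI impI)
        show "a < Re (y i)" by (rule y)
        show "?s f i = [:- y i, 1:] * move_roots \<theta> (f i)" using i by (simp add: stabilize_def)
        show "Re z < a" if "poly (move_roots \<theta> (f i)) z = 0" for z by (rule left[OF f i that])
      qed
      moreover have "Re z < a" if "j < n" "j \<noteq> i" "poly (?s f j) z = 0" for j z
        using left[OF f that(1)] that by (simp add: stabilize_def)
      ultimately show "?s f \<in> ?S" unfolding split_at_def by blast
    qed
  qed
  \<comment> \<open>\<open>G f\<close> is the cofactor of the root on the right. Dragging this root
    to the fixed point \<open>y i\<close> first makes the divisor constant, so continuity of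
    \<open>G\<close> follows from that of monic division and the root need not be located as a
    function of \<open>f\<close>.\<close>
  define G where "G f = move_roots (drag a (y i) 0) (f i) div [:- y i, 1:]" for f :: "nat \<Rightarrow> complex poly"
  define \<rho> where "\<rho> f = (\<lambda>j\<in>{..<n}. if j = i then move_roots \<kappa> (G f) else move_roots \<kappa> (f j))" for f
  have op: "open {z. Re z \<noteq> a}" by (intro open_Collect_neq continuous_intros)
  have G: "f i = [:- w, 1:] * G f \<and> G f \<in> monic_polys (D i) \<and> a < Re w \<and> (\<forall>z. poly (G f) z = 0 \<longrightarrow> Re z < a)
      \<and> (\<forall>s. move_roots (drag a (y i) s) (f i) = [:- drag a (y i) s w, 1:] * G f)"
    if f: "f \<in> topspace ?YS" and w: "a < Re w" "poly (f i) w = 0" for f w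
  proof -
    obtain w' g where g: "a < Re w'" "g \<in> monic_polys (D i)" "\<And>z. poly g z = 0 \<Longrightarrow> Re z < a" "f i = [:- w', 1:] * g"
        "\<And>s. move_roots (drag a (y i) s) (f i) = [:- drag a (y i) s w', 1:] * g"
      using move_roots_drag[OF YS(3,4)[OF f], of "y i"] by blast
    have "w = w'" using w g(3)[of w] unfolding g(4) by auto
    have "drag a (y i) 0 w' = y i" using drag_right[OF g(1)] by simp
    then have "move_roots (drag a (y i) 0) (f i) = [:- y i, 1:] * g" using g(5)[of 0] by simp
    then have "G f = g" by (simp only: G_def) (rule nonzero_mult_div_cancel_left, simp)
    then show ?thesis using g \<open>w = w'\<close> by auto
  qed
  have rt: "\<exists>w. a < Re w \<and> poly (f i) w = 0" if f: "f \<in> topspace ?YS" for f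
  proof -
    obtain w g where "a < Re w" "f i = [:- w, 1:] * g" using YS(3)[OF f] unfolding single_right_def by blast
    then show ?thesis by (intro exI[of _ w]) (simp del: mult_pCons_left)
  qed
  have Gm: "G f \<in> monic_polys (D i)" "poly (G f) z = 0 \<Longrightarrow> Re z < a" "poly (G f) z = 0 \<Longrightarrow> poly (f i) z = 0"
    if "f \<in> topspace ?YS" for f z
  proof -
    obtain w where w: "a < Re w" "poly (f i) w = 0" using rt[OF \<open>f \<in> topspace ?YS\<close>] by blast
    note g = G[OF \<open>f \<in> topspace ?YS\<close> w]
    show "G f \<in> monic_polys (D i)" using g by blast
    show "poly (G f) z = 0 \<Longrightarrow> Re z < a" using g by blast
    show "poly (f i) z = 0" if "poly (G f) z = 0"
    proof -
      have "poly (f i) z = poly ([:- w, 1:] * G f) z" using g by (simp only:)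
      then show ?thesis using that by (simp only: poly_mult mult_zero_right)
    qed
  qed
  have movei: "continuous_map (prod_topology ?I ?YS) (monic_poly_space (Suc (D i))) (\<lambda>w. move_roots (drag a (y i) (fst w)) (snd w i))"
  proof (rule continuous_map_move_roots_along[OF op continuous_map_drag _ _ continuous_map_fst])
    show "continuous_map (prod_topology ?I ?YS) (monic_poly_space (Suc (D i))) (\<lambda>w. snd w i)"
      using continuous_map_snd_comp[OF compY[OF i]] D' by simp
    fix w z assume "w \<in> topspace (prod_topology ?I ?YS)" "poly (snd w i) z = 0"
    moreover from this have "snd w \<in> topspace ?YS" unfolding topspace_prod_topology mem_Times_iff by blast
    ultimately show "z \<in> {z. Re z \<noteq> a}" using single_right_roots YS(3) by blast
  qed
  have contG: "continuous_map ?YS (monic_poly_space (D i)) G"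
  proof -
    have "continuous_map ?YS (prod_topology ?I ?YS) (\<lambda>f. (0, f))"
      by (intro continuous_map_pairedI) auto
    from continuous_map_compose[OF this movei]
    have "continuous_map ?YS (monic_poly_space (Suc (D i))) (\<lambda>f. move_roots (drag a (y i) 0) (f i))" by (simp add: o_def)
    from continuous_map_monic_div[OF this lin] show ?thesis by (simp add: G_def[abs_def])
  qed
  have contR: "continuous_map ?YS ?X \<rho>"
    unfolding continuous_map_in_subtopology
  proof (intro conjI)
    show "continuous_map ?YS (tuple_space n D) \<rho>"
      unfolding \<rho>_def[abs_def]
    proof (rule continuous_map_into_tuple_space)
      fix j assume j: "j < n"
      show "continuous_map ?YS (monic_poly_space (D j)) (\<lambda>f. if j = i then move_roots \<kappa> (G f) else move_roots \<kappa> (f j))"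
      proof (cases "j = i")
        case True
        have "continuous_map ?YS (monic_poly_space (D i)) (\<lambda>f. move_roots \<kappa> (G f))"
          by (rule continuous_map_move_roots_fixed[OF open_Re_halfplanes(1) th(2) contG]) (use Gm in blast)
        then show ?thesis using True by simp
      next
        case False
        have "continuous_map ?YS (monic_poly_space (D' j)) (\<lambda>f. move_roots \<kappa> (f j))"
          by (rule continuous_map_move_roots_fixed[OF open_Re_halfplanes(1) th(2) compY[OF j]]) (use YS(5) j False in blast)
        then show ?thesis using False D' by simp
      qed
    qed
    show "\<rho> \<in> topspace ?YS \<rightarrow> coprime_on J"
    proof
      fix f assume f: "f \<in> topspace ?YS"
      have co: "f(i := G f) \<in> coprime_on J"
      proof (rule coprime_on_alter_component[OF YS(2)[OF f] J two YS(5)[OF f]])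
        show "(f(i := G f)) j = f j" if "j \<noteq> i" for j using that by simp
        show "poly (f i) z = 0" if "poly ((f(i := G f)) i) z = 0" for z
          by (rule Gm(3)[OF f]) (use that in simp)
      qed
      show "\<rho> f \<in> coprime_on J"
      proof (rule coprime_on_move_roots[OF _ J co inj(2)])
        show "(f(i := G f)) j \<noteq> 0" if "j < n" for j
          using monic_polys_nonzero[OF fY[OF YS(1)[OF f] that]] monic_polys_nonzero[OF Gm(1)[OF f]] by simp
        show "z \<in> ?L" if "j < n" "poly ((f(i := G f)) j) z = 0" for j z
          using that YS(5)[OF f that(1)] Gm(2)[OF f] by (cases "j = i") simp_all
        show "\<rho> f j = move_roots \<kappa> ((f(i := G f)) j)" if "\<tau> \<in> J" "j \<in> \<tau>" for \<tau> j
          using that J by (auto simp: \<rho>_def)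
      qed
    qed
  qed
  have RS: "\<rho> (?s f) = f" if f: "f \<in> topspace ?X" for f
  proof
    fix j
    have sf: "?s f \<in> topspace ?YS" using contS f by (rule continuous_map_funspace[THEN funcset_mem])
    have mm: "move_roots \<kappa> (move_roots \<theta> (f j)) = f j" if "j < n" for j
      unfolding move_roots_move_roots th(4) by (rule move_roots_id[OF fX[OF f that]])
    have "?s f i = [:- y i, 1:] * move_roots \<theta> (f i)" using i by (simp add: stabilize_def)
    moreover from this have "poly (?s f i) (y i) = 0" by (simp del: mult_pCons_left)
    then have "?s f i = [:- y i, 1:] * G (?s f)" using G[OF sf y] by blast
    ultimately have "[:- y i, 1:] * G (?s f) = [:- y i, 1:] * move_roots \<theta> (f i)" by simp
    then have "G (?s f) = move_roots \<theta> (f i)" by (subst (asm) mult_left_cancel) auto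
    then show "\<rho> (?s f) j = f j"
      using mm f by (cases "j < n") (auto simp: \<rho>_def stabilize_def PiE_def extensional_def)
  qed
  \<comment> \<open>Adding the deleted root again puts it at \<open>y i\<close> instead of its old
    place; dragging connects the two positions within the split set.\<close>
  define H where "H w = (\<lambda>j\<in>{..<n}. if j = i then move_roots (drag a (y i) (fst w)) (snd w i) else snd w j)"
    for w :: "real \<times> (nat \<Rightarrow> complex poly)"
  have hYS: "homotopic_with (\<lambda>_. True) ?YS ?YS (?s \<circ> \<rho>) id"
  proof (subst homotopic_with, simp, intro exI[of _ H] conjI ballI)
    let ?Z = "prod_topology ?I ?YS"
    have Z: "0 \<le> fst w" "fst w \<le> 1" "snd w \<in> topspace ?YS" if "w \<in> topspace ?Z" for w
      using that unfolding topspace_prod_topology mem_Times_iff topspace_subtopology[of euclidean] by simp_all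
    have Hi: "\<exists>w'. a < Re w' \<and> H w i = [:- w', 1:] * G (snd w)" if w: "w \<in> topspace ?Z" for w
    proof -
      obtain v where v: "a < Re v" "poly (snd w i) v = 0" using rt[OF Z(3)[OF w]] by blast
      have "move_roots (drag a (y i) (fst w)) (snd w i) = [:- drag a (y i) (fst w) v, 1:] * G (snd w)"
        using G[OF Z(3)[OF w] v] by blast
      then have "H w i = [:- drag a (y i) (fst w) v, 1:] * G (snd w)"
        using i by (simp add: H_def del: mult_pCons_left)
      then show ?thesis using Re_drag_right[OF v(1) y Z(1,2)[OF w]] by blast
    qed
    show "continuous_map ?Z ?YS H"
      unfolding continuous_map_in_subtopology
    proof (intro conjI)
      show "continuous_map ?Z (tuple_space n D') H"
        unfolding H_def[abs_def]
      proof (rule continuous_map_into_tuple_space)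
        fix j assume j: "j < n"
        show "continuous_map ?Z (monic_poly_space (D' j)) (\<lambda>w. if j = i then move_roots (drag a (y i) (fst w)) (snd w i) else snd w j)"
          using movei continuous_map_snd_comp[OF compY[OF j]] D' by (cases "j = i") simp_all
      qed
      show "H \<in> topspace ?Z \<rightarrow> coprime_on J"
      proof
        fix w assume w: "w \<in> topspace ?Z"
        obtain w' where w': "a < Re w'" "H w i = [:- w', 1:] * G (snd w)" using Hi[OF w] by blast
        show "H w \<in> coprime_on J"
        proof (rule coprime_on_alter_component[OF YS(2)[OF Z(3)[OF w]] J two YS(5)[OF Z(3)[OF w]]])
          show "H w j = snd w j" if "j < n" "j \<noteq> i" for j using that by (simp add: H_def)
          show "poly (snd w i) z = 0" if "Re z < a" "poly (H w i) z = 0" for z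
          proof (rule Gm(3)[OF Z(3)[OF w]])
            have "z \<noteq> w'" using that(1) w'(1) by auto
            then show "poly (G (snd w)) z = 0" using that(2) unfolding w'(2) by auto
          qed
        qed
      qed
      show "H \<in> topspace ?Z \<rightarrow> ?S"
      proof
        fix w assume w: "w \<in> topspace ?Z"
        have "single_right a (H w i)" using Hi[OF w] Gm(2)[OF Z(3)[OF w]] unfolding single_right_def by blast
        moreover have "Re z < a" if "j < n" "j \<noteq> i" "poly (H w j) z = 0" for j z
          using YS(5)[OF Z(3)[OF w] that(1,2)] that by (simp add: H_def)
        ultimately show "H w \<in> ?S" unfolding split_at_def by blast
      qed
    qed
    show "H (0, f) = (?s \<circ> \<rho>) f" if f: "f \<in> topspace ?YS" for f
    proof
      fix j
      obtain w where w: "a < Re w" "poly (f i) w = 0" using rt[OF f] by blast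
      have "drag a (y i) 0 w = y i" using drag_right[OF w(1)] by simp
      then have d: "move_roots (drag a (y i) 0) (f i) = [:- y i, 1:] * G f" using G[OF f w] by metis
      have mm: "move_roots \<theta> (move_roots \<kappa> p) = p" if "p \<in> monic_polys m" "\<And>z. poly p z = 0 \<Longrightarrow> Re z < a" for p m
      proof -
        have "move_roots (\<lambda>z. \<theta> (\<kappa> z)) p = move_roots (\<lambda>z. z) p"
          using that th(5) by (intro move_roots_cong monic_polys_nonzero[OF that(1)]) auto
        then show ?thesis unfolding move_roots_move_roots move_roots_id[OF that(1)] .
      qed
      show "H (0, f) j = (?s \<circ> \<rho>) f j"
      proof (cases "j < n")
        case True
        then show ?thesis
          using d mm[OF Gm(1,2)[OF f]] mm[OF fY[OF YS(1)[OF f] True] YS(5)[OF f True]]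
          by (cases "j = i") (simp_all add: H_def \<rho>_def stabilize_def del: mult_pCons_left)
      qed (simp add: H_def stabilize_def)
    qed
    show "H (1, f) = id f" if f: "f \<in> topspace ?YS" for f
    proof
      fix j
      have "drag a (y i) 1 = (\<lambda>z. z)" by (simp add: drag_def fun_eq_iff)
      moreover have "f \<in> extensional {..<n}" using YS(1)[OF f] by (simp add: PiE_def)
      ultimately show "H (1, f) j = id f j"
        using move_roots_id[OF YS(4)[OF f]] by (cases "j < n") (auto simp: H_def extensional_def)
    qed
  qed simp
  have 1: "homology_equivalence_through ?X ?YS ?s E" for E
  proof (rule homology_equivalence_through_homotopy_equivalence[OF contS contR _ hYS])
    show "homotopic_with (\<lambda>_. True) ?X ?X (\<rho> \<circ> ?s) id"
      using RS contS contR by (intro homotopic_with_equal continuous_map_compose) simp_all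
  qed
  have 2: "homology_equivalence_through ?YS ?Y id ((2 * int r - 3) * int (Suc (D i)) - 2)"
  proof (rule homology_equivalence_through_inclusion)
    fix q assume "q < (2 * int r - 3) * int (Suc (D i))"
    then have "null_along q ?Y {f \<in> topspace ?Y. \<not> split_at a n i f}"
      using null_along_split[OF \<open>2 \<le> r\<close> i J r] D'(1) by simp
    moreover have "topspace ?Y - {f \<in> topspace ?Y. \<not> split_at a n i f} = topspace ?Y \<inter> ?S" by blast
    ultimately show "trivial_group (relative_homology_group q ?Y ?S)"
      unfolding null_along_def by (simp only: relative_homology_group_restrict)
  qed
  from homology_equivalence_through_compose[OF 1 2] show ?thesis by (simp add: D'_def)
qed

section \<open>Adding several roots\<close>

text \<open>An explicit chart that is increasing in the real part and keeps the imaginary part, so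
  vertical lines go to vertical lines and the horizontal order of points is preserved.\<close>

lemma half_plane_chart_exp:
  "half_plane_chart b (\<lambda>z. Complex (b - exp (- Re z)) (Im z)) (\<lambda>z. Complex (- ln (b - Re z)) (Im z))"
  unfolding half_plane_chart_def
proof (intro conjI allI impI)
  show "continuous_on UNIV (\<lambda>z. Complex (b - exp (- Re z)) (Im z))" by (intro continuous_intros)
  show "continuous_on {z. Re z < b} (\<lambda>z. Complex (- ln (b - Re z)) (Im z))" by (intro continuous_intros) auto
qed (auto simp: complex_eq_iff)

text \<open>The rightmost point \<open>y m\<close> is added last. The other points are added in the
  chart \<open>\<omega>\<close> of a half plane that excludes \<open>y m\<close>; then
  \<open>\<zeta>\<close> returns to the original coordinates while \<open>y m\<close> is added. The
  composite equals \<open>stabilize n A \<theta> y\<close> exactly, since \<open>\<zeta>\<close>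
  undoes \<open>\<omega>\<close> on that half plane. Distinct real parts are what makes a separating
  vertical line exist.\<close>

lemma homology_equivalence_stabilize:
  assumes "2 \<le> r" and J: "J \<subseteq> Pow {..<n}" and r: "\<And>\<tau>. \<tau> \<in> J \<Longrightarrow> r \<le> card \<tau>"
    and A: "A \<subseteq> {..<n}" "A \<noteq> {}" and chart: "half_plane_chart a \<theta> \<kappa>"
    and y: "\<And>j. j \<in> A \<Longrightarrow> a < Re (y j)" "inj_on (\<lambda>j. Re (y j)) A"
    and D: "\<And>j. j \<in> A \<Longrightarrow> D j = d"
  shows "homology_equivalence_through (coprime_space n J D) (coprime_space n J (raise_degrees A D)) (stabilize n A \<theta> y)
    ((2 * int r - 3) * int (Suc d) - 2)"
  using A chart y D
proof (induction "card A" arbitrary: A a \<theta> \<kappa> y)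
  case 0
  then show ?case using finite_subset[OF 0(2)] by simp
next
  case (Suc c)
  have fin: "finite A" using Suc.prems(1) finite_subset by blast
  show ?case
  proof (cases "c = 0")
    case True
    then obtain i where A: "A = {i}" using Suc(2) by (metis card_1_singletonE One_nat_def)
    then show ?thesis
      using homology_equivalence_stabilize_one[OF \<open>2 \<le> r\<close> _ J r Suc.prems(3), of i y D] Suc.prems by simp
  next
    case False
    obtain m where m: "m \<in> A" "\<And>j. j \<in> A \<Longrightarrow> Re (y j) \<le> Re (y m)"
    proof -
      have "Max ((\<lambda>j. Re (y j)) ` A) \<in> (\<lambda>j. Re (y j)) ` A" using fin Suc.prems(2) by (intro Max_in) auto
      then obtain m where m: "m \<in> A" "Max ((\<lambda>j. Re (y j)) ` A) = Re (y m)" by auto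
      have "Re (y j) \<le> Re (y m)" if "j \<in> A" for j unfolding m(2)[symmetric] using fin that by simp
      then show ?thesis using that m(1) by blast
    qed
    define A' where "A' = A - {m}"
    have c: "c = card A'" using Suc(2) m(1) fin by (simp add: A'_def)
    then have "A' \<noteq> {}" using False by auto
    with c have A': "A' \<subseteq> {..<n}" "A' \<noteq> {}" "c = card A'" "A = insert m A'" "m \<notin> A'"
      using Suc.prems(1) m(1) by (auto simp: A'_def)
    have less: "Re (y j) < Re (y m)" if "j \<in> A'" for j
      using m inj_onD[OF Suc.prems(5), of j m] that by (force simp: A'_def less_le)
    define M where "M = Max ((\<lambda>j. Re (y j)) ` A')"
    have finA': "finite A'" using fin by (simp add: A'_def)
    have M: "Re (y j) \<le> M" if "j \<in> A'" for j unfolding M_def using that finA' by simp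
    have "M \<in> (\<lambda>j. Re (y j)) ` A'" unfolding M_def using finA' A'(2) by (intro Max_in) auto
    then have Mm: "M < Re (y m)" "a < M" using less Suc.prems(4) A'(4) by auto
    \<comment> \<open>A vertical line between the rightmost point and all others.\<close>
    define b where "b = (M + Re (y m)) / 2"
    have b: "M < b" "b < Re (y m)" "a < b" using Mm by (auto simp: b_def)
    define \<zeta> where "\<zeta> = (\<lambda>z. Complex (b - exp (- Re z)) (Im z))"
    define \<omega> where "\<omega> = (\<lambda>z. Complex (- ln (b - Re z)) (Im z))"
    have ch: "half_plane_chart b \<zeta> \<omega>" unfolding \<zeta>_def \<omega>_def by (rule half_plane_chart_exp)
    have th: "continuous_on UNIV \<theta>" "continuous_on {z. Re z < a} \<kappa>" "\<And>z. Re (\<theta> z) < a" "\<And>z. \<kappa> (\<theta> z) = z" "\<And>z. Re z < a \<Longrightarrow> \<theta> (\<kappa> z) = z"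
      using Suc.prems(3) unfolding half_plane_chart_def by blast+
    have xo: "continuous_on UNIV \<zeta>" "continuous_on {z. Re z < b} \<omega>" "\<And>z. \<omega> (\<zeta> z) = z" "\<And>z. Re z < b \<Longrightarrow> \<zeta> (\<omega> z) = z"
      using ch unfolding half_plane_chart_def by blast+
    have Re\<omega>: "Re (\<omega> z) < Re (\<omega> w)" if "Re z < Re w" "Re w < b" for z w
      using that by (simp add: \<omega>_def)
    have Re\<zeta>: "Re (\<zeta> z) < a" if "Re z < - ln (b - a)" for z
    proof -
      have "exp (ln (b - a)) < exp (- Re z)" using that by simp
      then have "b - a < exp (- Re z)" using b(3) by simp
      then show ?thesis by (simp add: \<zeta>_def)
    qed
    \<comment> \<open>\<open>\<omega>\<close> carries the line \<open>Re z = a\<close> to the line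
      \<open>Re z = - ln (b - a)\<close>, so in the new coordinates the old half plane is again
      bounded by a vertical line.\<close>
    have "half_plane_chart (- ln (b - a)) (\<lambda>z. \<omega> (\<theta> z)) (\<lambda>z. \<kappa> (\<zeta> z))"
      unfolding half_plane_chart_def
    proof (intro conjI allI impI)
      show "continuous_on UNIV (\<lambda>z. \<omega> (\<theta> z))"
        by (rule continuous_on_compose2[OF xo(2) th(1)]) (use th(3) b(3) in \<open>auto intro: less_trans\<close>)
      show "continuous_on {z. Re z < - ln (b - a)} (\<lambda>z. \<kappa> (\<zeta> z))"
        by (rule continuous_on_compose2[OF th(2) continuous_on_subset[OF xo(1)]]) (use Re\<zeta> in auto)
      show "Re (\<omega> (\<theta> z)) < - ln (b - a)" for z using th(3)[of z] b(3) by (simp add: \<omega>_def)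
      have t: "Re (\<theta> z) < b" for z using th(3)[of z] b(3) by simp
      show "\<kappa> (\<zeta> (\<omega> (\<theta> z))) = z" for z by (simp only: xo(4)[OF t] th(4))
      show "\<omega> (\<theta> (\<kappa> (\<zeta> z))) = z" if "Re z < - ln (b - a)" for z by (simp only: th(5)[OF Re\<zeta>[OF that]] xo(3))
    qed
    then have "homology_equivalence_through (coprime_space n J D) (coprime_space n J (raise_degrees A' D))
        (stabilize n A' (\<lambda>z. \<omega> (\<theta> z)) (\<lambda>j. \<omega> (y j))) ((2 * int r - 3) * int (Suc d) - 2)"
    proof (rule Suc(1)[OF A'(3) A'(1,2)])
      show "- ln (b - a) < Re (\<omega> (y j))" if "j \<in> A'" for j
        using M[OF that] Suc.prems(4)[of j] that b A'(4) by (simp add: \<omega>_def)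
      show "inj_on (\<lambda>j. Re (\<omega> (y j))) A'"
      proof (rule inj_onI)
        fix j k assume jk: "j \<in> A'" "k \<in> A'" "Re (\<omega> (y j)) = Re (\<omega> (y k))"
        have "Re (y j) < b" "Re (y k) < b" using M jk b by force+
        then have "Re (y j) = Re (y k)"
          using Re\<omega>[of "y j" "y k"] Re\<omega>[of "y k" "y j"] jk(3) by (cases "Re (y j)" "Re (y k)" rule: linorder_cases) auto
        then show "j = k" using inj_onD[OF Suc.prems(5)] jk A'(4) by simp
      qed
      show "D j = d" if "j \<in> A'" for j using Suc.prems(6) that A'(4) by simp
    qed
    moreover have "homology_equivalence_through (coprime_space n J (raise_degrees A' D))
        (coprime_space n J (raise_degrees {m} (raise_degrees A' D))) (stabilize n {m} \<zeta> y) ((2 * int r - 3) * int (Suc d) - 2)"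
    proof -
      have "raise_degrees A' D m = d" using A'(5) Suc.prems(6)[OF m(1)] by (simp add: raise_degrees_def)
      then show ?thesis
        using homology_equivalence_stabilize_one[OF \<open>2 \<le> r\<close> _ J r ch, of m y "raise_degrees A' D"] Suc.prems(1) m(1) b(2) by auto
    qed
    ultimately have comp: "homology_equivalence_through (coprime_space n J D) (coprime_space n J (raise_degrees {m} (raise_degrees A' D)))
        (stabilize n {m} \<zeta> y \<circ> stabilize n A' (\<lambda>z. \<omega> (\<theta> z)) (\<lambda>j. \<omega> (y j))) ((2 * int r - 3) * int (Suc d) - 2)"
      by (rule homology_equivalence_through_compose)
    have rd: "raise_degrees {m} (raise_degrees A' D) = raise_degrees A D"
      using A'(4,5) by (auto simp: raise_degrees_def)
    have st: "(stabilize n {m} \<zeta> y \<circ> stabilize n A' (\<lambda>z. \<omega> (\<theta> z)) (\<lambda>j. \<omega> (y j))) f = stabilize n A \<theta> y f"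
      if f: "f \<in> topspace (coprime_space n J D)" for f
    proof
      fix j
      have "Re (\<theta> z) < b" for z using th(3)[of z] b(3) by simp
      then have xt: "move_roots \<zeta> (move_roots (\<lambda>z. \<omega> (\<theta> z)) p) = move_roots \<theta> p" for p
        unfolding move_roots_move_roots by (simp only: xo(4))
      have l: "move_roots \<zeta> ([:- \<omega> (y j), 1:] * move_roots (\<lambda>z. \<omega> (\<theta> z)) (f j)) = [:- y j, 1:] * move_roots \<theta> (f j)"
        if "j \<in> A'" "j < n"
      proof -
        have "move_roots (\<lambda>z. \<omega> (\<theta> z)) (f j) \<noteq> 0"
          using f that(2) tuple_monic[of f D n j] by (intro monic_polys_nonzero[OF move_roots_monic]) simp
        moreover have "Re (y j) < b" using M[OF that(1)] b(1) by simp
        ultimately show ?thesis by (subst move_roots_mult) (simp_all add: move_roots_linear xt xo(4) del: mult_pCons_left)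
      qed
      show "(stabilize n {m} \<zeta> y \<circ> stabilize n A' (\<lambda>z. \<omega> (\<theta> z)) (\<lambda>j. \<omega> (y j))) f j = stabilize n A \<theta> y f j"
        using l A'(4,5) by (simp add: stabilize_def xt del: mult_pCons_left)
    qed
    show ?thesis using homology_equivalence_through_cong[OF comp st] unfolding rd .
  qed
qed

section \<open>Arbitrary points and charts\<close>

lemma homology_equivalence_move_roots:
  assumes J: "J \<subseteq> Pow {..<n}" and \<mu>: "continuous_on UNIV \<mu>" "continuous_on UNIV \<nu>" "\<And>z. \<nu> (\<mu> z) = z" "\<And>z. \<mu> (\<nu> z) = z"
  shows "homology_equivalence_through (coprime_space n J D) (coprime_space n J D) (\<lambda>f. \<lambda>j\<in>{..<n}. move_roots \<mu> (f j)) E"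
proof -
  let ?X = "coprime_space n J D" and ?m = "\<lambda>\<mu> f. \<lambda>j\<in>{..<n}. move_roots \<mu> (f j)"
  have fX: "f j \<in> monic_polys (D j)" if "f \<in> topspace ?X" "j < n" for f j using that tuple_monic[of f D n j] by simp
  have c: "continuous_map ?X ?X (?m \<mu>)" if \<mu>: "continuous_on UNIV \<mu>" and inj: "inj \<mu>" for \<mu>
    unfolding continuous_map_in_subtopology
  proof (intro conjI)
    show "continuous_map ?X (tuple_space n D) (?m \<mu>)"
    proof (rule continuous_map_into_tuple_space)
      fix j assume j: "j < n"
      show "continuous_map ?X (monic_poly_space (D j)) (\<lambda>f. move_roots \<mu> (f j))"
        by (rule continuous_map_move_roots_fixed[OF open_UNIV \<mu>])
          (simp_all add: continuous_map_from_subtopology continuous_map_tuple_component j)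
    qed
    show "?m \<mu> \<in> topspace ?X \<rightarrow> coprime_on J"
    proof
      fix f assume f: "f \<in> topspace ?X"
      show "?m \<mu> f \<in> coprime_on J"
      proof (rule coprime_on_move_roots[OF _ J _ inj])
        show "f j \<noteq> 0" if "j < n" for j using fX[OF f that] by (rule monic_polys_nonzero)
        show "f \<in> coprime_on J" using f unfolding topspace_subtopology by blast
        show "z \<in> UNIV" for z :: complex ..
        show "?m \<mu> f j = move_roots \<mu> (f j)" if "\<tau> \<in> J" "j \<in> \<tau>" for \<tau> j using that J by auto
      qed
    qed
  qed
  have id: "(?m \<alpha> \<circ> ?m \<beta>) f = id f" if f: "f \<in> topspace ?X" and ab: "\<And>z. \<alpha> (\<beta> z) = z" for \<alpha> \<beta> f
  proof
    fix j
    have "move_roots \<alpha> (move_roots \<beta> (f j)) = f j" if "j < n"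
      unfolding move_roots_move_roots ab by (rule move_roots_id[OF fX[OF f that]])
    then show "(?m \<alpha> \<circ> ?m \<beta>) f j = id f j" using f by (cases "j < n") (auto simp: PiE_def extensional_def)
  qed
  have inj: "inj \<mu>" "inj \<nu>" using \<mu>(3,4) by (metis injI)+
  show ?thesis
  proof (rule homology_equivalence_through_homotopy_equivalence)
    show 1: "continuous_map ?X ?X (?m \<mu>)" and 2: "continuous_map ?X ?X (?m \<nu>)" using c \<mu> inj by auto
    show "homotopic_with (\<lambda>_. True) ?X ?X (?m \<nu> \<circ> ?m \<mu>) id"
      using id[where \<alpha> = \<nu> and \<beta> = \<mu>, OF _ \<mu>(3)] continuous_map_compose[OF 1 2] by (intro homotopic_with_equal) auto
    show "homotopic_with (\<lambda>_. True) ?X ?X (?m \<mu> \<circ> ?m \<nu>) id"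
      using id[where \<alpha> = \<mu> and \<beta> = \<nu>, OF _ \<mu>(4)] continuous_map_compose[OF 2 1] by (intro homotopic_with_equal) auto
  qed
qed

text \<open>If \<open>v k \<noteq> v l\<close>, equality of the two products determines
  \<open>t\<close>, by taking logarithms of positive numbers; so finitely many values are to be
  avoided. If \<open>v k = v l\<close>, then \<open>u k \<noteq> u l\<close> for
  \<open>k \<noteq> l\<close>, and the common factor does no harm. In \<open>?B\<close> such pairs
  contribute only the default value \<open>0\<close> of division by zero.\<close>

lemma exists_separating_twist:
  fixes u v :: "nat \<Rightarrow> real"
  assumes u: "\<And>k. k < n \<Longrightarrow> 0 < u k" and inj: "inj_on (\<lambda>k. (u k, v k)) {..<n}"
  obtains t where "inj_on (\<lambda>k. u k * exp (t * v k)) {..<n}"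
proof -
  let ?B = "(\<lambda>(k, l). (ln (u l) - ln (u k)) / (v k - v l)) ` ({..<n} \<times> {..<n})"
  have "finite ?B" by simp
  then obtain t where t: "t \<notin> ?B" using ex_new_if_finite[OF infinite_UNIV_char_0] by blast
  have "inj_on (\<lambda>k. u k * exp (t * v k)) {..<n}"
  proof (rule inj_onI)
    fix k l assume kl: "k \<in> {..<n}" "l \<in> {..<n}" "u k * exp (t * v k) = u l * exp (t * v l)"
    have "ln (u k * exp (t * v k)) = ln (u k) + t * v k" "ln (u l * exp (t * v l)) = ln (u l) + t * v l"
      using u[of k] u[of l] kl(1,2) by (simp_all add: ln_mult)
    then have eq: "t * (v k - v l) = ln (u l) - ln (u k)" using kl(3) by (simp add: algebra_simps)
    have "v k = v l"
    proof (rule ccontr)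
      assume "v k \<noteq> v l"
      then have "t = (ln (u l) - ln (u k)) / (v k - v l)" using eq by (simp add: field_simps)
      then show False using t kl(1,2) by auto
    qed
    moreover from this have "u k = u l" using kl(3) by simp
    ultimately show "k = l" using inj_onD[OF inj] kl by simp
  qed
  then show ?thesis by (rule that)
qed

text \<open>For families of spaces that agree only on the index set, as do the degrees raised on
  \<open>{..<n}\<close> and the constant degree \<open>Suc d\<close>.\<close>

lemma product_topology_cong:
  assumes "\<And>i. i \<in> I \<Longrightarrow> X i = Y i"
  shows "product_topology X I = product_topology Y I"
proof -
  have "{i \<in> I. U i \<noteq> topspace (X i)} = {i \<in> I. U i \<noteq> topspace (Y i)}" for U using assms by auto
  then show ?thesis
    unfolding topology_eq openin_product_topology_alt using assms by simp
qed

theorem theorem2p7: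
  fixes n d :: nat and I :: "nat set set"
    and \<phi> \<psi> :: "complex \<Rightarrow> complex" and x :: "nat \<Rightarrow> complex"
  assumes "n \<ge> 2" and "d \<ge> 1"
    and "I \<noteq> {}" and "I \<subseteq> Pow {..<n}" and "\<And>\<sigma>. \<sigma> \<in> I \<Longrightarrow> card \<sigma> \<ge> 2"
    and "homeomorphic_map euclidean (top_of_set (half_plane d)) \<phi>"
    and "homeomorphic_map euclidean (top_of_set (half_plane (Suc d))) \<psi>"
    and "inj_on x {..<n}"
    and "\<And>k. k < n \<Longrightarrow> real d < Re (x k) \<and> Re (x k) < real d + 1"
  shows "homology_equivalence_through (hol_space n I d) (hol_space n I (Suc d))
           (stab_map n \<phi> \<psi> x) ((2 * int (r_min I) - 3) * int d - 2)"
proof -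
  define r where "r = r_min I"
  have "finite I" using assms(4) by (rule finite_subset) simp
  then have r: "r \<le> card \<tau>" if "\<tau> \<in> I" for \<tau> using that by (simp add: r_def r_min_def)
  have "r \<in> card ` I" unfolding r_def r_min_def using \<open>finite I\<close> assms(3) by (intro Min_in) auto
  then have r2: "2 \<le> r" using assms(5) by auto
  obtain \<phi>' where "homeomorphic_maps euclidean (top_of_set (half_plane d)) \<phi> \<phi>'"
    using assms(6) homeomorphic_map_maps by blast
  then have \<phi>: "continuous_on UNIV \<phi>" "continuous_on {z. Re z < d} \<phi>'" "\<And>z. Re (\<phi> z) < d" "\<And>z. \<phi>' (\<phi> z) = z"
      "\<And>z. Re z < d \<Longrightarrow> \<phi> (\<phi>' z) = z"
    by (auto simp: homeomorphic_maps_def half_plane_def continuous_map_in_subtopology)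
  obtain \<psi>' where "homeomorphic_maps euclidean (top_of_set (half_plane (Suc d))) \<psi> \<psi>'"
    using assms(7) homeomorphic_map_maps by blast
  then have \<psi>: "continuous_on UNIV \<psi>" "continuous_on {z. Re z < d + 1} \<psi>'" "\<And>z. Re (\<psi> z) < d + 1" "\<And>z. \<psi>' (\<psi> z) = z"
      "\<And>z. Re z < d + 1 \<Longrightarrow> \<psi> (\<psi>' z) = z"
    by (auto simp: homeomorphic_maps_def half_plane_def continuous_map_in_subtopology add.commute)
  have inv: "inv_into UNIV \<psi> z = \<psi>' z" if "Re z < d + 1" for z
    using \<psi>(4,5) that by (metis UNIV_I inj_on_inverseI inv_into_f_f)
  \<comment> \<open>This stretches the half plane \<open>Re z < d + 1\<close> to the whole plane so
    that the line \<open>Re z = d\<close> goes to real part \<open>0\<close>: old roots get negative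
    values and the added points positive ones.\<close>
  define u where "u z = - ln (d + 1 - Re z)" for z
  have u: "0 < u (x k)" if "k < n" for k using assms(9)[OF that] by (simp add: u_def)
  have "inj_on (\<lambda>k. (u (x k), Im (x k))) {..<n}"
  proof (rule inj_onI)
    fix k l assume kl: "k \<in> {..<n}" "l \<in> {..<n}" "(u (x k), Im (x k)) = (u (x l), Im (x l))"
    then have "x k = x l" using assms(9)[of k] assms(9)[of l] by (simp add: u_def complex_eq_iff)
    then show "k = l" using inj_onD[OF assms(8)] kl by simp
  qed
  then obtain t where t: "inj_on (\<lambda>k. u (x k) * exp (t * Im (x k))) {..<n}"
    using exists_separating_twist[of n "\<lambda>k. u (x k)" "\<lambda>k. Im (x k)"] u by blast
  \<comment> \<open>The twist makes the real parts of the added points distinct, so that they can be added one after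
    the other from left to right.\<close>
  define \<beta> where "\<beta> z = Complex (u z * exp (t * Im z)) (Im z)" for z
  define \<gamma> where "\<gamma> z = Complex (d + 1 - exp (- (Re z * exp (- (t * Im z))))) (Im z)" for z
  have \<beta>: "continuous_on {z. Re z < d + 1} \<beta>" unfolding \<beta>_def u_def by (intro continuous_intros) auto
  have \<gamma>: "continuous_on UNIV \<gamma>" unfolding \<gamma>_def by (intro continuous_intros)
  have \<gamma>lt: "Re (\<gamma> z) < d + 1" for z by (simp add: \<gamma>_def)
  have \<gamma>\<beta>: "\<gamma> (\<beta> z) = z" if "Re z < d + 1" for z
    using that by (simp add: \<gamma>_def \<beta>_def u_def complex_eq_iff exp_minus mult.assoc)
  have \<beta>\<gamma>: "\<beta> (\<gamma> z) = z" for z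
  proof -
    have "u (\<gamma> z) = Re z * exp (- (t * Im z))" by (simp add: \<gamma>_def u_def)
    moreover have "Im (\<gamma> z) = Im z" by (simp add: \<gamma>_def)
    ultimately show ?thesis by (simp add: \<beta>_def complex_eq_iff mult.assoc flip: exp_add)
  qed
  \<comment> \<open>The twist multiplies \<open>u\<close> by a positive number and so keeps its
    sign; the half plane \<open>Re z < d\<close> still becomes \<open>Re z < 0\<close>, which is why
    the chart below has \<open>a = 0\<close>.\<close>
  have \<beta>neg: "Re (\<beta> z) < 0" if "Re z < d" for z
    using that by (simp add: \<beta>_def u_def mult_neg_pos)
  have \<gamma>neg: "Re (\<gamma> z) < d" if "Re z < 0" for z
    using that by (simp add: \<gamma>_def mult_neg_pos)
  have chart: "half_plane_chart 0 (\<lambda>z. \<beta> (\<phi> z)) (\<lambda>z. \<phi>' (\<gamma> z))"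
    unfolding half_plane_chart_def
  proof (intro conjI allI impI)
    have lt: "Re (\<phi> z) < d + 1" for z using \<phi>(3)[of z] by simp
    show "continuous_on UNIV (\<lambda>z. \<beta> (\<phi> z))"
      by (rule continuous_on_compose2[OF \<beta> \<phi>(1)]) (use lt in auto)
    show "continuous_on {z. Re z < 0} (\<lambda>z. \<phi>' (\<gamma> z))"
      by (rule continuous_on_compose2[OF \<phi>(2) continuous_on_subset[OF \<gamma>]]) (use \<gamma>neg in auto)
    show "Re (\<beta> (\<phi> z)) < 0" for z by (rule \<beta>neg[OF \<phi>(3)])
    show "\<phi>' (\<gamma> (\<beta> (\<phi> z))) = z" for z by (simp only: \<gamma>\<beta>[OF lt] \<phi>(4))
    show "\<beta> (\<phi> (\<phi>' (\<gamma> z))) = z" if "Re z < 0" for z by (simp only: \<phi>(5)[OF \<gamma>neg[OF that]] \<beta>\<gamma>)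
  qed
  let ?X = "coprime_space n I (\<lambda>_. d)" and ?Y = "coprime_space n I (\<lambda>_. Suc d)"
  have hX: "hol_space n I e = coprime_space n I (\<lambda>_. e)" for e
    by (simp add: hol_space_def coprime_on_def)
  have raise: "tuple_space n (raise_degrees {..<n} (\<lambda>_. d)) = tuple_space n (\<lambda>_. Suc d)"
    by (rule product_topology_cong) (simp_all add: raise_degrees_def)
  have "homology_equivalence_through ?X (coprime_space n I (raise_degrees {..<n} (\<lambda>_. d)))
      (stabilize n {..<n} (\<lambda>z. \<beta> (\<phi> z)) (\<lambda>k. \<beta> (x k))) ((2 * int r - 3) * int (Suc d) - 2)"
  proof (rule homology_equivalence_stabilize[OF r2 assms(4) r order_refl _ chart])
    have "0 \<in> {..<n}" using assms(1) by simp
    then show "{..<n} \<noteq> {}" by blast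
    show "0 < Re (\<beta> (x j))" if "j \<in> {..<n}" for j using u[of j] that by (simp add: \<beta>_def)
    show "inj_on (\<lambda>j. Re (\<beta> (x j))) {..<n}" using t by (simp add: \<beta>_def)
  qed auto
  then have 1: "homology_equivalence_through ?X ?Y (stabilize n {..<n} (\<lambda>z. \<beta> (\<phi> z)) (\<lambda>k. \<beta> (x k))) ((2 * int r - 3) * int (Suc d) - 2)"
    by (simp only: raise)
  \<comment> \<open>After adding the points in the coordinates \<open>\<beta>\<close>, the roots
    fill the whole plane. The map \<open>\<psi>' \<circ> \<gamma>\<close> returns to the half plane
    \<open>Re z < d + 1\<close> and applies the inverse of \<open>\<psi>\<close>. It is a
    self-homeomorphism of the plane, so it costs nothing in homology.\<close>
  have 2: "homology_equivalence_through ?Y ?Y (\<lambda>f. \<lambda>j\<in>{..<n}. move_roots (\<lambda>z. \<psi>' (\<gamma> z)) (f j)) ((2 * int r - 3) * int (Suc d) - 2)"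
  proof (rule homology_equivalence_move_roots[OF assms(4), where \<nu> = "\<lambda>z. \<beta> (\<psi> z)"])
    show "continuous_on UNIV (\<lambda>z. \<psi>' (\<gamma> z))"
      by (rule continuous_on_compose2[OF \<psi>(2) \<gamma>]) (use \<gamma>lt in auto)
    show "continuous_on UNIV (\<lambda>z. \<beta> (\<psi> z))"
      by (rule continuous_on_compose2[OF \<beta> \<psi>(1)]) (use \<psi>(3) in auto)
    show "\<beta> (\<psi> (\<psi>' (\<gamma> z))) = z" for z by (simp only: \<psi>(5)[OF \<gamma>lt] \<beta>\<gamma>)
    show "\<psi>' (\<gamma> (\<beta> (\<psi> z))) = z" for z by (simp only: \<gamma>\<beta>[OF \<psi>(3)] \<psi>(4))
  qed
  have "homology_equivalence_through ?X ?Y (stab_map n \<phi> \<psi> x) ((2 * int r - 3) * int (Suc d) - 2)"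
  proof (rule homology_equivalence_through_cong[OF homology_equivalence_through_compose[OF 1 2]])
    fix f assume f: "f \<in> topspace ?X"
    show "((\<lambda>f. \<lambda>j\<in>{..<n}. move_roots (\<lambda>z. \<psi>' (\<gamma> z)) (f j)) \<circ> stabilize n {..<n} (\<lambda>z. \<beta> (\<phi> z)) (\<lambda>k. \<beta> (x k))) f
        = stab_map n \<phi> \<psi> x f"
    proof
      fix j
      show "((\<lambda>f. \<lambda>j\<in>{..<n}. move_roots (\<lambda>z. \<psi>' (\<gamma> z)) (f j)) \<circ> stabilize n {..<n} (\<lambda>z. \<beta> (\<phi> z)) (\<lambda>k. \<beta> (x k))) f j
        = stab_map n \<phi> \<psi> x f j"
      proof (cases "j < n")
        case True
        have lt: "Re (\<phi> z) < d + 1" for z using \<phi>(3)[of z] by simp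
        have xj: "Re (x j) < d + 1" using assms(9)[OF True] by simp
        have nz: "move_roots (\<lambda>z. \<beta> (\<phi> z)) (f j) \<noteq> 0"
          using f True tuple_monic[of f "\<lambda>_. d" n j] by (intro monic_polys_nonzero[OF move_roots_monic]) simp
        have "move_roots (\<lambda>z. \<psi>' (\<gamma> z)) ([:- \<beta> (x j), 1:] * move_roots (\<lambda>z. \<beta> (\<phi> z)) (f j))
            = [:- \<psi>' (\<gamma> (\<beta> (x j))), 1:] * move_roots (\<lambda>z. \<psi>' (\<gamma> (\<beta> (\<phi> z)))) (f j)"
          by (subst move_roots_mult) (use nz in \<open>simp_all add: move_roots_linear move_roots_move_roots del: mult_pCons_left\<close>)
        also have "\<dots> = [:- \<psi>' (x j), 1:] * move_roots (\<lambda>z. \<psi>' (\<phi> z)) (f j)"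
          by (simp only: \<gamma>\<beta>[OF lt] \<gamma>\<beta>[OF xj])
        also have "\<dots> = [:- inv_into UNIV \<psi> (x j), 1:] * move_roots (\<lambda>z. inv_into UNIV \<psi> (\<phi> z)) (f j)"
          by (simp only: inv[OF lt] inv[OF xj])
        also have "\<dots> = stab_map n \<phi> \<psi> x f j"
          using True by (simp add: stab_map_def poly_map_def config_image_def add_points_def roots_map_def move_roots_def
              image_mset.compositionality o_def del: mult_pCons_left)
        finally show ?thesis using True by (simp add: stabilize_def del: mult_pCons_left)
      qed (simp add: stab_map_def poly_map_def)
    qed
  qed
  \<comment> \<open>The proof yields the range with \<open>Suc d\<close> in place of
    \<open>d\<close>, the degree in the target; as \<open>2 r - 3\<close> is positive, this contains
    the asserted range.\<close>
  then have "homology_equivalence_through ?X ?Y (stab_map n \<phi> \<psi> x) ((2 * int r - 3) * int d - 2)"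
    by (rule homology_equivalence_through_mono) (use r2 in \<open>simp add: algebra_simps\<close>)
  then show ?thesis by (simp only: hX r_def)
qed

end
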